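(* Let $\Gamma=SL_2(\mathbb{Z})$ and let $\mathcal{A}$ be finite. For every $\mathbf{h}\in\mathcal{M}(\mathcal{A},\Gamma)$ there exists a family $T_1,T_2,\dots$ of elements of the set $$\mathcal{T}=\{\,(p,q)\mapsto e^{c\,(D_{f_1\cdots f_n}(p,q)-D_{f_1\cdots f_n}(-q,p))\,w}\ :\ c\in\mathbb{C},\ w\in\mathcal{B}(\mathcal{A}),\ n\ge1,\ f_1,\dots,f_n\in\{\mathbf{h}(B):B\in\mathcal{B}(\mathcal{A})\}\,\}$$ such that (1) $s_i\le s_{i+1}$ for all $i$, where $s_i$ is the maximal positive integer such that all length-$k$ components of $T_i$ vanish for $0<k<s_i$; and (2) $M_{\mathbf{h}}=T_1\bullet T_2\bullet\cdots$, where $M_{\mathbf{h}}(p,q)=D_{\mathbf{h}}(p,q)D_{\mathbf{h}}(-q,p)^{-1}$ is the multiple reciprocity function associated to $D_{\mathbf{h}}$ (the product may be infinite).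
   Context: Setting. $\mathcal{A}=\{A_1,\dots,A_m\}$ is a finite set of non-commuting symbols, each $A_i$ assigned an even integer $w_i\ge2$; for a non-empty word $B=A_{i_1}\cdots A_{i_l}$ put $w(B)=\sum_j w_{i_j}$; $\mathcal{B}(\mathcal{A})$ is the set of non-empty words, $l(w)$ the length of a word. $\mathcal{M}_k(\Gamma)$ is the space of modular forms of weight $k$, $\mathcal{M}(\mathcal{A},\Gamma)=\prod_{B\in\mathcal{B}(\mathcal{A})}\mathcal{M}_{w(B)+2}(\Gamma)$, with $B$-component $\mathbf{h}(B)$. Put $\Omega_{\mathbf{h}}(\tau)=\sum_B B\,\mathbf{h}(B)(\tau)(X-Y\tau)^{w(B)}d\tau$ and $\Omega^\infty_{\mathbf{h}}$ the same with $\mathbf{h}(B)$ replaced by its constant Fourier coefficient. For $\tau_0,\tau_1$ in the upper half plane $\mathfrak{h}$, $I_{\mathbf{h}}(\tau_0,\tau_1)=1+\int_{\tau_0}^{\tau_1}\Omega_{\mathbf{h}}+\int_{\tau_0}^{\tau_1}\Omega_{\mathbf{h}}\Omega_{\mathbf{h}}+\cdots$ (path independent) with the convention $\frac{d}{d\tau}I_{\mathbf{h}}(\tau,\tau_1)=-\Omega_{\mathbf{h}}(\tau)I_{\mathbf{h}}(\tau,\tau_1)$ and $I(\tau_0,\tau_1)I(\tau_1,\tau_2)=I(\tau_0,\tau_2)$; $I^\infty_{\mathbf{h}}$ is defined likewise from $\Omega^\infty_{\mathbf{h}}$. Regularization: $I_{\mathbf{h}}(\tau,\overrightarrow{s}_\infty)=\lim_{\varepsilon\to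 i\infty}I_{\mathbf{h}}(\tau,\varepsilon)I^\infty_{\mathbf{h}}(\varepsilon,s)$, $I_{\mathbf{h}}(\overrightarrow{s}_\infty,\tau)=I_{\mathbf{h}}(\tau,\overrightarrow{s}_\infty)^{-1}$; for a cusp $r\in\mathbb{Q}$ and $\gamma\in\Gamma$ with $\gamma(\infty)=r$, $I_{\mathbf{h}}(\overrightarrow{s}_r,\tau_1)=I_{\mathbf{h}}(\overrightarrow{\gamma^{-1}(s)}_\infty,\gamma^{-1}(\tau_1))|_\gamma$ where $P(X,Y)|_\gamma=P(aX+bY,cX+dY)$ for $\gamma=\begin{pmatrix}a&b\\c&d\end{pmatrix}$, and $I_{\mathbf{h}}(\tau_1,\overrightarrow{s}_r)=I_{\mathbf{h}}(\overrightarrow{s}_r,\tau_1)^{-1}$; finally $I_{\mathbf{h}}(\overrightarrow{s}_{r_0},\overrightarrow{t}_{r_2})=I_{\mathbf{h}}(\overrightarrow{s}_{r_0},\tau_1)I_{\mathbf{h}}(\tau_1,\overrightarrow{t}_{r_2})$ for any $\tau_1\in\mathfrak{h}$. For $(p,q)$ with $\gcd(p,q)=1$, $pq\neq0$, $D_{\mathbf{h}}(p,q)=I_{\mathbf{h}}(\overrightarrow{q/p}_\infty,\overrightarrow{\infty}_{q/p})|_{X=q,Y=p}$, a shuffled $\mathbb{C}\langle\langle\mathcal{A}\rangle\rangle^\times$-valued (almost) multiple Dedekind symbol. For modular forms $f_1,\dots,f_n$ of even weights $k_j\ge4$, $D_{f_1\cdots f_n}(p,q)$ is the coefficient of the word $a_1\cdots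 a_n$ in $D_{\mathbf{h}'}(p,q)$ where $\mathcal{A}'=\{a_1,\dots,a_n\}$ are distinct new symbols with $w_{a_j}=k_j-2$, $\mathbf{h}'(a_j)=f_j$ and $\mathbf{h}'(B)=0$ for words of length $\ge2$ (i.e. the regularized iterated integral of $f_j(\tau)(q-p\tau)^{k_j-2}d\tau$ from $\overrightarrow{q/p}_\infty$ to $\overrightarrow{\infty}_{q/p}$); it is a $\mathbb{C}$-valued Dedekind symbol, so each element of $\mathcal{T}$ is a multiple reciprocity function. Product: every (almost) multiple reciprocity function $F$ is the associated function $D_F(p,q)D_F(-q,p)^{-1}$ of a unique normalized multiple Dedekind symbol $D_F$, and $(F\bullet G)(p,q)=D_F(p,q)G(p,q)D_F(-q,p)^{-1}$. An infinite product $T_1\bullet T_2\bullet\cdots$ is understood word-by-word: each word component of it is that of the finite partial products for all sufficiently long partial products.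
   Formalization: At a finite cusp r=γ(∞) the regularized integral is transported with |_{γ^{-1}} instead of the stated |_γ, since with P|_γ=P(aX+bY,cX+dY) the stated formula depends on the choice of γ and on τ_1 and so is not well defined. *)

theory Defs
  imports "HOL-Complex_Analysis.Complex_Analysis" "HOL-Library.Extended_Nat"
begin

section \<open>Non-commutative power series\<close>

text \<open>
  A series \<open>\<Sum>\<^sub>B F(B) B\<close> is the function sending a word \<open>B\<close> to its coefficient \<open>F B\<close>. The
  series over an alphabet \<open>\<A>\<close> are those vanishing at every word not in \<open>lists \<A>\<close>.
\<close>

definition nc_one :: "'a list \<Rightarrow> complex" where
  "nc_one B = (if B = [] then 1 else 0)"

definition nc_mult :: "('a list \<Rightarrow> complex) \<Rightarrow> ('a list \<Rightarrow> complex) \<Rightarrow> 'a list \<Rightarrow> complex"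
    (infixl "\<odot>" 70) where
  "(F \<odot> G) B = (\<Sum>i\<le>length B. F (take i B) * G (drop i B))"

definition nc_inverse :: "('a list \<Rightarrow> complex) \<Rightarrow> 'a list \<Rightarrow> complex" where
  "nc_inverse F = (THE G. F \<odot> G = nc_one \<and> G \<odot> F = nc_one)"

primrec nc_pow :: "('a list \<Rightarrow> complex) \<Rightarrow> nat \<Rightarrow> 'a list \<Rightarrow> complex" where
  "nc_pow F 0 = nc_one"
| "nc_pow F (Suc n) = F \<odot> nc_pow F n"

text \<open>When \<open>F [] = 0\<close>, each of the following sums has only finitely many nonzero terms.\<close>

definition nc_exp :: "('a list \<Rightarrow> complex) \<Rightarrow> 'a list \<Rightarrow> complex" where
  "nc_exp F B = (\<Sum>n. nc_pow F n B / fact n)"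

definition nc_monom :: "complex \<Rightarrow> 'a list \<Rightarrow> 'a list \<Rightarrow> complex" where
  "nc_monom c w B = (if B = w then c else 0)"

definition words :: "'a set \<Rightarrow> 'a list set" where
  "words \<A> = lists \<A> - {[]}"

definition word_weight :: "('a \<Rightarrow> nat) \<Rightarrow> 'a list \<Rightarrow> nat" where
  "word_weight wt B = sum_list (map wt B)"


section \<open>Modular forms for the full modular group\<close>

definition SL2Z :: "(int^2^2) set" where
  "SL2Z = {\<gamma>. det \<gamma> = 1}"

definition upper_half_plane :: "complex set" where
  "upper_half_plane = {\<tau>. 0 < Im \<tau>}"

text \<open>Points of the projective line over the complex numbers.\<close>

datatype cpoint = Fin (affine: complex) | Infty

primrec moebius :: "int^2^2 \<Rightarrow> cpoint \<Rightarrow> cpoint" where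
  "moebius \<gamma> Infty =
     (if \<gamma>$2$1 = 0 then Infty else Fin (of_int (\<gamma>$1$1) / of_int (\<gamma>$2$1)))"
| "moebius \<gamma> (Fin z) =
     (if of_int (\<gamma>$2$1) * z + of_int (\<gamma>$2$2) = 0 then Infty
      else Fin ((of_int (\<gamma>$1$1) * z + of_int (\<gamma>$1$2)) / (of_int (\<gamma>$2$1) * z + of_int (\<gamma>$2$2))))"

definition fourier_expansion :: "(complex \<Rightarrow> complex) \<Rightarrow> (nat \<Rightarrow> complex) \<Rightarrow> bool" where
  "fourier_expansion f a \<longleftrightarrow>
     (\<forall>\<tau>\<in>upper_half_plane. (\<lambda>n. a n * exp (2 * of_real pi * \<i> * of_nat n * \<tau>)) sums f \<tau>)"

definition modular_forms :: "nat \<Rightarrow> (complex \<Rightarrow> complex) set" where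
  "modular_forms k = {f. f holomorphic_on upper_half_plane \<and>
     (\<forall>\<gamma>\<in>SL2Z. \<forall>\<tau>\<in>upper_half_plane.
        f (affine (moebius \<gamma> (Fin \<tau>))) = (of_int (\<gamma>$2$1) * \<tau> + of_int (\<gamma>$2$2)) ^ k * f \<tau>) \<and>
     (\<exists>a. fourier_expansion f a)}"

definition fourier_const :: "(complex \<Rightarrow> complex) \<Rightarrow> complex" where
  "fourier_const f = (THE a. fourier_expansion f a) 0"

definition modular_family :: "'a set \<Rightarrow> ('a \<Rightarrow> nat) \<Rightarrow> ('a list \<Rightarrow> complex \<Rightarrow> complex) set" where
  "modular_family \<A> wt = (\<Pi>\<^sub>E B\<in>words \<A>. modular_forms (word_weight wt B + 2))"


section \<open>Iterated integrals\<close>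

text \<open>
  Polynomials in \<open>X\<close>, \<open>Y\<close> over the complex numbers are represented by their values, so a
  series with polynomial coefficients is a family of complex series depending on complex
  arguments \<open>X\<close> and \<open>Y\<close>. In \<open>Omega\<close> and \<open>Omega_infty\<close> the factor \<open>d\<tau>\<close> is left implicit.
\<close>

definition Omega :: "'a set \<Rightarrow> ('a \<Rightarrow> nat) \<Rightarrow> ('a list \<Rightarrow> complex \<Rightarrow> complex) \<Rightarrow>
    complex \<Rightarrow> complex \<Rightarrow> complex \<Rightarrow> 'a list \<Rightarrow> complex" where
  "Omega \<A> wt h X Y \<tau> B =
     (if B \<in> words \<A> then h B \<tau> * (X - Y * \<tau>) ^ word_weight wt B else 0)"

definition Omega_infty :: "'a set \<Rightarrow> ('a \<Rightarrow> nat) \<Rightarrow> ('a list \<Rightarrow> complex \<Rightarrow> complex) \<Rightarrow>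
    complex \<Rightarrow> complex \<Rightarrow> complex \<Rightarrow> 'a list \<Rightarrow> complex" where
  "Omega_infty \<A> wt h X Y \<tau> B =
     (if B \<in> words \<A> then fourier_const (h B) * (X - Y * \<tau>) ^ word_weight wt B else 0)"

text \<open>
  \<open>iter_int \<omega> n \<tau>\<^sub>0 \<tau>\<^sub>1\<close> is the \<open>n\<close>-fold iterated integral of \<open>\<omega>\<close> along the segment from
  \<open>\<tau>\<^sub>0\<close> to \<open>\<tau>\<^sub>1\<close>, with the leftmost factor integrated at the point closest to \<open>\<tau>\<^sub>0\<close>.
\<close>

primrec iter_int :: "(complex \<Rightarrow> 'a list \<Rightarrow> complex) \<Rightarrow> nat \<Rightarrow>
    complex \<Rightarrow> complex \<Rightarrow> 'a list \<Rightarrow> complex" where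
  "iter_int \<omega> 0 = (\<lambda>\<tau>\<^sub>0 \<tau>\<^sub>1. nc_one)"
| "iter_int \<omega> (Suc n) = (\<lambda>\<tau>\<^sub>0 \<tau>\<^sub>1 B.
     contour_integral (linepath \<tau>\<^sub>0 \<tau>\<^sub>1) (\<lambda>t. (\<omega> t \<odot> iter_int \<omega> n t \<tau>\<^sub>1) B))"

text \<open>
  If \<open>\<omega> t [] = 0\<close>, only the terms with \<open>n \<le> length B\<close> contribute to the coefficient of \<open>B\<close>.
\<close>

definition iter_series :: "(complex \<Rightarrow> 'a list \<Rightarrow> complex) \<Rightarrow>
    complex \<Rightarrow> complex \<Rightarrow> 'a list \<Rightarrow> complex" where
  "iter_series \<omega> \<tau>\<^sub>0 \<tau>\<^sub>1 B = (\<Sum>n. iter_int \<omega> n \<tau>\<^sub>0 \<tau>\<^sub>1 B)"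

definition II :: "'a set \<Rightarrow> ('a \<Rightarrow> nat) \<Rightarrow> ('a list \<Rightarrow> complex \<Rightarrow> complex) \<Rightarrow>
    complex \<Rightarrow> complex \<Rightarrow> complex \<Rightarrow> complex \<Rightarrow> 'a list \<Rightarrow> complex" where
  "II \<A> wt h \<tau>\<^sub>0 \<tau>\<^sub>1 X Y = iter_series (Omega \<A> wt h X Y) \<tau>\<^sub>0 \<tau>\<^sub>1"

definition II_infty :: "'a set \<Rightarrow> ('a \<Rightarrow> nat) \<Rightarrow> ('a list \<Rightarrow> complex \<Rightarrow> complex) \<Rightarrow>
    complex \<Rightarrow> complex \<Rightarrow> complex \<Rightarrow> complex \<Rightarrow> 'a list \<Rightarrow> complex" where
  "II_infty \<A> wt h \<tau>\<^sub>0 \<tau>\<^sub>1 X Y = iter_series (Omega_infty \<A> wt h X Y) \<tau>\<^sub>0 \<tau>\<^sub>1"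

text \<open>
  The limit \<open>\<epsilon> \<rightarrow> i\<infinity>\<close> is taken coefficientwise along the imaginary axis; any other vertical
  line gives the same value.
\<close>

definition II_to_infty :: "'a set \<Rightarrow> ('a \<Rightarrow> nat) \<Rightarrow> ('a list \<Rightarrow> complex \<Rightarrow> complex) \<Rightarrow>
    complex \<Rightarrow> complex \<Rightarrow> complex \<Rightarrow> complex \<Rightarrow> 'a list \<Rightarrow> complex" where
  "II_to_infty \<A> wt h \<tau> s X Y B =
     Lim at_top (\<lambda>y::real. (II \<A> wt h \<tau> (\<i> * of_real y) X Y \<odot>
                            II_infty \<A> wt h (\<i> * of_real y) s X Y) B)"

definition II_from_infty :: "'a set \<Rightarrow> ('a \<Rightarrow> nat) \<Rightarrow> ('a list \<Rightarrow> complex \<Rightarrow> complex) \<Rightarrow>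
    complex \<Rightarrow> complex \<Rightarrow> complex \<Rightarrow> complex \<Rightarrow> 'a list \<Rightarrow> complex" where
  "II_from_infty \<A> wt h s \<tau> X Y = nc_inverse (II_to_infty \<A> wt h \<tau> s X Y)"

definition slash :: "(complex \<Rightarrow> complex \<Rightarrow> 'b) \<Rightarrow> int^2^2 \<Rightarrow> complex \<Rightarrow> complex \<Rightarrow> 'b" where
  "slash P \<gamma> X Y = P (of_int (\<gamma>$1$1) * X + of_int (\<gamma>$1$2) * Y)
                     (of_int (\<gamma>$2$1) * X + of_int (\<gamma>$2$2) * Y)"

text \<open>
  \<open>II_from \<A> wt h s r \<tau>\<close> is the regularized iterated integral from the tangential base point
  \<open>s\<close> at the cusp \<open>r\<close> to \<open>\<tau>\<close>. With \<open>slash\<close> as above,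
  \<open>Omega(\<gamma> \<tau>) d(\<gamma> \<tau>) = slash (Omega(\<tau>) d\<tau>) \<gamma>\<^sup>-\<^sup>1\<close>, so the transport from \<open>\<infinity>\<close> to
  \<open>r = \<gamma>(\<infinity>)\<close> is by \<open>slash\<close> with \<open>\<gamma>\<^sup>-\<^sup>1\<close>. It is this choice that makes the result independent
  of \<open>\<gamma>\<close> and compatible with composition of paths.
\<close>

primrec II_from :: "'a set \<Rightarrow> ('a \<Rightarrow> nat) \<Rightarrow> ('a list \<Rightarrow> complex \<Rightarrow> complex) \<Rightarrow>
    cpoint \<Rightarrow> cpoint \<Rightarrow> complex \<Rightarrow> complex \<Rightarrow> complex \<Rightarrow> 'a list \<Rightarrow> complex" where
  "II_from \<A> wt h s Infty = (\<lambda>\<tau>. II_from_infty \<A> wt h (affine s) \<tau>)"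
| "II_from \<A> wt h s (Fin r) = (\<lambda>\<tau>.
     let \<gamma> = (SOME \<gamma>. \<gamma> \<in> SL2Z \<and> moebius \<gamma> Infty = Fin r); \<delta> = matrix_inv \<gamma>
     in slash (II_from_infty \<A> wt h (affine (moebius \<delta> s)) (affine (moebius \<delta> (Fin \<tau>)))) \<delta>)"

definition II_to :: "'a set \<Rightarrow> ('a \<Rightarrow> nat) \<Rightarrow> ('a list \<Rightarrow> complex \<Rightarrow> complex) \<Rightarrow>
    complex \<Rightarrow> cpoint \<Rightarrow> cpoint \<Rightarrow> complex \<Rightarrow> complex \<Rightarrow> 'a list \<Rightarrow> complex" where
  "II_to \<A> wt h \<tau> s r X Y = nc_inverse (II_from \<A> wt h s r \<tau> X Y)"

text \<open>The value does not depend on the intermediate point of the upper half plane; we use \<open>\<i>\<close>.\<close>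

definition II_cusps :: "'a set \<Rightarrow> ('a \<Rightarrow> nat) \<Rightarrow> ('a list \<Rightarrow> complex \<Rightarrow> complex) \<Rightarrow>
    cpoint \<Rightarrow> cpoint \<Rightarrow> cpoint \<Rightarrow> cpoint \<Rightarrow> complex \<Rightarrow> complex \<Rightarrow> 'a list \<Rightarrow> complex" where
  "II_cusps \<A> wt h s r\<^sub>0 t r\<^sub>2 X Y = II_from \<A> wt h s r\<^sub>0 \<i> X Y \<odot> II_to \<A> wt h \<i> t r\<^sub>2 X Y"


section \<open>Multiple Dedekind symbols and reciprocity functions\<close>

definition dedekind_dom :: "(int \<times> int) set" where
  "dedekind_dom = {(p, q). coprime p q \<and> p * q \<noteq> 0}"

definition DD :: "'a set \<Rightarrow> ('a \<Rightarrow> nat) \<Rightarrow> ('a list \<Rightarrow> complex \<Rightarrow> complex) \<Rightarrow>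
    int \<Rightarrow> int \<Rightarrow> 'a list \<Rightarrow> complex" where
  "DD \<A> wt h p q =
     II_cusps \<A> wt h (Fin (of_int q / of_int p)) Infty Infty (Fin (of_int q / of_int p))
       (of_int q) (of_int p)"

definition MM :: "'a set \<Rightarrow> ('a \<Rightarrow> nat) \<Rightarrow> ('a list \<Rightarrow> complex \<Rightarrow> complex) \<Rightarrow>
    int \<Rightarrow> int \<Rightarrow> 'a list \<Rightarrow> complex" where
  "MM \<A> wt h p q = DD \<A> wt h p q \<odot> nc_inverse (DD \<A> wt h (- q) p)"

text \<open>
  Modular forms are given here together with their weights, as pairs \<open>(k\<^sub>j, f\<^sub>j)\<close>; the letters
  of the auxiliary alphabet are the indices \<open>j < n\<close>.
\<close>

definition DD_forms :: "(nat \<times> (complex \<Rightarrow> complex)) list \<Rightarrow> int \<Rightarrow> int \<Rightarrow> complex" where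
  "DD_forms fs p q =
     DD {..<length fs} (\<lambda>j. fst (fs ! j) - 2)
        (\<lambda>B\<in>words {..<length fs}. if length B = 1 then snd (fs ! hd B) else (\<lambda>_. 0))
        p q [0..<length fs]"

definition recip_set :: "'a set \<Rightarrow> ('a \<Rightarrow> nat) \<Rightarrow> ('a list \<Rightarrow> complex \<Rightarrow> complex) \<Rightarrow>
    (int \<Rightarrow> int \<Rightarrow> 'a list \<Rightarrow> complex) set" where
  "recip_set \<A> wt h =
     {\<lambda>p q. nc_exp (nc_monom (c * (DD_forms fs p q - DD_forms fs (- q) p)) w) | c w fs.
        w \<in> words \<A> \<and> fs \<noteq> [] \<and>
        set fs \<subseteq> {(word_weight wt B + 2, h B) | B. B \<in> words \<A>}}"

text \<open>A series is a unit iff its constant coefficient is nonzero.\<close>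

definition normalized_dedekind_symbol :: "(int \<Rightarrow> int \<Rightarrow> 'a list \<Rightarrow> complex) \<Rightarrow> bool" where
  "normalized_dedekind_symbol D \<longleftrightarrow>
     (\<forall>(p, q)\<in>dedekind_dom. D p q [] \<noteq> 0) \<and>
     (\<forall>(p, q)\<in>dedekind_dom. (p, q + p) \<in> dedekind_dom \<longrightarrow> D p (q + p) = D p q) \<and>
     (\<forall>(p, q)\<in>dedekind_dom. D p (- q) = D (- p) q) \<and>
     D 1 1 = nc_one"

text \<open>
  The normalized Dedekind symbol of a reciprocity function. The values outside
  \<open>dedekind_dom\<close> carry no information and are fixed only to make the symbol unique.
\<close>

definition dedekind_of :: "(int \<Rightarrow> int \<Rightarrow> 'a list \<Rightarrow> complex) \<Rightarrow>
    int \<Rightarrow> int \<Rightarrow> 'a list \<Rightarrow> complex" where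
  "dedekind_of F = (THE D. normalized_dedekind_symbol D \<and>
     (\<forall>(p, q)\<in>dedekind_dom. F p q = D p q \<odot> nc_inverse (D (- q) p)) \<and>
     (\<forall>p q. (p, q) \<notin> dedekind_dom \<longrightarrow> D p q = nc_one))"

definition recip_mult :: "(int \<Rightarrow> int \<Rightarrow> 'a list \<Rightarrow> complex) \<Rightarrow>
    (int \<Rightarrow> int \<Rightarrow> 'a list \<Rightarrow> complex) \<Rightarrow> int \<Rightarrow> int \<Rightarrow> 'a list \<Rightarrow> complex" where
  "recip_mult F G p q = dedekind_of F p q \<odot> G p q \<odot> nc_inverse (dedekind_of F (- q) p)"

primrec recip_partial_prod :: "(nat \<Rightarrow> int \<Rightarrow> int \<Rightarrow> 'a list \<Rightarrow> complex) \<Rightarrow> nat \<Rightarrow>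
    int \<Rightarrow> int \<Rightarrow> 'a list \<Rightarrow> complex" where
  "recip_partial_prod T 0 = (\<lambda>p q. nc_one)"
| "recip_partial_prod T (Suc n) = recip_mult (recip_partial_prod T n) (T n)"

text \<open>
  The product of the family \<open>T\<^sub>0, T\<^sub>1, \<dots>\<close> of \<open>N\<close> factors, \<open>N \<le> \<infinity>\<close>. For finite \<open>N\<close> the last
  partial product \<open>n = N\<close> is the full product.
\<close>

definition is_recip_prod :: "enat \<Rightarrow> (nat \<Rightarrow> int \<Rightarrow> int \<Rightarrow> 'a list \<Rightarrow> complex) \<Rightarrow>
    (int \<Rightarrow> int \<Rightarrow> 'a list \<Rightarrow> complex) \<Rightarrow> bool" where
  "is_recip_prod N T F \<longleftrightarrow>
     (\<forall>B. \<exists>n\<^sub>0. enat n\<^sub>0 \<le> N \<and>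
        (\<forall>n\<ge>n\<^sub>0. enat n \<le> N \<longrightarrow> (\<forall>(p, q)\<in>dedekind_dom. recip_partial_prod T n p q B = F p q B)))"

text \<open>The value is \<open>\<infinity>\<close> iff all components of positive length vanish.\<close>

definition vanishing_level :: "(int \<Rightarrow> int \<Rightarrow> 'a list \<Rightarrow> complex) \<Rightarrow> enat" where
  "vanishing_level T = Sup {enat s | s. 0 < s \<and>
     (\<forall>k. 0 < k \<and> k < s \<longrightarrow>
        (\<forall>B. length B = k \<longrightarrow> (\<forall>(p, q)\<in>dedekind_dom. T p q B = 0)))}"

end

theory Submission
  imports Defs
begin

text \<open>
  Substituting for each letter the sum of the words carrying the corresponding modular form turns
  \<open>D\<^sub>h\<close> into a specialization of one universal series \<open>D\<close>, whose coefficient at a word of modular forms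
  is the regularized iterated integral of these forms. Limits of products of iterated integrals are
  group-like, so products of coefficients of \<open>D\<close> are linear combinations of coefficients of \<open>D\<close>
  (shuffle relations), and the span of these coefficients is an algebra of Dedekind symbols.

  Under the correspondence between reciprocity functions and normalized Dedekind symbols, the
  product \<open>\<bullet>\<close> is the pointwise product of symbols. So \<open>D\<^sub>h D\<^sub>h(1,1)\<^sup>-\<^sup>1\<close> has to be written as an
  ordered product of exponentials \<open>exp (c (D\<^bsub>f\<^esub> - D\<^bsub>f\<^esub>(1,1)) w)\<close>. This is done by length: if a
  partial product is correct in lengths up to \<open>k\<close>, its error at a word \<open>w\<close> of length \<open>k + 1\<close> lies in
  the span and vanishes at \<open>(1,1)\<close>, hence is corrected by finitely many factors with the word \<open>w\<close>.
  Factors with trivial reciprocity function have infinite vanishing level and are dropped; they are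
  trivial as symbols because a symbol is determined by its reciprocity function.
\<close>

section \<open>Non-commutative power series\<close>

text \<open>The obstacle is that \<open>h\<close> attaches forms to words of every length, so the
  coefficients of \<open>DD \<A> wt h\<close> need not satisfy shuffle relations over the alphabet
  \<open>\<A>\<close>. They are combinations of coefficients that do, once every modular form,
  paired with its weight, becomes a letter. The relations are needed because the error at a word is
  a polynomial in symbols, while a factor contributes only a scalar multiple of a single symbol.
  Subtracting the value at (1, 1) normalizes a factor without changing its reciprocity function,
  whose exponent is a difference. Integrals run along straight segments, which modular
  transformations do not preserve; therefore identities between iterated integrals are proved by
  comparing derivatives and one value. Invariance under q -> q + p rests on the equality of the
  regularized limits along iy and iy + 1, and on independence of the matrix chosen for a
  cusp.\<close>

lemma nc_mult_Nil [simp]: "(F \<odot> G) [] = F [] * G []"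
  by (simp add: nc_mult_def)

text \<open>Removing the first letter acts as a Fox derivation. Associativity and the substitution
  and shuffle identities for products all reduce to this rule.\<close>

lemma nc_mult_Cons: "(F \<odot> G) (x # B) = F [] * G (x # B) + ((\<lambda>C. F (x # C)) \<odot> G) B"
  unfolding nc_mult_def by (simp add: sum.atMost_Suc_shift del: sum.atMost_Suc)

lemma nc_mult_add_left: "((\<lambda>C. F C + G C) \<odot> H) B = (F \<odot> H) B + (G \<odot> H) B"
  by (simp add: nc_mult_def algebra_simps sum.distrib)

lemma nc_mult_scale_left: "((\<lambda>C. c * F C) \<odot> H) B = c * (F \<odot> H) B"
  by (simp add: nc_mult_def algebra_simps sum_distrib_left)

lemma nc_mult_zero_left: "((\<lambda>C. 0) \<odot> H) B = 0"
  by (simp add: nc_mult_def)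

lemma nc_one_Nil [simp]: "nc_one [] = 1"
  by (simp add: nc_one_def)

lemma nc_one_Cons [simp]: "nc_one (x # B) = 0"
  by (simp add: nc_one_def)

lemma nc_mult_one_left [simp]: "nc_one \<odot> F = F"
proof
  show "(nc_one \<odot> F) B = F B" for B
    by (cases B) (simp_all add: nc_mult_Cons nc_mult_zero_left)
qed

lemma nc_mult_one_right [simp]: "F \<odot> nc_one = F"
proof
  show "(F \<odot> nc_one) B = F B" for B
    by (induction B arbitrary: F) (simp_all add: nc_mult_Cons)
qed

lemma nc_mult_assoc: "F \<odot> G \<odot> H = F \<odot> (G \<odot> H)"
proof
  show "(F \<odot> G \<odot> H) B = (F \<odot> (G \<odot> H)) B" for B
    by (induction B arbitrary: F)
      (simp_all add: nc_mult_Cons nc_mult_add_left nc_mult_scale_left algebra_simps)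
qed

lemma nc_mult_cong:
  assumes "\<And>C. length C \<le> length B \<Longrightarrow> F C = F' C"
    and "\<And>C. length C \<le> length B \<Longrightarrow> G C = G' C"
  shows "(F \<odot> G) B = (F' \<odot> G') B"
  using assms by (simp add: nc_mult_def)

text \<open>Solves \<open>F \<odot> G = nc_one\<close> for \<open>G\<close> one coefficient at a
  time. This gives the definite description \<open>nc_inverse\<close> a recursive value on which
  truncation and support can be checked by induction.\<close>

fun nc_rinv :: "('a list \<Rightarrow> complex) \<Rightarrow> 'a list \<Rightarrow> complex" where
  "nc_rinv F [] = 1 / F []"
| "nc_rinv F (x # B) = - (\<Sum>i\<le>length B. F (x # take i B) * nc_rinv F (drop i B)) / F []"

lemma nc_mult_rinv:
  assumes "F [] \<noteq> 0"
  shows "F \<odot> nc_rinv F = nc_one"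
proof
  show "(F \<odot> nc_rinv F) B = nc_one B" for B
    using assms
    by (cases B) (simp_all only: nc_mult_Cons nc_rinv.simps nc_one_Cons, simp_all add: nc_mult_def)
qed

text \<open>The right inverse of \<open>F\<close> has a right inverse of its own, which must then be
  \<open>F\<close>.\<close>

lemma nc_rinv_mult:
  assumes "F [] \<noteq> 0"
  shows "nc_rinv F \<odot> F = nc_one"
proof -
  let ?G = "nc_rinv F"
  have G: "?G \<odot> nc_rinv ?G = nc_one"
    by (rule nc_mult_rinv) (use assms in simp)
  have "F = F \<odot> (?G \<odot> nc_rinv ?G)"
    using G by simp
  also have "\<dots> = nc_rinv ?G"
    using nc_mult_rinv[of F, OF assms] by (simp flip: nc_mult_assoc)
  finally show ?thesis
    using G by simp
qed

text \<open>A one-sided inverse suffices, so later identifications check a single product.\<close>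

lemma nc_inverse_unique:
  assumes "F \<odot> G = nc_one"
  shows "nc_inverse F = G"
proof -
  have "(F \<odot> G) [] = 1"
    using assms by simp
  hence F0: "F [] \<noteq> 0"
    by auto
  have G: "G = nc_rinv F" if "F \<odot> G = nc_one" for G
  proof -
    have "G = nc_rinv F \<odot> F \<odot> G"
      by (simp add: nc_rinv_mult F0)
    also have "\<dots> = nc_rinv F"
      by (simp add: nc_mult_assoc that)
    finally show ?thesis .
  qed
  show ?thesis
    unfolding nc_inverse_def
  proof (rule the_equality)
    show "F \<odot> G = nc_one \<and> G \<odot> F = nc_one"
      using assms G[OF assms] nc_rinv_mult[of F, OF F0] by simp
  next
    fix H assume "F \<odot> H = nc_one \<and> H \<odot> F = nc_one"
    thus "H = G"
      using G[of H] G[OF assms] by simp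
  qed
qed

lemma nc_inverse_eq_rinv: "F [] \<noteq> 0 \<Longrightarrow> nc_inverse F = nc_rinv F"
  by (rule nc_inverse_unique) (rule nc_mult_rinv)

lemma nc_inverse_right: "F [] \<noteq> 0 \<Longrightarrow> F \<odot> nc_inverse F = nc_one"
  by (simp add: nc_inverse_eq_rinv nc_mult_rinv)

lemma nc_inverse_left: "F [] \<noteq> 0 \<Longrightarrow> nc_inverse F \<odot> F = nc_one"
  by (simp add: nc_inverse_eq_rinv nc_rinv_mult)

lemma nc_inverse_Nil: "F [] \<noteq> 0 \<Longrightarrow> nc_inverse F [] = 1 / F []"
  by (simp add: nc_inverse_eq_rinv)

lemma nc_inverse_one [simp]: "nc_inverse nc_one = nc_one"
  by (rule nc_inverse_unique) simp

lemma nc_inverse_inverse: "F [] \<noteq> 0 \<Longrightarrow> nc_inverse (nc_inverse F) = F"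
  by (rule nc_inverse_unique) (rule nc_inverse_left)

lemma nc_inverse_mult:
  assumes "F [] \<noteq> 0" "G [] \<noteq> 0"
  shows "nc_inverse (F \<odot> G) = nc_inverse G \<odot> nc_inverse F"
proof (rule nc_inverse_unique)
  have "F \<odot> G \<odot> (nc_inverse G \<odot> nc_inverse F) = F \<odot> (G \<odot> nc_inverse G) \<odot> nc_inverse F"
    by (simp add: nc_mult_assoc)
  thus "F \<odot> G \<odot> (nc_inverse G \<odot> nc_inverse F) = nc_one"
    using assms by (simp add: nc_inverse_right)
qed

text \<open>Inversion respects truncation. This is needed when a partial product agrees with its
  target only up to a given length.\<close>

lemma nc_inverse_cong:
  assumes "F [] \<noteq> 0" "\<And>C. length C \<le> length B \<Longrightarrow> F C = G C"
  shows "nc_inverse F B = nc_inverse G B"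
proof -
  have "nc_rinv F B = nc_rinv G B"
    using assms(2)
  proof (induction B rule: length_induct)
    case (1 B)
    show ?case
    proof (cases B)
      case (Cons x C)
      have "nc_rinv F (drop i C) = nc_rinv G (drop i C)" for i
        using 1 Cons by auto
      moreover have "F (x # take i C) = G (x # take i C)" for i
        using 1 Cons by auto
      moreover have "F [] = G []"
        using 1 by auto
      ultimately show ?thesis
        using Cons by simp
    qed (use 1 in auto)
  qed
  moreover have "G [] \<noteq> 0"
    using assms by force
  ultimately show ?thesis
    using assms(1) by (simp add: nc_inverse_eq_rinv)
qed

lemma nc_mult_supported:
  assumes "\<And>C. C \<notin> lists A \<Longrightarrow> F C = 0" "\<And>C. C \<notin> lists A \<Longrightarrow> G C = 0" "B \<notin> lists A"
  shows "(F \<odot> G) B = 0"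
proof -
  have *: "F (take i B) * G (drop i B) = 0" for i
  proof (cases "take i B \<in> lists A")
    case True
    hence "drop i B \<notin> lists A"
      using assms(3) append_in_lists_conv[of "take i B" "drop i B" A] by simp
    thus ?thesis
      using assms(2) by simp
  qed (simp add: assms(1))
  show ?thesis
    unfolding nc_mult_def * by simp
qed

lemma nc_inverse_supported:
  assumes "F [] \<noteq> 0" "\<And>C. C \<notin> lists A \<Longrightarrow> F C = 0" "B \<notin> lists A"
  shows "nc_inverse F B = 0"
proof -
  have "nc_rinv F B = 0"
    using assms(3)
  proof (induction B rule: length_induct)
    case (1 B)
    then obtain x C where B: "B = x # C"
      by (cases B) auto
    have *: "F (x # take i C) * nc_rinv F (drop i C) = 0" for i
    proof (cases "drop i C \<in> lists A")
      case True
      hence "x # take i C \<notin> lists A"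
        using 1(2) B append_in_lists_conv[of "x # take i C" "drop i C" A] by auto
      thus ?thesis
        using assms(2) by simp
    next
      case False
      hence "nc_rinv F (drop i C) = 0"
        using 1(1) B by auto
      thus ?thesis
        by simp
    qed
    show ?case
      unfolding B nc_rinv.simps * by simp
  qed
  thus ?thesis
    using assms(1) by (simp add: nc_inverse_eq_rinv)
qed

subsection \<open>Exponentials of monomials\<close>

text \<open>Each of the \<open>n\<close> factors uses up at least one letter. The series in
  \<open>nc_exp\<close> thereby becomes a finite sum at every word.\<close>

lemma nc_pow_eq_0:
  assumes "F [] = 0" "length B < n"
  shows "nc_pow F n B = 0"
  using assms(2)
proof (induction n arbitrary: B)
  case (Suc n)
  have *: "F (take i B) * nc_pow F n (drop i B) = 0" for i
  proof (cases "i = 0 \<or> B = []")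
    case False
    hence "length (drop i B) < n"
      using Suc.prems by (cases B) auto
    thus ?thesis
      using Suc.IH by simp
  qed (use assms(1) in auto)
  show ?case
    unfolding nc_pow.simps nc_mult_def * by simp
qed simp

lemma nc_pow_add: "nc_pow F (m + n) = nc_pow F m \<odot> nc_pow F n"
  by (induction m) (simp_all add: nc_mult_assoc)

lemma nc_monom_Nil [simp]: "w \<noteq> [] \<Longrightarrow> nc_monom c w [] = 0"
  by (simp add: nc_monom_def)

lemma nc_pow_monom: "nc_pow (nc_monom c w) n B = c ^ n * nc_pow (nc_monom 1 w) n B"
proof (induction n arbitrary: B)
  case (Suc n)
  have "nc_monom c w (take i B) = c * nc_monom 1 w (take i B)" for i
    by (simp add: nc_monom_def)
  thus ?case
    unfolding nc_pow.simps nc_mult_def sum_distrib_left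
    by (intro sum.cong refl) (simp add: Suc.IH[of "drop _ B"])
qed simp

lemma nc_exp_monom:
  assumes "w \<noteq> []" "length B \<le> N"
  shows "nc_exp (nc_monom c w) B = (\<Sum>n\<le>N. c ^ n / fact n * nc_pow (nc_monom 1 w) n B)"
proof -
  have "nc_exp (nc_monom c w) B = (\<Sum>n\<le>N. nc_pow (nc_monom c w) n B / fact n)"
    unfolding nc_exp_def using assms
    by (intro suminf_finite) (auto intro!: nc_pow_eq_0)
  thus ?thesis
    unfolding nc_pow_monom[of c] by simp
qed

lemma nc_exp_monom_0:
  assumes "w \<noteq> []"
  shows "nc_exp (nc_monom 0 w) = nc_one"
proof
  show "nc_exp (nc_monom 0 w) B = nc_one B" for B
    using assms
    by (subst nc_exp_monom[of w B "length B"])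
      (auto simp: power_0_left if_distrib[of "\<lambda>x. x / _"] if_distrib[of "\<lambda>x. x * _"] sum.delta cong: if_cong)
qed

text \<open>Powers of one monomial commute, so the usual binomial computation applies; both sums are
  cut at \<open>N = length B\<close> to make it a finite rearrangement.\<close>

lemma nc_exp_monom_add:
  assumes "w \<noteq> []"
  shows "nc_exp (nc_monom (c + d) w) = nc_exp (nc_monom c w) \<odot> nc_exp (nc_monom d w)"
proof
  fix B :: "'a list"
  define N where "N = length B"
  define m where "m = nc_pow (nc_monom 1 w)"
  have m0: "m n B = 0" if "\<not> n \<le> N" for n
    using that assms unfolding m_def N_def not_le by (intro nc_pow_eq_0) auto
  have "(nc_exp (nc_monom c w) \<odot> nc_exp (nc_monom d w)) B =
      (\<Sum>i\<le>N. (\<Sum>a\<le>N. c ^ a / fact a * m a (take i B)) * (\<Sum>b\<le>N. d ^ b / fact b * m b (drop i B)))"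
    unfolding nc_mult_def N_def m_def using assms
    by (intro sum.cong refl arg_cong2[where f = "(*)"] nc_exp_monom) auto
  also have "\<dots> = (\<Sum>i\<le>N. \<Sum>a\<le>N. \<Sum>b\<le>N.
      c ^ a / fact a * (d ^ b / fact b) * (m a (take i B) * m b (drop i B)))"
    by (simp add: sum_product mult_ac)
  also have "\<dots> = (\<Sum>a\<le>N. \<Sum>b\<le>N. \<Sum>i\<le>N.
      c ^ a / fact a * (d ^ b / fact b) * (m a (take i B) * m b (drop i B)))"
    by (subst sum.swap, rule sum.cong[OF refl], subst sum.swap) simp
  also have "\<dots> = (\<Sum>a\<le>N. \<Sum>b\<le>N. c ^ a / fact a * (d ^ b / fact b) * m (a + b) B)"
    by (simp add: m_def nc_pow_add nc_mult_def N_def sum_distrib_left)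
  also have "\<dots> = (\<Sum>(a,b)\<in>{..N}\<times>{..N}. c ^ a / fact a * (d ^ b / fact b) * m (a + b) B)"
    by (simp add: sum.cartesian_product)
  \<comment> \<open>Pairs with \<open>a + b > N\<close> drop out: the corresponding power needs more
    letters than \<open>B\<close> has.\<close>
  also have "\<dots> = (\<Sum>(a,b)\<in>{(a,b). a + b \<le> N}. c ^ a / fact a * (d ^ b / fact b) * m (a + b) B)"
    by (rule sum.mono_neutral_right) (auto, metis m0)
  also have "\<dots> = (\<Sum>k\<le>N. \<Sum>a\<le>k. c ^ a / fact a * (d ^ (k - a) / fact (k - a)) * m (a + (k - a)) B)"
    by (rule sum.triangle_reindex_eq)
  also have "\<dots> = (\<Sum>k\<le>N. (c + d) ^ k / fact k * m k B)"
  proof (rule sum.cong[OF refl])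
    fix k
    have "(c + d) ^ k / fact k = (\<Sum>a\<le>k. c ^ a / fact a * (d ^ (k - a) / fact (k - a)))"
      by (simp add: binomial_ring sum_divide_distrib binomial_fact divide_simps)
    thus "(\<Sum>a\<le>k. c ^ a / fact a * (d ^ (k - a) / fact (k - a)) * m (a + (k - a)) B) =
        (c + d) ^ k / fact k * m k B"
      by (simp add: sum_distrib_right)
  qed
  also have "\<dots> = nc_exp (nc_monom (c + d) w) B"
    unfolding m_def N_def by (rule nc_exp_monom[OF assms order_refl, symmetric])
  finally show "nc_exp (nc_monom (c + d) w) B = (nc_exp (nc_monom c w) \<odot> nc_exp (nc_monom d w)) B"
    by simp
qed

text \<open>On words not longer than \<open>w\<close> only the terms of degree 0 and 1 of the
  exponential are visible.\<close>

lemma nc_exp_monom_short: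
  assumes "w \<noteq> []" "length B \<le> length w"
  shows "nc_exp (nc_monom c w) B = nc_one B + (if B = w then c else 0)"
proof -
  have "nc_pow (nc_monom 1 w) n B = (if n = 0 then nc_one B else if n = 1 \<and> B = w then 1 else 0)" for n
  proof (cases n)
    case (Suc k)
    have "nc_monom 1 w (take i B) * nc_pow (nc_monom 1 w) k (drop i B) =
       (if i = length B then if B = w then nc_pow (nc_monom 1 w) k [] else 0 else 0)" if "i \<le> length B" for i
      using that assms by (auto simp: nc_monom_def)
    hence "nc_pow (nc_monom 1 w) n B = (if B = w then nc_pow (nc_monom 1 w) k [] else 0)"
      using Suc by (simp add: nc_mult_def)
    moreover have "nc_pow (nc_monom 1 w) k [] = (if k = 0 then 1 else 0)"
      using assms(1) by (cases k) auto
    ultimately show ?thesis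
      using Suc by auto
  qed simp
  moreover have "nc_exp (nc_monom c w) B =
      (\<Sum>n\<le>Suc (length B). c ^ n / fact n * nc_pow (nc_monom 1 w) n B)"
    using assms(1) by (intro nc_exp_monom) auto
  moreover have "(\<Sum>n\<le>k. if n = 0 \<and> P then c else 0) = (if P then c else 0)" for k :: nat and P
    by (induction k) auto
  ultimately show ?thesis
    by (simp add: sum.atMost_Suc_shift if_distrib[of "\<lambda>x. _ * x"] del: sum.atMost_Suc cong: if_cong)
qed

lemma nc_pow_monom_supported:
  assumes "w \<in> lists A" "B \<notin> lists A"
  shows "nc_pow (nc_monom c w) n B = 0"
  using assms(2)
proof (induction n arbitrary: B)
  case (Suc n)
  thus ?case
    unfolding nc_pow.simps using assms(1)
    by (intro nc_mult_supported[of A "nc_monom c w"]) (metis nc_monom_def, blast, blast)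
qed (auto simp: nc_one_def)

subsection \<open>Substitution\<close>

text \<open>The homomorphism sending a letter \<open>x\<close> to the sum of all words \<open>B\<close> with \<open>\<phi> B = Some x\<close>.\<close>

fun nc_subst :: "('a list \<Rightarrow> 'b option) \<Rightarrow> ('b list \<Rightarrow> complex) \<Rightarrow> 'a list \<Rightarrow> complex" where
  "nc_subst \<phi> F [] = F []"
| "nc_subst \<phi> F (x # B) = (\<Sum>i\<le>length B. case \<phi> (x # take i B) of None \<Rightarrow> 0
      | Some y \<Rightarrow> nc_subst \<phi> (\<lambda>C. F (y # C)) (drop i B))"

lemma nc_subst_add: "nc_subst \<phi> (\<lambda>C. F C + G C) B = nc_subst \<phi> F B + nc_subst \<phi> G B"
proof (induction B arbitrary: F G rule: length_induct)
  case (1 B)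
  show ?case
  proof (cases B)
    case (Cons x D)
    have "nc_subst \<phi> (\<lambda>C. F C + G C) (drop i D) = nc_subst \<phi> F (drop i D) + nc_subst \<phi> G (drop i D)"
      for i F G using 1 Cons by auto
    thus ?thesis
      unfolding Cons nc_subst.simps sum.distrib[symmetric]
      by (intro sum.cong refl) (auto split: option.split)
  qed simp
qed

lemma nc_subst_scale: "nc_subst \<phi> (\<lambda>C. c * F C) B = c * nc_subst \<phi> F B"
proof (induction B arbitrary: F rule: length_induct)
  case (1 B)
  show ?case
  proof (cases B)
    case (Cons x D)
    have "nc_subst \<phi> (\<lambda>C. c * F C) (drop i D) = c * nc_subst \<phi> F (drop i D)"
      for i F using 1 Cons by auto
    thus ?thesis
      unfolding Cons nc_subst.simps sum_distrib_left
      by (intro sum.cong refl) (auto split: option.split)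
  qed simp
qed

lemma nc_subst_zero [simp]: "nc_subst \<phi> (\<lambda>C. 0) B = 0"
  using nc_subst_scale[of \<phi> 0 "\<lambda>_. 0" B] by simp

lemma nc_subst_sum:
  "finite I \<Longrightarrow> nc_subst \<phi> (\<lambda>C. \<Sum>i\<in>I. F i C) B = (\<Sum>i\<in>I. nc_subst \<phi> (F i) B)"
  by (induction I rule: finite_induct) (simp_all add: nc_subst_add)

lemma nc_subst_one: "nc_subst \<phi> nc_one = nc_one"
proof
  show "nc_subst \<phi> nc_one B = nc_one B" for B
    by (cases B) (auto intro!: sum.neutral split: option.split)
qed

lemma nc_subst_cong:
  assumes "\<And>C. length C \<le> length B \<Longrightarrow> F C = G C"
  shows "nc_subst \<phi> F B = nc_subst \<phi> G B"
  using assms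
proof (induction B arbitrary: F G rule: length_induct)
  case (1 B)
  show ?case
  proof (cases B)
    case (Cons x D)
    have "nc_subst \<phi> (\<lambda>C. F (y # C)) (drop i D) = nc_subst \<phi> (\<lambda>C. G (y # C)) (drop i D)" for i y
      using 1 Cons by auto
    thus ?thesis
      unfolding Cons nc_subst.simps
      by (intro sum.cong refl) (auto split: option.split)
  qed (use 1 in auto)
qed

text \<open>A decomposition into blocks and a cut between two blocks can be chosen in either order;
  \<open>F []\<close> accounts for the cut before the first block.\<close>

lemma nc_subst_mult: "nc_subst \<phi> (F \<odot> G) = nc_subst \<phi> F \<odot> nc_subst \<phi> G"
proof
  show "nc_subst \<phi> (F \<odot> G) B = (nc_subst \<phi> F \<odot> nc_subst \<phi> G) B" for B
  proof (induction B arbitrary: F rule: length_induct)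
    case (1 B)
    show ?case
    proof (cases B)
      case (Cons x D)
      define n where "n = length D"
      \<comment> \<open>\<open>s F i j\<close> collects the block decompositions of the prefix
        \<open>x # take j D\<close> whose first block is \<open>x # take i D\<close>;
        \<open>g j\<close> is the contribution of what follows that prefix.\<close>
      define s where "s F i j = (case \<phi> (x # take i D) of None \<Rightarrow> 0
          | Some y \<Rightarrow> nc_subst \<phi> (\<lambda>C. F (y # C)) (drop i (take j D)))" for F :: "'b list \<Rightarrow> complex" and i j
      define g where "g j = nc_subst \<phi> G (drop j D)" for j
      have IH: "nc_subst \<phi> (F \<odot> G) (drop i D) = (nc_subst \<phi> F \<odot> nc_subst \<phi> G) (drop i D)" for i F
        using 1 Cons by auto
      have "s (F \<odot> G) i n = F [] * s G i n + (\<Sum>j=i..n. s F i j * g j)" if "i \<le> n" for i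
      proof (cases "\<phi> (x # take i D)")
        case (Some y)
        have "(\<Sum>j\<le>n - i. nc_subst \<phi> (\<lambda>C. F (y # C)) (take j (drop i D)) * nc_subst \<phi> G (drop j (drop i D)))
          = (\<Sum>j=i..n. nc_subst \<phi> (\<lambda>C. F (y # C)) (drop i (take j D)) * g j)"
          by (rule sum.reindex_bij_witness[of _ "\<lambda>j. j - i" "\<lambda>j. j + i"])
            (use that in \<open>auto simp: g_def take_drop drop_drop add.commute\<close>)
        thus ?thesis
          using Some by (simp add: s_def n_def nc_mult_Cons nc_subst_add nc_subst_scale IH)
            (simp add: nc_mult_def)
      qed (simp add: s_def)
      hence "(\<Sum>i\<le>n. s (F \<odot> G) i n) = F [] * (\<Sum>i\<le>n. s G i n) + (\<Sum>i\<le>n. \<Sum>j=i..n. s F i j * g j)"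
        by (simp add: sum.distrib sum_distrib_left)
      moreover have "nc_subst \<phi> H B = (\<Sum>i\<le>n. s H i n)" for H
        unfolding Cons nc_subst.simps s_def n_def by (intro sum.cong refl) (simp split: option.split)
      ultimately have "nc_subst \<phi> (F \<odot> G) B = F [] * nc_subst \<phi> G B + (\<Sum>i\<le>n. \<Sum>j=i..n. s F i j * g j)"
        by simp
      \<comment> \<open>The first block ends at \<open>i\<close> and the cut lies at
        \<open>j\<close>, with \<open>i \<le> j\<close>; the triangle is now summed over
        \<open>j\<close> outermost.\<close>
      also have "(\<Sum>i\<le>n. \<Sum>j=i..n. s F i j * g j) = (\<Sum>j\<le>n. \<Sum>i\<le>j. s F i j * g j)"
        by (subst sum.Sigma, simp, simp, subst sum.Sigma, simp, simp,
          rule sum.reindex_bij_witness[of _ "\<lambda>(a,b). (b,a)" "\<lambda>(a,b). (b,a)"]) auto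
      also have "\<dots> = (\<Sum>j\<le>n. nc_subst \<phi> F (x # take j D) * g j)"
        by (intro sum.cong refl)
          (auto simp: s_def n_def sum_distrib_right min_absorb1 min_absorb2 intro!: sum.cong)
      finally show ?thesis
        unfolding Cons nc_mult_Cons by (simp add: nc_mult_def n_def g_def)
    qed simp
  qed
qed

lemma nc_subst_inverse:
  assumes "F [] \<noteq> 0"
  shows "nc_inverse (nc_subst \<phi> F) = nc_subst \<phi> (nc_inverse F)"
  by (rule nc_inverse_unique)
    (simp add: nc_subst_mult[symmetric] nc_inverse_right[of F, OF assms] nc_subst_one)

text \<open>A coefficient of a substitution is a finite linear combination of coefficients, so
  coefficientwise limits pass through.\<close>

lemma nc_subst_tendsto:
  assumes "\<And>C. ((\<lambda>t. F t C) \<longlongrightarrow> G C) net"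
  shows "((\<lambda>t. nc_subst \<phi> (F t) B) \<longlongrightarrow> nc_subst \<phi> G B) net"
  using assms
proof (induction B arbitrary: F G rule: length_induct)
  case (1 B)
  show ?case
  proof (cases B)
    case (Cons x D)
    have "((\<lambda>t. nc_subst \<phi> (\<lambda>C. F t (y # C)) (drop i D)) \<longlongrightarrow> nc_subst \<phi> (\<lambda>C. G (y # C)) (drop i D)) net" for i y
      using 1 Cons by auto
    thus ?thesis
      unfolding Cons nc_subst.simps
      by (intro tendsto_sum) (auto split: option.split)
  qed (use 1 in auto)
qed

lemma nc_subst_supported:
  assumes "\<And>C. C \<notin> lists A \<Longrightarrow> \<phi> C = None" "B \<notin> lists A"
  shows "nc_subst \<phi> F B = 0"
  using assms(2)
proof (induction B arbitrary: F rule: length_induct)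
  case (1 B)
  then obtain x D where B: "B = x # D"
    by (cases B) auto
  have "(case \<phi> (x # take i D) of None \<Rightarrow> 0
      | Some y \<Rightarrow> nc_subst \<phi> (\<lambda>C. F (y # C)) (drop i D)) = 0" for i
  proof (cases "x # take i D \<in> lists A")
    case True
    hence "drop i D \<notin> lists A"
      using 1(2) B append_in_lists_conv[of "x # take i D" "drop i D" A] by simp
    hence "nc_subst \<phi> F (drop i D) = 0" for F
      using 1(1) B by auto
    thus ?thesis
      by (simp split: option.split)
  next
    case False
    hence "\<phi> (x # take i D) = None"
      by (rule assms(1))
    thus ?thesis
      by simp
  qed
  thus ?case
    using B by simp
qed

subsection \<open>Shuffles\<close>

text \<open>\<open>shuffle_sum F C D\<close> is the sum of \<open>F\<close> over the shuffles of \<open>C\<close> and \<open>D\<close> with multiplicity.\<close>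

fun shuffle_sum :: "('b list \<Rightarrow> complex) \<Rightarrow> 'b list \<Rightarrow> 'b list \<Rightarrow> complex" where
  "shuffle_sum F [] D = F D"
| "shuffle_sum F (x # C) [] = F (x # C)"
| "shuffle_sum F (x # C) (y # D) =
     shuffle_sum (\<lambda>E. F (x # E)) C (y # D) + shuffle_sum (\<lambda>E. F (y # E)) (x # C) D"

lemma shuffle_sum_Nil [simp]: "shuffle_sum F C [] = F C"
  by (cases C) auto

text \<open>Equivalently, the linear extension of the coefficients is a character of the shuffle
  algebra.\<close>

definition group_like :: "('b list \<Rightarrow> complex) \<Rightarrow> bool" where
  "group_like F \<longleftrightarrow> F [] = 1 \<and> (\<forall>C D. F C * F D = shuffle_sum F C D)"

lemma shuffle_sum_add:
  "shuffle_sum (\<lambda>E. F E + G E) C D = shuffle_sum F C D + shuffle_sum G C D"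
  by (induction F C D arbitrary: G rule: shuffle_sum.induct) auto

lemma shuffle_sum_scale: "shuffle_sum (\<lambda>E. c * F E) C D = c * shuffle_sum F C D"
  by (induction F C D rule: shuffle_sum.induct) (auto simp: algebra_simps)

lemma shuffle_sum_one: "shuffle_sum nc_one C D = nc_one C * nc_one D"
proof -
  have "shuffle_sum (\<lambda>E. 0) C D = 0" for C D :: "'a list"
    using shuffle_sum_scale[of 0 "\<lambda>_. 0" C D] by simp
  thus ?thesis
    by (cases C; cases D) simp_all
qed

lemma shuffle_sum_tendsto:
  assumes "\<And>E. ((\<lambda>t. F t E) \<longlongrightarrow> G E) net"
  shows "((\<lambda>t. shuffle_sum (F t) C D) \<longlongrightarrow> shuffle_sum G C D) net"
  using assms
proof (induction G C D arbitrary: F rule: shuffle_sum.induct)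
  case (3 G x C y D)
  show ?case
    unfolding shuffle_sum.simps by (intro tendsto_add 3) 
qed auto

text \<open>The coproduct dual to the shuffle product is multiplicative.\<close>

lemma shuffle_sum_mult:
  "shuffle_sum (F \<odot> G) C D = (\<Sum>i\<le>length C. \<Sum>j\<le>length D.
     shuffle_sum F (take i C) (take j D) * shuffle_sum G (drop i C) (drop j D))"
proof (induction F C D rule: shuffle_sum.induct)
  case (1 F D)
  show ?case
    by (simp add: nc_mult_def)
next
  case (2 F x C)
  show ?case
    by (simp add: nc_mult_def)
next
  case (3 F x C y D)
  let ?m = "length C" and ?n = "length D"
  define f where "f i j = shuffle_sum F (take i (x # C)) (take j (y # D))" for i j
  define g where "g i j = shuffle_sum G (drop i (x # C)) (drop j (y # D))" for i j
  \<comment> \<open>Terms are split by which of the two words supplies the first letter; for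
    \<open>i = 0\<close> or \<open>j = 0\<close> there is at most one candidate.\<close>
  define fx where "fx i j = shuffle_sum (\<lambda>E. F (x # E)) (take i C) (take j (y # D))" for i j
  define fy where "fy i j = shuffle_sum (\<lambda>E. F (y # E)) (take i (x # C)) (take j D)" for i j
  have f: "f (Suc i) (Suc j) = fx i (Suc j) + fy (Suc i) j" "f (Suc i) 0 = fx i 0" "f 0 (Suc j) = fy 0 j"
      "f 0 0 = F []" for i j
    by (simp_all add: f_def fx_def fy_def)
  have "shuffle_sum (F \<odot> G) (x # C) (y # D) = F [] * g 0 0
      + shuffle_sum ((\<lambda>E. F (x # E)) \<odot> G) C (y # D) + shuffle_sum ((\<lambda>E. F (y # E)) \<odot> G) (x # C) D"
    by (simp add: nc_mult_Cons[abs_def] shuffle_sum_add shuffle_sum_scale g_def algebra_simps)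
  also have "\<dots> = F [] * g 0 0 + (\<Sum>i\<le>?m. \<Sum>j\<le>Suc ?n. fx i j * g (Suc i) j)
      + (\<Sum>i\<le>Suc ?m. \<Sum>j\<le>?n. fy i j * g i (Suc j))"
    unfolding 3 fx_def fy_def g_def by (simp del: sum.atMost_Suc)
  also have "\<dots> = F [] * g 0 0 + (\<Sum>i\<le>?m. fx i 0 * g (Suc i) 0) + (\<Sum>j\<le>?n. fy 0 j * g 0 (Suc j))
      + (\<Sum>i\<le>?m. \<Sum>j\<le>?n. (fx i (Suc j) + fy (Suc i) j) * g (Suc i) (Suc j))"
    by (simp add: sum.atMost_Suc_shift sum.distrib algebra_simps del: sum.atMost_Suc)
  also have "\<dots> = (\<Sum>i\<le>Suc ?m. \<Sum>j\<le>Suc ?n. f i j * g i j)"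
    by (simp add: sum.atMost_Suc_shift sum.distrib algebra_simps f del: sum.atMost_Suc)
  finally show ?case
    unfolding f_def g_def by (simp del: sum.atMost_Suc)
qed

lemma nc_mult_times_nc_mult: "(F \<odot> G) C * (F \<odot> G) D = (\<Sum>i\<le>length C. \<Sum>j\<le>length D.
    F (take i C) * F (take j D) * (G (drop i C) * G (drop j D)))"
  by (simp add: nc_mult_def sum_product mult_ac)

lemma group_like_mult: "group_like F \<Longrightarrow> group_like G \<Longrightarrow> group_like (F \<odot> G)"
  unfolding group_like_def by (simp add: shuffle_sum_mult nc_mult_times_nc_mult)

text \<open>Multiplicativity is applied to \<open>F \<odot> nc_inverse F = nc_one\<close>. By
  induction on the total length, all terms in which \<open>F\<close> takes a nonempty part already
  agree, and the remaining term is the shuffle relation for the inverse.\<close>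

lemma group_like_inverse:
  assumes "group_like F"
  shows "group_like (nc_inverse F)"
proof -
  let ?G = "nc_inverse F"
  have F: "F [] = 1" "shuffle_sum F C D = F C * F D" for C D
    using assms by (simp_all add: group_like_def)
  have "?G C * ?G D = shuffle_sum ?G C D" for C D
  proof (induction "length C + length D" arbitrary: C D rule: less_induct)
    case less
    define s where "s i j = F (take i C) * F (take j D)" for i j
    \<comment> \<open>Both double sums equal \<open>nc_one C * nc_one D\<close>.\<close>
    have "(\<Sum>i\<le>length C. \<Sum>j\<le>length D. s i j * shuffle_sum ?G (drop i C) (drop j D))
        = (\<Sum>i\<le>length C. \<Sum>j\<le>length D. s i j * (?G (drop i C) * ?G (drop j D)))"
      using shuffle_sum_mult[of F ?G C D] nc_mult_times_nc_mult[of F ?G C D]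
      by (simp add: F nc_inverse_right shuffle_sum_one s_def)
    hence "0 = (\<Sum>i\<le>length C. \<Sum>j\<le>length D. s i j * (?G (drop i C) * ?G (drop j D) -
        shuffle_sum ?G (drop i C) (drop j D)))"
      by (simp add: algebra_simps sum_subtractf)
    also have "\<dots> = (\<Sum>i\<le>length C. \<Sum>j\<le>length D. if i = 0 \<and> j = 0 then ?G C * ?G D - shuffle_sum ?G C D else 0)"
    proof (intro sum.cong refl)
      fix i j assume ij: "i \<in> {..length C}" "j \<in> {..length D}"
      show "s i j * (?G (drop i C) * ?G (drop j D) - shuffle_sum ?G (drop i C) (drop j D)) =
        (if i = 0 \<and> j = 0 then ?G C * ?G D - shuffle_sum ?G C D else 0)"
      proof (cases "i = 0 \<and> j = 0")
        case False
        hence "length (drop i C) + length (drop j D) < length C + length D"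
          using ij by auto
        from less[OF this] show ?thesis
          by (simp only: False if_False) simp
      qed (simp add: s_def F)
    qed
    also have "\<dots> = (\<Sum>i\<le>length C. if i = 0 then ?G C * ?G D - shuffle_sum ?G C D else 0)"
      by (intro sum.cong refl) (auto simp: sum.delta)
    also have "\<dots> = ?G C * ?G D - shuffle_sum ?G C D"
      by (simp add: sum.delta)
    finally show ?case
      by simp
  qed
  thus ?thesis
    using F by (simp add: group_like_def nc_inverse_Nil)
qed

section \<open>Iterated integrals of one-forms indexed by letters\<close>

text \<open>As in \<open>iter_int\<close>, the recursion is on the starting point and the leftmost
  letter is integrated nearest to \<open>a\<close>.\<close>

primrec word_integral :: "('b \<Rightarrow> complex \<Rightarrow> complex) \<Rightarrow> complex \<Rightarrow> complex \<Rightarrow> 'b list \<Rightarrow> complex" where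
  "word_integral W a b [] = 1"
| "word_integral W a b (x # C) = contour_integral (linepath a b) (\<lambda>t. W x t * word_integral W t b C)"

lemma word_integral_refl: "word_integral W a a = nc_one"
proof
  show "word_integral W a a C = nc_one C" for C
    by (cases C) simp_all
qed

text \<open>Replaces the manipulation of nested integrals: composition of paths, shuffle relations
  and change of variables are obtained by comparing derivatives in one variable point.\<close>

lemma eq_of_same_derivative:
  assumes "open S" "convex S" "a \<in> S" "b \<in> S"
    and "\<And>z. z \<in> S \<Longrightarrow> (f has_field_derivative h z) (at z)"
    and "\<And>z. z \<in> S \<Longrightarrow> (g has_field_derivative h z) (at z)"
    and "f b = g b"
  shows "f a = (g a :: complex)"
proof -
  have "((\<lambda>z. f z - g z) has_field_derivative 0) (at z within S)" if "z \<in> S" for z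
    using DERIV_diff[OF assms(5,6)[OF that]] by (simp add: has_field_derivative_at_within)
  from has_field_derivative_zero_constant[OF \<open>convex S\<close> this]
  obtain c where "\<And>z. z \<in> S \<Longrightarrow> f z - g z = c"
    by auto
  from this[OF \<open>a \<in> S\<close>] this[OF \<open>b \<in> S\<close>] \<open>f b = g b\<close> show ?thesis
    by simp
qed

text \<open>Convexity supplies a primitive, whose difference of values is the integral; the sign is
  negative because the starting point moves.\<close>

lemma contour_integral_linepath_holomorphic:
  assumes "open S" "convex S" "a \<in> S" "b \<in> S" "g holomorphic_on S"
  shows "(g has_contour_integral contour_integral (linepath a b) g) (linepath a b)"
    and "((\<lambda>z. contour_integral (linepath z b) g) has_field_derivative - g a) (at a)"
proof -
  obtain G where "\<And>z. z \<in> S \<Longrightarrow> (G has_field_derivative g z) (at z within S)"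
    by (rule holomorphic_convex_primitive'[OF \<open>convex S\<close> \<open>open S\<close> \<open>g holomorphic_on S\<close>]) (rule that)
  hence G: "\<And>z. z \<in> S \<Longrightarrow> (G has_field_derivative g z) (at z)"
    using \<open>open S\<close> by (metis at_within_open)
  have int: "(g has_contour_integral G b - G z) (linepath z b)" if "z \<in> S" for z
    using contour_integral_primitive[of S G g "linepath z b", OF has_field_derivative_at_within[OF G]]
      closed_segment_subset[OF that \<open>b \<in> S\<close> \<open>convex S\<close>] by simp
  show "(g has_contour_integral contour_integral (linepath a b) g) (linepath a b)"
    using int[OF \<open>a \<in> S\<close>] contour_integral_unique[OF int[OF \<open>a \<in> S\<close>]] by simp
  have "((\<lambda>z. G b - G z) has_field_derivative - g a) (at a)"
    using DERIV_diff[OF DERIV_const G[OF \<open>a \<in> S\<close>]] by simp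
  thus "((\<lambda>z. contour_integral (linepath z b) g) has_field_derivative - g a) (at a)"
    by (rule has_field_derivative_transform_within_open[OF _ \<open>open S\<close> \<open>a \<in> S\<close>])
      (rule contour_integral_unique[OF int, symmetric])
qed

text \<open>The intermediate point moves the last letter of the left factor and the first letter of
  the right one, so only the differences \<open>W - V\<close> survive. For \<open>W = V\<close> this
  yields composition of paths; with \<open>V\<close> built from constant Fourier coefficients it
  makes the derivative decay at the cusp.\<close>

lemma nc_mult_has_derivative:
  assumes F: "\<And>C x. ((\<lambda>b. F b (C @ [x])) has_field_derivative W x z * F z C) (at z)"
    and F0: "((\<lambda>b. F b []) has_field_derivative 0) (at z)"
    and H: "\<And>C x. ((\<lambda>b. H b (x # C)) has_field_derivative - V x z * H z C) (at z)"
    and H0: "((\<lambda>b. H b []) has_field_derivative 0) (at z)"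
  shows "((\<lambda>b. (F b \<odot> H b) C) has_field_derivative
    (\<Sum>i<length C. F z (take i C) * (W (C ! i) z - V (C ! i) z) * H z (drop (Suc i) C))) (at z)"
proof -
  define n where "n = length C"
  \<comment> \<open>\<open>f i\<close> and \<open>h i\<close> are the derivatives of the two factors
    at \<open>take i C\<close> and \<open>drop i C\<close>; they are zero where that word is
    empty.\<close>
  define f where "f i = (if i = 0 then 0 else W (C ! (i - 1)) z * F z (take (i - 1) C))" for i
  define h where "h i = (if i < n then - V (C ! i) z * H z (drop (Suc i) C) else 0)" for i
  have "((\<lambda>b. F b (take i C)) has_field_derivative f i) (at z)" if "i \<le> n" for i
  proof (cases i)
    case (Suc j)
    thus ?thesis
      using that F[of "take j C" "C ! j"] by (simp add: f_def take_Suc_conv_app_nth n_def)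
  qed (simp add: f_def F0)
  moreover have "((\<lambda>b. H b (drop i C)) has_field_derivative h i) (at z)" if "i \<le> n" for i
  proof (cases "i < n")
    case True
    thus ?thesis
      using that H[of "C ! i" "drop (Suc i) C"] by (simp add: h_def n_def Cons_nth_drop_Suc)
  qed (use that H0 in \<open>simp add: h_def n_def\<close>)
  ultimately have "((\<lambda>b. (F b \<odot> H b) C) has_field_derivative
      (\<Sum>i\<le>n. f i * H z (drop i C) + h i * F z (take i C))) (at z)"
    unfolding nc_mult_def n_def by (intro DERIV_sum DERIV_mult) auto
  also have "(\<Sum>i\<le>n. f i * H z (drop i C) + h i * F z (take i C)) =
      (\<Sum>i\<le>n. f i * H z (drop i C)) + (\<Sum>i\<le>n. h i * F z (take i C))"
    by (rule sum.distrib)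
  also have "(\<Sum>i\<le>n. f i * H z (drop i C)) = (\<Sum>i<n. W (C ! i) z * F z (take i C) * H z (drop (Suc i) C))"
    by (subst sum.atMost_shift) (simp add: f_def)
  also have "(\<Sum>i\<le>n. h i * F z (take i C)) = (\<Sum>i<n. - V (C ! i) z * H z (drop (Suc i) C) * F z (take i C))"
    by (simp add: lessThan_Suc_atMost[symmetric] h_def)
  also have "(\<Sum>i<n. W (C ! i) z * F z (take i C) * H z (drop (Suc i) C)) + \<dots> =
      (\<Sum>i<n. F z (take i C) * (W (C ! i) z - V (C ! i) z) * H z (drop (Suc i) C))"
    by (simp add: algebra_simps sum_subtractf sum_negf)
  finally show ?thesis
    unfolding n_def .
qed

lemma shuffle_sum_has_derivative:
  assumes "\<And>E. ((\<lambda>t. F t E) has_field_derivative F' E) (at z)"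
  shows "((\<lambda>t. shuffle_sum (F t) C D) has_field_derivative shuffle_sum F' C D) (at z)"
  using assms
proof (induction F' C D arbitrary: F rule: shuffle_sum.induct)
  case (3 F' x C y D)
  show ?case
    unfolding shuffle_sum.simps by (intro DERIV_add 3)
qed auto

lemma nc_subst_has_contour_integral:
  assumes "\<And>C. ((\<lambda>t. F t C) has_contour_integral I C) \<gamma>"
  shows "((\<lambda>t. nc_subst \<phi> (F t) B) has_contour_integral nc_subst \<phi> I B) \<gamma>"
  using assms
proof (induction B arbitrary: F I rule: length_induct)
  case (1 B)
  show ?case
  proof (cases B)
    case (Cons x D)
    have "((\<lambda>t. nc_subst \<phi> (\<lambda>C. F t (y # C)) (drop i D)) has_contour_integral
        nc_subst \<phi> (\<lambda>C. I (y # C)) (drop i D)) \<gamma>" for i y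
      using 1 Cons by auto
    thus ?thesis
      unfolding Cons nc_subst.simps
      by (intro has_contour_integral_sum) (auto split: option.split simp: has_contour_integral_0)
  qed (use 1 in auto)
qed

text \<open>Used for modular forms on the upper half plane and for their constant terms on the whole
  plane. Convexity keeps every segment inside the domain.\<close>

locale letter_forms =
  fixes S :: "complex set" and W :: "'b \<Rightarrow> complex \<Rightarrow> complex"
  assumes open_S: "open S" and convex_S: "convex S"
    and holomorphic_W: "W x holomorphic_on S"
begin

abbreviation "I \<equiv> word_integral W"

lemma holomorphic_integrand:
  assumes "b \<in> S"
  shows "(\<lambda>t. W x t * I t b C) holomorphic_on S"
proof -
  have "(\<lambda>a. I a b C) holomorphic_on S"
  proof (induction C)
    case (Cons x C)
    have "(\<lambda>t. W x t * I t b C) holomorphic_on S"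
      by (intro holomorphic_on_mult holomorphic_W Cons)
    from contour_integral_linepath_holomorphic(2)[OF open_S convex_S _ assms this]
    show ?case
      unfolding holomorphic_on_open[OF open_S] word_integral.simps by blast
  qed auto
  thus ?thesis
    by (intro holomorphic_on_mult holomorphic_W)
qed

lemma has_derivative_left:
  assumes "a \<in> S" "b \<in> S"
  shows "((\<lambda>a. I a b (x # C)) has_field_derivative - W x a * I a b C) (at a)"
  using contour_integral_linepath_holomorphic(2)[OF open_S convex_S assms holomorphic_integrand[OF assms(2), of x C]]
  by simp

text \<open>The recursion gives derivatives in the starting point only. The signed reversal with
  exchanged endpoints has the derivative in \<open>b\<close> expected of the integral from
  \<open>a\<close> to \<open>b\<close>, before the two are known to be equal.\<close>

lemma reversal_aux:
  assumes "b \<in> S" "a \<in> S"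
  shows "((\<lambda>b. (- 1) ^ length (C @ [x]) * I b a (rev (C @ [x]))) has_field_derivative
    W x b * ((- 1) ^ length C * I b a (rev C))) (at b)"
  using DERIV_cmult[OF has_derivative_left[OF assms, of x "rev C"], of "(- 1) ^ Suc (length C)"]
  by (simp add: algebra_simps)

lemma reversal_comp:
  assumes "a \<in> S" "b \<in> S" "b' \<in> S" "c \<in> S"
  shows "((\<lambda>C. (- 1) ^ length C * I b a (rev C)) \<odot> I b c) C =
    ((\<lambda>C. (- 1) ^ length C * I b' a (rev C)) \<odot> I b' c) C"
proof (rule eq_of_same_derivative[OF open_S convex_S \<open>b \<in> S\<close> \<open>b' \<in> S\<close>, where h = "\<lambda>_. 0"])
  fix z assume z: "z \<in> S"
  show "((\<lambda>b. ((\<lambda>C. (- 1) ^ length C * I b a (rev C)) \<odot> I b c) C) has_field_derivative 0) (at z)"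
    using nc_mult_has_derivative[of "\<lambda>b C. (- 1) ^ length C * I b a (rev C)" W z "\<lambda>b. I b c" W C,
      OF reversal_aux[OF z assms(1)] _ has_derivative_left[OF z assms(4)]] by simp
  show "((\<lambda>b. ((\<lambda>C. (- 1) ^ length C * I b' a (rev C)) \<odot> I b' c) C) has_field_derivative 0) (at z)"
    by simp
qed simp

text \<open>The intermediate point in \<open>reversal_comp\<close> is moved from \<open>a\<close> to
  \<open>b\<close>; at each of these positions one of the two factors is trivial. The same device
  gives composition of paths.\<close>

lemma reversal:
  assumes "a \<in> S" "b \<in> S"
  shows "I a b C = (- 1) ^ length C * I b a (rev C)"
proof -
  have "(\<lambda>C :: 'b list. (- 1) ^ length C * nc_one (rev C)) = (nc_one :: 'b list \<Rightarrow> complex)"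
    by (auto simp: nc_one_def fun_eq_iff)
  thus ?thesis
    using reversal_comp[OF assms(1) assms(1) assms(2) assms(2), of C]
    unfolding word_integral_refl by (simp only: nc_mult_one_left nc_mult_one_right)
qed

lemma compose:
  assumes "a \<in> S" "b \<in> S" "c \<in> S"
  shows "I a b \<odot> I b c = I a c"
proof
  fix C
  have *: "(\<lambda>C. (- 1) ^ length C * I z a (rev C)) = I a z" if "z \<in> S" for z
    using reversal[OF assms(1) that] by (intro ext) simp
  show "(I a b \<odot> I b c) C = I a c C"
    using reversal_comp[OF assms assms(3), of C]
    unfolding word_integral_refl *[OF assms(2)] *[OF assms(3)] by (simp only: nc_mult_one_right)
qed

lemma has_derivative_right:
  assumes "a \<in> S" "b \<in> S"
  shows "((\<lambda>b. I a b (C @ [x])) has_field_derivative W x b * I a b C) (at b)"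
proof -
  have "((\<lambda>b. I a b (C @ [x])) has_field_derivative
     W x b * ((- 1) ^ length C * I b a (rev C))) (at b)"
    by (rule has_field_derivative_transform_within_open[OF reversal_aux[OF assms(2,1)] open_S assms(2)])
      (simp add: reversal[OF assms(1)])
  thus ?thesis
    using reversal[OF assms, of C] by simp
qed

text \<open>As functions of the starting point both sides have the same derivative, by induction for
  the pairs with one first letter removed, and both vanish on the trivial path when neither word is
  empty. The starting point is generalised because the hypothesis is needed at every
  \<open>z\<close>.\<close>

lemma group_like_word_integral:
  assumes "a \<in> S" "b \<in> S"
  shows "group_like (I a b)"
proof -
  have "I a b C * I a b D = shuffle_sum (I a b) C D" if "a \<in> S" for a C D
    using that
  proof (induction "length C + length D" arbitrary: C D a rule: less_induct)
    case less
    show ?case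
    proof (cases "C = [] \<or> D = []")
      case False
      then obtain x C' y D' where C: "C = x # C'" and D: "D = y # D'"
        by (meson neq_Nil_conv)
      define d where "d z = - W x z * shuffle_sum (I z b) C' (y # D') - W y z * shuffle_sum (I z b) (x # C') D'" for z
      show ?thesis
        unfolding C D
      proof (rule eq_of_same_derivative[OF open_S convex_S \<open>a \<in> S\<close> \<open>b \<in> S\<close>, where h = d])
        fix z assume z: "z \<in> S"
        have "d z = - W x z * (I z b C' * I z b (y # D')) - W y z * (I z b (x # C') * I z b D')"
          unfolding d_def using less.hyps[of C' "y # D'" z] less.hyps[of "x # C'" D' z] z C D by simp
        hence "d z = - W x z * I z b C' * I z b (y # D') + - W y z * I z b D' * I z b (x # C')"
          by (simp add: algebra_simps del: word_integral.simps)
        thus "((\<lambda>z. I z b (x # C') * I z b (y # D')) has_field_derivative d z) (at z)"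
          using DERIV_mult[OF has_derivative_left[OF z assms(2), of x C'] has_derivative_left[OF z assms(2), of y D']]
          by (simp only:)
        have "((\<lambda>z. shuffle_sum (\<lambda>E. I z b (u # E)) E F) has_field_derivative
           - W u z * shuffle_sum (I z b) E F) (at z)" for u E F
          using shuffle_sum_has_derivative[of "\<lambda>z E. I z b (u # E)" "\<lambda>E. - W u z * I z b E" z E F,
              OF has_derivative_left[OF z assms(2), of u]]
          unfolding shuffle_sum_scale .
        from DERIV_add[OF this this]
        show "((\<lambda>z. shuffle_sum (I z b) (x # C') (y # D')) has_field_derivative d z) (at z)"
          unfolding d_def shuffle_sum.simps by (simp del: word_integral.simps)
      next
        show "I b b (x # C') * I b b (y # D') = shuffle_sum (I b b) (x # C') (y # D')"
          by (simp only: word_integral_refl shuffle_sum_one)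
      qed
    qed auto
  qed
  thus ?thesis
    using assms by (simp add: group_like_def)
qed

text \<open>The generating one-form is the substitution of the universal one, and the
  \<open>n\<close>-fold integral is the substitution of the part of degree \<open>n\<close> of the
  universal series, called \<open>R n\<close> in the proof.\<close>

lemma iter_series_eq_nc_subst:
  assumes ab: "a \<in> S" "b \<in> S"
    and \<omega>: "\<And>t B. \<omega> t B = (case \<phi> B of None \<Rightarrow> 0 | Some x \<Rightarrow> W x t)" and \<phi>: "\<phi> [] = None"
  shows "iter_series \<omega> a b = nc_subst \<phi> (I a b)"
proof
  fix B
  define R where "R n a C = (if length C = n then I a b C else 0)" for n a C
  have iter: "iter_int \<omega> n a b B = nc_subst \<phi> (R n a) B" if "a \<in> S" for n B a
    using that
  proof (induction n arbitrary: B a)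
    case 0
    have "R 0 a = nc_one"
      by (auto simp: R_def nc_one_def fun_eq_iff)
    thus ?case
      by (simp add: nc_subst_one)
  next
    case (Suc n)
    \<comment> \<open>The universal integrand: the one-form times the part of degree
      \<open>n\<close>.\<close>
    define G where "G t C = (case C of [] \<Rightarrow> 0 | x # D \<Rightarrow> W x t * R n t D)" for t C
    have G: "(\<omega> t \<odot> iter_int \<omega> n t b) B = nc_subst \<phi> (G t) B" if "t \<in> S" for t
    proof (cases B)
      case (Cons x D)
      have "\<omega> t (x # take i D) * nc_subst \<phi> (R n t) (drop i D) = (case \<phi> (x # take i D) of None \<Rightarrow> 0
          | Some y \<Rightarrow> nc_subst \<phi> (\<lambda>C. G t (y # C)) (drop i D))" for i
        by (simp add: \<omega> G_def nc_subst_scale split: option.split)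
      thus ?thesis
        unfolding Cons nc_mult_Cons nc_subst.simps by (simp add: nc_mult_def Suc.IH that \<omega> \<phi>)
    qed (simp add: \<omega> \<phi> G_def)
    have "((\<lambda>t. G t C) has_contour_integral R (Suc n) a C) (linepath a b)" for C
    proof (cases C)
      case (Cons x D)
      show ?thesis
        using contour_integral_linepath_holomorphic(1)[OF open_S convex_S Suc.prems \<open>b \<in> S\<close>
            holomorphic_integrand[OF \<open>b \<in> S\<close>, of x D]]
        by (simp add: Cons G_def R_def has_contour_integral_0)
    qed (simp add: G_def R_def has_contour_integral_0)
    hence "((\<lambda>t. nc_subst \<phi> (G t) B) has_contour_integral nc_subst \<phi> (R (Suc n) a) B) (linepath a b)"
      by (rule nc_subst_has_contour_integral)
    hence "contour_integral (linepath a b) (\<lambda>t. nc_subst \<phi> (G t) B) = nc_subst \<phi> (R (Suc n) a) B"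
      by (rule contour_integral_unique)
    moreover have "closed_segment a b \<subseteq> S"
      using closed_segment_subset[OF Suc.prems \<open>b \<in> S\<close> convex_S] .
    ultimately show ?case
      using contour_integral_eq[of "linepath a b" "\<lambda>t. (\<omega> t \<odot> iter_int \<omega> n t b) B" "\<lambda>t. nc_subst \<phi> (G t) B"] G
      by auto
  qed
  have "iter_series \<omega> a b B = (\<Sum>n\<le>length B. nc_subst \<phi> (R n a) B)"
    unfolding iter_series_def iter[OF \<open>a \<in> S\<close>]
  proof (rule suminf_finite)
    fix n assume "n \<notin> {..length B}"
    hence "nc_subst \<phi> (R n a) B = nc_subst \<phi> (\<lambda>_. 0) B"
      by (intro nc_subst_cong) (auto simp: R_def)
    thus "nc_subst \<phi> (R n a) B = 0"
      by simp
  qed simp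
  also have "\<dots> = nc_subst \<phi> (\<lambda>C. \<Sum>n\<le>length B. R n a C) B"
    by (simp add: nc_subst_sum)
  also have "\<dots> = nc_subst \<phi> (I a b) B"
    by (rule nc_subst_cong) (simp add: R_def)
  finally show "iter_series \<omega> a b B = nc_subst \<phi> (I a b) B" .
qed

end

text \<open>In general \<open>g\<close> carries the segment from \<open>a\<close> to
  \<open>b\<close> to a curve and not to a segment. Both sides still have equal derivatives in
  \<open>a\<close> by the chain rule, and they agree for \<open>a = b\<close>.\<close>

lemma word_integral_substitution:
  assumes "letter_forms S W" "letter_forms S' W'"
    and g: "\<And>z. z \<in> S \<Longrightarrow> g z \<in> S'" "\<And>z. z \<in> S \<Longrightarrow> (g has_field_derivative g' z) (at z)"
    and W: "\<And>x z. z \<in> S \<Longrightarrow> W' x (g z) * g' z = W x z"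
    and ab: "a \<in> S" "b \<in> S"
  shows "word_integral W' (g a) (g b) = word_integral W a b"
proof
  interpret A: letter_forms S W by fact
  interpret B: letter_forms S' W' by fact
  show "word_integral W' (g a) (g b) C = word_integral W a b C" for C
    using ab(1)
  proof (induction C arbitrary: a)
    case (Cons x C)
    show ?case
    proof (rule eq_of_same_derivative[OF A.open_S A.convex_S \<open>a \<in> S\<close> \<open>b \<in> S\<close>])
      fix z assume z: "z \<in> S"
      show "((\<lambda>z. word_integral W z b (x # C)) has_field_derivative - W x z * word_integral W z b C) (at z)"
        by (rule A.has_derivative_left[OF z ab(2)])
      have "((\<lambda>z. word_integral W' (g z) (g b) (x # C)) has_field_derivative
          - W' x (g z) * word_integral W' (g z) (g b) C * g' z) (at z)"
        by (rule DERIV_chain2[OF B.has_derivative_left g(2)]) (auto intro: g z ab)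
      moreover have "- W' x (g z) * word_integral W' (g z) (g b) C * g' z = - W x z * word_integral W z b C"
        using W[OF z, of x] Cons.IH[OF z] by (simp add: mult.commute mult.left_commute)
      ultimately show "((\<lambda>z. word_integral W' (g z) (g b) (x # C)) has_field_derivative
          - W x z * word_integral W z b C) (at z)"
        by simp
    qed (simp only: word_integral_refl)
  qed simp
qed

section \<open>Regularization at the cusp\<close>

lemma open_upper_half_plane: "open upper_half_plane"
  unfolding upper_half_plane_def by (rule open_halfspace_Im_gt)

lemma convex_upper_half_plane: "convex upper_half_plane"
  unfolding upper_half_plane_def by (rule convex_halfspace_Im_gt)

section \<open>Fourier expansions: exponential decay and uniqueness of coefficients\<close>

lemma fourier_expansion_bound:
  assumes "fourier_expansion f a"
  obtains K where "\<And>z. 1 \<le> Im z \<Longrightarrow> norm (f z - a 0) \<le> K * exp (- (2 * pi * Im z))"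
proof -
  have norm_exp: "norm (exp (2 * of_real pi * \<i> * of_nat n * z)) = exp (- (2 * pi * real n * Im z))" for n z
    by (simp add: norm_exp_eq_Re)
  \<comment> \<open>Convergence at \<open>\<i> / 2\<close>, where the n-th exponential is exp(-pi
    n), bounds the coefficients by \<open>M * exp (pi * n)\<close>; for Im z \<ge> 1 the tail is
    then dominated by a geometric series of ratio exp(-pi).\<close>
  have "summable (\<lambda>n. a n * exp (2 * of_real pi * \<i> * of_nat n * (\<i> / 2)))"
    by (rule sums_summable[OF bspec[OF assms[unfolded fourier_expansion_def]]])
      (simp add: upper_half_plane_def)
  then obtain M where M: "\<And>n. norm (a n * exp (2 * of_real pi * \<i> * of_nat n * (\<i> / 2))) \<le> M"
    using summable_imp_bounded unfolding bounded_iff by blast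
  have a: "norm (a n) \<le> M * exp (pi * real n)" for n
  proof -
    have "norm (a n) * exp (- (pi * real n)) \<le> M"
      using M[of n] norm_exp[of n "\<i> / 2"] by (simp add: norm_mult)
    thus ?thesis
      by (simp add: exp_minus field_simps)
  qed
  have M0: "0 \<le> M"
    using order_trans[OF norm_ge_zero a[of 0]] by simp
  have r1: "exp (- pi) < 1"
    by simp
  define K where "K = M * exp pi * (\<Sum>n. exp (- pi) ^ n)"
  have "norm (f z - a 0) \<le> K * exp (- (2 * pi * Im z))" if z: "1 \<le> Im z" for z
  proof -
    let ?y = "Im z"
    let ?t = "\<lambda>n. a (Suc n) * exp (2 * of_real pi * \<i> * of_nat (Suc n) * z)"
    have "(\<lambda>n. a n * exp (2 * of_real pi * \<i> * of_nat n * z)) sums f z"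
      using assms z unfolding fourier_expansion_def upper_half_plane_def by auto
    hence "?t sums (f z - a 0)"
      using sums_Suc_iff[of "\<lambda>n. a n * exp (2 * of_real pi * \<i> * of_nat n * z)" "f z - a 0"] by simp
    hence eq: "f z - a 0 = suminf ?t"
      by (rule sums_unique)
    have bound: "norm (?t n) \<le> (M * exp pi * exp (- (2 * pi * ?y))) * exp (- pi) ^ n" for n
    proof -
      have "norm (?t n) \<le> (M * exp (pi * real (Suc n))) * exp (- (2 * pi * real (Suc n) * ?y))"
        unfolding norm_mult norm_exp using a[of "Suc n"] by (intro mult_right_mono) auto
      also have "\<dots> = M * exp (pi * real (Suc n) - 2 * pi * real (Suc n) * ?y)"
        by (simp only: diff_conv_add_uminus exp_add mult.assoc)
      \<comment> \<open>One factor exp(-2 pi y) is kept as the decay rate; the other powers are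
        estimated by y \<ge> 1.\<close>
      also have "\<dots> \<le> M * exp (pi - 2 * pi * ?y - pi * real n)"
      proof -
        have "2 * pi * real n * 1 \<le> 2 * pi * real n * ?y"
          using z by (intro mult_left_mono) auto
        hence "pi * real (Suc n) - 2 * pi * real (Suc n) * ?y \<le> pi - 2 * pi * ?y - pi * real n"
          by (simp add: algebra_simps)
        thus ?thesis
          using M0 by (intro mult_left_mono) auto
      qed
      also have "exp (pi - 2 * pi * ?y - pi * real n) = exp pi * exp (- (2 * pi * ?y)) * exp (- pi) ^ n"
        by (simp add: diff_conv_add_uminus exp_add exp_of_nat_mult[symmetric] mult_ac
            del: add_uminus_conv_diff)
      finally show ?thesis
        by (simp add: mult_ac)
    qed
    have sum: "summable (\<lambda>n. exp (- pi) ^ n)"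
      using r1 by (intro summable_geometric) simp
    have "norm (suminf ?t) \<le> (\<Sum>n. (M * exp pi * exp (- (2 * pi * ?y))) * exp (- pi) ^ n)"
      by (rule norm_suminf_le[OF bound summable_mult[OF sum]])
    also have "\<dots> = K * exp (- (2 * pi * ?y))"
      by (subst suminf_mult[OF sum]) (simp add: K_def)
    finally show ?thesis
      unfolding eq .
  qed
  thus ?thesis
    by (rule that)
qed

text \<open>In the variable x = exp(2 pi i z) this is the identity theorem on the unit disc. The
  centre is not reached from the upper half plane, so the constant coefficient is treated
  separately, by letting Im z tend to infinity.\<close>

lemma fourier_expansion_zero:
  assumes "fourier_expansion (\<lambda>_. 0) c"
  shows "c = (\<lambda>_. 0)"
proof -
  obtain K where K: "\<And>z. 1 \<le> Im z \<Longrightarrow> norm (0 - c 0) \<le> K * exp (- (2 * pi * Im z))"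
    using fourier_expansion_bound[OF assms] by blast
  have "((\<lambda>y. K * exp (- (2 * pi * y))) \<longlongrightarrow> K * 0) at_top"
    by (intro tendsto_mult tendsto_const filterlim_compose[OF exp_at_bot]
        filterlim_uminus_at_top[THEN iffD1] filterlim_tendsto_pos_mult_at_top[OF tendsto_const]
        filterlim_ident) auto
  moreover have "eventually (\<lambda>y::real. norm (c 0) \<le> K * exp (- (2 * pi * y))) at_top"
    using eventually_ge_at_top[of 1] by eventually_elim (use K[of "\<i> * of_real _"] in simp)
  ultimately have "norm (c 0) \<le> K * 0"
    by (intro tendsto_lowerbound[of _ _ at_top]) auto
  hence c0: "c 0 = 0"
    by simp
  have sums: "(\<lambda>n. c n * (x - 0) ^ n) sums 0" if "norm (x - 0) < 1" for x :: complex
  proof (cases "x = 0")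
    case False
    define z where "z = Ln x / (2 * of_real pi * \<i>)"
    have "Im z = - ln (norm x) / (2 * pi)"
      using False by (simp add: z_def Im_divide power2_eq_square field_simps)
    hence "z \<in> upper_half_plane"
      using that False by (simp add: upper_half_plane_def divide_neg_pos ln_less_zero)
    moreover have "exp (2 * of_real pi * \<i> * of_nat n * z) = x ^ n" for n
    proof -
      have *: "2 * of_real pi * \<i> * of_nat n * z = of_nat n * Ln x"
        by (simp add: z_def)
      show ?thesis
        unfolding * using False by (simp add: exp_of_nat_mult)
    qed
    ultimately show ?thesis
      using assms unfolding fourier_expansion_def by auto
  qed (simp add: c0)
  show ?thesis
  proof (rule ccontr)
    assume "c \<noteq> (\<lambda>_. 0)"
    then obtain m where m: "c m \<noteq> 0"
      by auto
    hence "0 < m"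
      using c0 by (cases m) auto
    show False
    proof (rule powser_0_nonzero[of 1 0 c "\<lambda>_. 0" m, OF zero_less_one sums refl m \<open>0 < m\<close>])
      fix s :: real
      assume "0 < s" and s: "\<And>z::complex. z \<in> cball 0 s - {0} \<Longrightarrow> (0::complex) \<noteq> 0"
      hence "of_real s \<in> cball 0 s - {0::complex}"
        by simp
      thus False
        using s by blast
    qed
  qed
qed

text \<open>Uniqueness of the expansion evaluates the definite description in
  \<open>fourier_const\<close>.\<close>

lemma fourier_const_eq:
  assumes "fourier_expansion f a"
  shows "fourier_const f = a 0"
proof -
  have "b = a" if "fourier_expansion f b" for b
  proof -
    have "fourier_expansion (\<lambda>_. 0) (\<lambda>n. b n - a n)"
      unfolding fourier_expansion_def
    proof
      fix z assume z: "z \<in> upper_half_plane"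
      have "(\<lambda>n. b n * exp (2 * of_real pi * \<i> * of_nat n * z)
          - a n * exp (2 * of_real pi * \<i> * of_nat n * z)) sums (f z - f z)"
        using assms that z unfolding fourier_expansion_def by (intro sums_diff) auto
      thus "(\<lambda>n. (b n - a n) * exp (2 * of_real pi * \<i> * of_nat n * z)) sums 0"
        by (simp add: algebra_simps)
    qed
    from fourier_expansion_zero[OF this] show ?thesis
      by (simp add: fun_eq_iff)
  qed
  hence "(THE a. fourier_expansion f a) = a"
    using assms by (intro the_equality)
  thus ?thesis
    by (simp add: fourier_const_def)
qed

lemma fourier_const_zero: "fourier_const (\<lambda>_. 0) = 0"
  using fourier_const_eq[of "\<lambda>_. 0" "\<lambda>_. 0"] by (simp add: fourier_expansion_def)

section \<open>Growth conditions on a vertical strip and limits at the cusp\<close>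

definition cusp_strip :: "complex set" where
  "cusp_strip = {z. \<bar>Re z\<bar> \<le> 1 \<and> 1 \<le> Im z}"

lemma convex_cusp_strip: "convex cusp_strip"
proof -
  have *: "cusp_strip = {z. Re z \<le> 1} \<inter> {z. Re z \<ge> -1} \<inter> {z. Im z \<ge> 1}"
    by (auto simp: cusp_strip_def)
  show ?thesis
    unfolding * by (intro convex_Int convex_halfspace_Re_le convex_halfspace_Re_ge convex_halfspace_Im_ge)
qed

lemma cusp_strip_subset: "cusp_strip \<subseteq> upper_half_plane"
  by (auto simp: cusp_strip_def upper_half_plane_def)

text \<open>Powers of Im z suffice for comparison: on the strip the real part is bounded, and Im z
  \<ge> 1 allows exponents to be raised.\<close>

definition poly_growth :: "(complex \<Rightarrow> complex) \<Rightarrow> bool" where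
  "poly_growth f \<longleftrightarrow> (\<exists>K n. 0 \<le> K \<and> (\<forall>z\<in>cusp_strip. norm (f z) \<le> K * Im z ^ n))"

lemma poly_growth_const: "poly_growth (\<lambda>_. c)"
  unfolding poly_growth_def by (intro exI[of _ "norm c"] exI[of _ 0]) auto

lemma poly_growth_id: "poly_growth (\<lambda>z. z)"
  unfolding poly_growth_def
proof (intro exI conjI ballI)
  fix z assume "z \<in> cusp_strip"
  thus "norm z \<le> 2 * Im z ^ 1"
    using cmod_le[of z] by (simp add: cusp_strip_def)
qed simp

lemma poly_growth_add:
  assumes "poly_growth f" "poly_growth g"
  shows "poly_growth (\<lambda>z. f z + g z)"
proof -
  obtain K m L n where K: "0 \<le> K" "\<And>z. z \<in> cusp_strip \<Longrightarrow> norm (f z) \<le> K * Im z ^ m"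
    and L: "0 \<le> L" "\<And>z. z \<in> cusp_strip \<Longrightarrow> norm (g z) \<le> L * Im z ^ n"
    using assms unfolding poly_growth_def by metis
  have "norm (f z + g z) \<le> (K + L) * Im z ^ (m + n)" if z: "z \<in> cusp_strip" for z
  proof -
    have "Im z ^ m \<le> Im z ^ (m + n)" "Im z ^ n \<le> Im z ^ (m + n)"
      using z by (auto simp: cusp_strip_def intro!: power_increasing)
    hence "K * Im z ^ m \<le> K * Im z ^ (m + n)" "L * Im z ^ n \<le> L * Im z ^ (m + n)"
      using K(1) L(1) by (auto intro: mult_left_mono)
    thus ?thesis
      using K(2)[OF z] L(2)[OF z] norm_triangle_ineq[of "f z" "g z"] by (simp add: algebra_simps)
  qed
  thus ?thesis
    unfolding poly_growth_def using K(1) L(1) by (intro exI[of _ "K + L"] exI[of _ "m + n"]) auto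
qed

lemma poly_growth_mult:
  assumes "poly_growth f" "poly_growth g"
  shows "poly_growth (\<lambda>z. f z * g z)"
proof -
  obtain K m L n where K: "0 \<le> K" "\<And>z. z \<in> cusp_strip \<Longrightarrow> norm (f z) \<le> K * Im z ^ m"
    and L: "0 \<le> L" "\<And>z. z \<in> cusp_strip \<Longrightarrow> norm (g z) \<le> L * Im z ^ n"
    using assms unfolding poly_growth_def by metis
  have "norm (f z * g z) \<le> (K * L) * Im z ^ (m + n)" if z: "z \<in> cusp_strip" for z
  proof -
    have "norm (f z) * norm (g z) \<le> (K * Im z ^ m) * (L * Im z ^ n)"
      using K L z by (intro mult_mono) (auto simp: cusp_strip_def)
    thus ?thesis
      by (simp add: norm_mult power_add mult_ac)
  qed
  thus ?thesis
    unfolding poly_growth_def using K(1) L(1) by (intro exI[of _ "K * L"] exI[of _ "m + n"]) auto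
qed

lemma poly_growth_power: "poly_growth f \<Longrightarrow> poly_growth (\<lambda>z. f z ^ n)"
  by (induction n) (auto intro: poly_growth_const poly_growth_mult)

lemma poly_growth_sum: "(\<And>i. i \<in> A \<Longrightarrow> poly_growth (f i)) \<Longrightarrow> poly_growth (\<lambda>z. \<Sum>i\<in>A. f i z)"
  by (induction A rule: infinite_finite_induct) (auto intro: poly_growth_const poly_growth_add)

lemma poly_growth_nc_mult:
  assumes "\<And>C. poly_growth (\<lambda>z. F z C)" "\<And>C. poly_growth (\<lambda>z. G z C)"
  shows "poly_growth (\<lambda>z. (F z \<odot> G z) C)"
  unfolding nc_mult_def using assms by (intro poly_growth_sum poly_growth_mult)

text \<open>With base point \<i> the segment from \<open>z\<close> stays in the strip and below the
  height of \<open>z\<close>, so each integration raises the exponent by one. Composition then moves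
  the base point to an arbitrary \<open>b\<close>, and reversal handles the other endpoint.\<close>

lemma (in letter_forms) poly_growth_word_integral:
  assumes "cusp_strip \<subseteq> S" "b \<in> S" and W: "\<And>x. poly_growth (W x)"
  shows "poly_growth (\<lambda>z. I z b C)" "poly_growth (\<lambda>z. I b z C)"
proof -
  have i: "\<i> \<in> cusp_strip"
    by (simp add: cusp_strip_def)
  have *: "poly_growth (\<lambda>z. I z \<i> C)" for C
  proof (induction C)
    case (Cons x C)
    obtain K n where K: "0 \<le> K" "\<And>z. z \<in> cusp_strip \<Longrightarrow> norm (W x z * I z \<i> C) \<le> K * Im z ^ n"
      using poly_growth_mult[OF W[of x] Cons] unfolding poly_growth_def by metis
    have "norm (I z \<i> (x # C)) \<le> 3 * K * Im z ^ Suc n" if z: "z \<in> cusp_strip" for z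
    proof -
      have y: "1 \<le> Im z"
        using z by (simp add: cusp_strip_def)
      have "norm (W x t * I t \<i> C) \<le> K * Im z ^ n" if t: "t \<in> closed_segment z \<i>" for t
      proof -
        have "closed_segment z \<i> \<subseteq> cusp_strip \<inter> {w. Im w \<le> Im z}"
          using z i y by (intro closed_segment_subset convex_Int convex_cusp_strip convex_halfspace_Im_le) auto
        hence t': "t \<in> cusp_strip" "Im t \<le> Im z"
          using t by auto
        hence "K * Im t ^ n \<le> K * Im z ^ n"
          using K(1) by (intro mult_left_mono power_mono) (auto simp: cusp_strip_def)
        thus ?thesis
          using K(2)[OF t'(1)] by simp
      qed
      hence "norm (I z \<i> (x # C)) \<le> K * Im z ^ n * norm (\<i> - z)"
        unfolding word_integral.simps using assms(1) z i K(1) y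
        by (intro has_contour_integral_bound_linepath[OF contour_integral_linepath_holomorphic(1)
            [OF open_S convex_S _ _ holomorphic_integrand]]) auto
      \<comment> \<open>The segment has length at most 1 + |Re z| + Im z, hence at most 3 Im z on
        the strip.\<close>
      also have "\<dots> \<le> K * Im z ^ n * (3 * Im z)"
        using norm_triangle_ineq4[of "\<i>" z] cmod_le[of z] z K(1) y
        by (intro mult_left_mono) (simp_all add: cusp_strip_def)
      finally show ?thesis
        by (simp add: mult_ac)
    qed
    thus ?case
      unfolding poly_growth_def using K(1) by (intro exI[of _ "3 * K"] exI[of _ "Suc n"]) auto
  qed (simp add: poly_growth_const)
  have **: "poly_growth (\<lambda>z. I z b C)" for C
  proof -
    have "poly_growth (\<lambda>z. (I z \<i> \<odot> I \<i> b) C)"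
      by (intro poly_growth_nc_mult * poly_growth_const)
    moreover have "(I z \<i> \<odot> I \<i> b) C = I z b C" if "z \<in> cusp_strip" for z
      using compose[of z \<i> b] assms(1,2) i that by (simp add: subset_iff)
    ultimately show ?thesis
      by (simp add: poly_growth_def)
  qed
  thus "poly_growth (\<lambda>z. I z b C)" .
  have "poly_growth (\<lambda>z. (- 1) ^ length C * I z b (rev C))"
    by (intro poly_growth_mult poly_growth_const **)
  moreover have "(- 1) ^ length C * I z b (rev C) = I b z C" if "z \<in> cusp_strip" for z
    using reversal[of b z C] assms(1,2) that by auto
  ultimately show "poly_growth (\<lambda>z. I b z C)"
    by (simp add: poly_growth_def)
qed

text \<open>The rate is weaker than the exp(-2 pi Im z) of Fourier tails; the slack absorbs
  polynomial factors.\<close>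

definition rapid_decay :: "(complex \<Rightarrow> complex) \<Rightarrow> bool" where
  "rapid_decay f \<longleftrightarrow> (\<exists>K. \<forall>z\<in>cusp_strip. norm (f z) \<le> K * exp (- Im z))"

lemma rapid_decay_zero: "rapid_decay (\<lambda>_. 0)"
  unfolding rapid_decay_def by (intro exI[of _ 0]) simp

lemma rapid_decay_add:
  assumes "rapid_decay f" "rapid_decay g"
  shows "rapid_decay (\<lambda>z. f z + g z)"
proof -
  obtain K L where "\<And>z. z \<in> cusp_strip \<Longrightarrow> norm (f z) \<le> K * exp (- Im z)"
    "\<And>z. z \<in> cusp_strip \<Longrightarrow> norm (g z) \<le> L * exp (- Im z)"
    using assms unfolding rapid_decay_def by metis
  hence "\<And>z. z \<in> cusp_strip \<Longrightarrow> norm (f z + g z) \<le> (K + L) * exp (- Im z)"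
    unfolding distrib_right using norm_triangle_le add_mono by blast
  thus ?thesis
    unfolding rapid_decay_def by blast
qed

lemma rapid_decay_sum: "(\<And>i. i \<in> A \<Longrightarrow> rapid_decay (f i)) \<Longrightarrow> rapid_decay (\<lambda>z. \<Sum>i\<in>A. f i z)"
  by (induction A rule: infinite_finite_induct) (auto intro: rapid_decay_zero rapid_decay_add)

lemma rapid_decay_mult:
  assumes "\<And>z. z \<in> cusp_strip \<Longrightarrow> norm (f z) \<le> K * exp (- (2 * pi * Im z))" "poly_growth g"
  shows "rapid_decay (\<lambda>z. f z * g z)"
proof -
  obtain L n where L: "0 \<le> L" "\<And>z. z \<in> cusp_strip \<Longrightarrow> norm (g z) \<le> L * Im z ^ n"
    using assms(2) unfolding poly_growth_def by metis
  have "norm (f z * g z) \<le> (\<bar>K\<bar> * L * fact n) * exp (- Im z)" if z: "z \<in> cusp_strip" for z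
  proof -
    define y where "y = Im z"
    have y: "1 \<le> y"
      using z by (simp add: cusp_strip_def y_def)
    \<comment> \<open>A single term of the exponential series bounds the polynomial factor; the cost
      exp(y) is affordable since y - 2 pi y \<le> - y.\<close>
    have "y ^ n / fact n \<le> exp y"
      using sum_le_suminf[OF summable_exp_generic[of y], of "{n}"] y
      by (simp add: exp_def field_simps)
    hence yn: "y ^ n \<le> fact n * exp y"
      by (simp add: field_simps)
    have "norm (f z) * norm (g z) \<le> (\<bar>K\<bar> * exp (- (2 * pi * y))) * (L * (fact n * exp y))"
    proof (intro mult_mono)
      show "norm (f z) \<le> \<bar>K\<bar> * exp (- (2 * pi * y))"
        using assms(1)[OF z] by (rule order_trans) (simp add: y_def)
      show "norm (g z) \<le> L * (fact n * exp y)"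
        using L(2)[OF z] mult_left_mono[OF yn L(1)] by (simp add: y_def)
    qed auto
    also have "\<dots> = (\<bar>K\<bar> * L * fact n) * exp (y - 2 * pi * y)"
      by (simp add: exp_diff exp_minus field_simps)
    also have "\<dots> \<le> (\<bar>K\<bar> * L * fact n) * exp (- y)"
    proof -
      have "1 * y \<le> pi * y"
        using pi_gt3 y by (intro mult_right_mono) auto
      thus ?thesis
        using L(1) by (intro mult_left_mono) auto
    qed
    finally show ?thesis
      by (simp add: norm_mult y_def)
  qed
  thus ?thesis
    unfolding rapid_decay_def by blast
qed

text \<open>Rapid decay makes the values along the imaginary axis Cauchy. Between iy and iy + 1 the
  function changes by at most the bound of its derivative times the length 1, so both vertical lines
  have the same limit; the strip is wide enough to contain them.\<close>

lemma limit_at_cusp: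
  assumes G: "\<And>z. z \<in> upper_half_plane \<Longrightarrow> (G has_field_derivative G' z) (at z)"
    and "rapid_decay G'"
  obtains l where "((\<lambda>y::real. G (\<i> * of_real y)) \<longlongrightarrow> l) at_top"
    "((\<lambda>y::real. G (\<i> * of_real y + 1)) \<longlongrightarrow> l) at_top"
proof -
  obtain K where K: "\<And>z. z \<in> cusp_strip \<Longrightarrow> norm (G' z) \<le> K * exp (- Im z)"
    using assms(2) unfolding rapid_decay_def by metis
  have K0: "0 \<le> K"
    using order_trans[OF norm_ge_zero K[of \<i>]] by (simp add: cusp_strip_def zero_le_mult_iff)
  define g where "g y = G (\<i> * of_real y)" for y :: real
  have g_deriv: "(g has_vector_derivative (\<i> * G' (\<i> * of_real y))) (at y)" if "1 \<le> y" for y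
  proof -
    have "\<i> * of_real y \<in> upper_half_plane"
      using that by (simp add: upper_half_plane_def)
    moreover have "((\<lambda>y. \<i> * of_real y) has_vector_derivative \<i>) (at y)"
      by (auto intro!: derivative_eq_intros)
    ultimately show ?thesis
      using field_vector_diff_chain_at[of "\<lambda>y. \<i> * of_real y" \<i> y G] G
      by (simp add: g_def[abs_def] o_def)
  qed
  have diff: "norm (g v - g u) \<le> K * exp (- u)" if "1 \<le> u" "u \<le> v" for u v
  proof (cases "u = v")
    case False
    \<comment> \<open>Comparison with \<open>- K * exp (- y)\<close>, whose derivative is the bound
      for the derivative of \<open>g\<close>.\<close>
    hence "norm (g v - g u) \<le> - K * exp (- v) - (- K * exp (- u))"
    proof (intro differentiable_bound_general[where f' = "\<lambda>y. \<i> * G' (\<i> * of_real y)" and \<phi>' = "\<lambda>y. K * exp (- y)"])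
      show "continuous_on {u..v} g"
        using that(1) by (intro continuous_at_imp_continuous_on ballI has_vector_derivative_continuous[OF g_deriv]) auto
      fix x assume x: "u < x" "x < v"
      show "(g has_vector_derivative \<i> * G' (\<i> * of_real x)) (at x)"
        using x that by (intro g_deriv) auto
      show "((\<lambda>y. - K * exp (- y)) has_vector_derivative K * exp (- x)) (at x)"
        unfolding has_real_derivative_iff_has_vector_derivative[symmetric]
        by (auto intro!: derivative_eq_intros)
      show "norm (\<i> * G' (\<i> * complex_of_real x)) \<le> K * exp (- x)"
        using K[of "\<i> * of_real x"] x that by (simp add: norm_mult cusp_strip_def)
    qed (use that False in \<open>auto intro!: continuous_intros\<close>)
    thus ?thesis
      using mult_nonneg_nonneg[OF K0 exp_ge_zero[of "- v"]] by simp
  qed (use K0 in auto)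
  have lim0: "((\<lambda>y::real. K * exp (- y)) \<longlongrightarrow> 0) at_top"
    using tendsto_mult[OF tendsto_const filterlim_compose[OF exp_at_bot filterlim_uminus_at_bot_at_top], of K]
    by simp
  have "Cauchy (\<lambda>n. g (real n))"
  proof (rule metric_CauchyI)
    fix e :: real assume "0 < e"
    hence "eventually (\<lambda>y. K * exp (- y) < e \<and> 1 \<le> y) at_top"
      using order_tendstoD(2)[OF lim0] eventually_ge_at_top[of 1] by (auto intro: eventually_conj)
    then obtain Y where Y: "\<And>y. y \<ge> Y \<Longrightarrow> K * exp (- y) < e \<and> 1 \<le> y"
      unfolding eventually_at_top_linorder by blast
    have "dist (g (real m)) (g (real n)) < e" if "m \<ge> nat \<lceil>Y\<rceil>" "n \<ge> nat \<lceil>Y\<rceil>" for m n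
    proof -
      have *: "dist (g (real m)) (g (real n)) < e" if "m \<ge> nat \<lceil>Y\<rceil>" "m \<le> n" for m n
        using diff[of "real m" "real n"] Y[of "real m"] that
        by (simp add: dist_norm norm_minus_commute nat_le_iff ceiling_le_iff)
      show ?thesis
        using *[of m n] *[of n m] that by (cases "m \<le> n") (auto simp: dist_commute)
    qed
    thus "\<exists>M. \<forall>m\<ge>M. \<forall>n\<ge>M. dist (g (real m)) (g (real n)) < e"
      by blast
  qed
  then obtain l where l: "(\<lambda>n. g (real n)) \<longlonglongrightarrow> l"
    using Cauchy_convergent convergent_def by blast
  have "norm (g y - l) \<le> K * exp (- y)" if "1 \<le> y" for y
  proof (rule tendsto_upperbound)
    show "(\<lambda>n. norm (g y - g (real n))) \<longlonglongrightarrow> norm (g y - l)"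
      by (intro tendsto_intros l)
    show "\<forall>\<^sub>F n in sequentially. norm (g y - g (real n)) \<le> K * exp (- y)"
      using eventually_ge_at_top[of "nat \<lceil>y\<rceil>"]
      by eventually_elim (subst norm_minus_commute, rule diff[OF that], linarith)
  qed simp
  hence "eventually (\<lambda>y. norm (g y - l) \<le> K * exp (- y)) at_top"
    by (rule eventually_mono[OF eventually_ge_at_top[of 1]])
  from Lim_null_comparison[OF this lim0] have glim: "(g \<longlongrightarrow> l) at_top"
    using LIM_zero_iff by blast
  have "norm (G (\<i> * of_real y + 1) - g y) \<le> K * exp (- y)" if "1 \<le> y" for y
  proof -
    let ?A = "cusp_strip \<inter> {z. Im z \<ge> y}"
    have "norm (G (\<i> * of_real y + 1) - G (\<i> * of_real y)) \<le> K * exp (- y) * norm (\<i> * of_real y + 1 - \<i> * of_real y)"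
    proof (rule field_differentiable_bound[where S = ?A and f' = G'])
      show "convex ?A"
        by (intro convex_Int convex_cusp_strip convex_halfspace_Im_ge)
      fix z assume z: "z \<in> ?A"
      show "(G has_field_derivative G' z) (at z within ?A)"
        using G z cusp_strip_subset by (intro has_field_derivative_at_within[OF G]) auto
      have "K * exp (- Im z) \<le> K * exp (- y)"
        using z K0 by (intro mult_left_mono) auto
      thus "norm (G' z) \<le> K * exp (- y)"
        using K[of z] z by auto
    qed (use that in \<open>auto simp: cusp_strip_def\<close>)
    thus ?thesis
      by (simp add: g_def)
  qed
  hence "eventually (\<lambda>y. norm (G (\<i> * of_real y + 1) - g y) \<le> K * exp (- y)) at_top"
    by (rule eventually_mono[OF eventually_ge_at_top[of 1]])
  from tendsto_add[OF Lim_null_comparison[OF this lim0] glim]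
  have "((\<lambda>y::real. G (\<i> * of_real y + 1)) \<longlongrightarrow> l) at_top"
    by simp
  with glim show ?thesis
    using that unfolding g_def by blast
qed

section \<open>Modular forms as letters, and their regularized integrals\<close>

definition even_forms :: "(nat \<times> (complex \<Rightarrow> complex)) set" where
  "even_forms = {(k, f). even k \<and> 2 \<le> k \<and> f \<in> modular_forms k}"

text \<open>A letter carries its weight because a function, such as zero, need not determine it.
  Letters outside \<open>even_forms\<close> get the zero form, so that the whole type can serve as
  an alphabet of holomorphic forms; inside, the subtraction \<open>fst x - 2\<close> is
  exact.\<close>

definition letter_form :: "complex \<Rightarrow> complex \<Rightarrow> nat \<times> (complex \<Rightarrow> complex) \<Rightarrow> complex \<Rightarrow> complex" where
  "letter_form X Y x t = (if x \<in> even_forms then snd x t * (X - Y * t) ^ (fst x - 2) else 0)"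

definition letter_form_infty :: "complex \<Rightarrow> complex \<Rightarrow> nat \<times> (complex \<Rightarrow> complex) \<Rightarrow> complex \<Rightarrow> complex" where
  "letter_form_infty X Y x t = (if x \<in> even_forms then fourier_const (snd x) * (X - Y * t) ^ (fst x - 2) else 0)"

interpretation hp: letter_forms upper_half_plane "letter_form X Y" for X Y
proof
  fix x :: "nat \<times> (complex \<Rightarrow> complex)"
  show "letter_form X Y x holomorphic_on upper_half_plane"
  proof (cases "x \<in> even_forms")
    case True
    hence "snd x holomorphic_on upper_half_plane"
      by (auto simp: even_forms_def modular_forms_def)
    thus ?thesis
      using True unfolding letter_form_def[abs_def] by (auto intro!: holomorphic_intros)
  qed (simp add: letter_form_def[abs_def])
qed (rule open_upper_half_plane convex_upper_half_plane)+

interpretation cp: letter_forms UNIV "letter_form_infty X Y" for X Y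
proof
  show "letter_form_infty X Y x holomorphic_on UNIV" for x
    unfolding letter_form_infty_def[abs_def] by (cases "x \<in> even_forms") (auto intro!: holomorphic_intros)
qed auto

text \<open>The exponents k - 2 are even. This absorbs the sign of a matrix representing a cusp and
  gives the symmetry under (p, q) -> (-p, -q).\<close>

lemma letter_form_uminus: "letter_form (- X) (- Y) = letter_form X Y"
  and letter_form_infty_uminus: "letter_form_infty (- X) (- Y) = letter_form_infty X Y"
proof -
  have *: "(- X - - Y * t) ^ (fst x - 2) = (X - Y * t) ^ (fst x - 2)" if "x \<in> even_forms" for x t
  proof -
    have "even (fst x - 2)"
      using that by (auto simp: even_forms_def)
    hence "(- (X - Y * t)) ^ (fst x - 2) = (X - Y * t) ^ (fst x - 2)"
      by (rule power_minus_even)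
    thus ?thesis
      by simp
  qed
  show "letter_form (- X) (- Y) = letter_form X Y" "letter_form_infty (- X) (- Y) = letter_form_infty X Y"
    using * by (auto simp: fun_eq_iff letter_form_def letter_form_infty_def)
qed

lemma fourier_const_decay:
  assumes "x \<in> even_forms"
  obtains K where "\<And>z. z \<in> cusp_strip \<Longrightarrow> norm (snd x z - fourier_const (snd x)) \<le> K * exp (- (2 * pi * Im z))"
proof -
  obtain a where a: "fourier_expansion (snd x) a"
    using assms by (auto simp: even_forms_def modular_forms_def)
  obtain K where "\<And>z. 1 \<le> Im z \<Longrightarrow> norm (snd x z - a 0) \<le> K * exp (- (2 * pi * Im z))"
    using fourier_expansion_bound[OF a] by blast
  thus ?thesis
    using that[of K] fourier_const_eq[OF a] by (simp add: cusp_strip_def)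
qed

lemma poly_growth_linear_power: "poly_growth (\<lambda>z. (X - Y * z) ^ n)"
proof -
  have "poly_growth (\<lambda>z. (X + (- Y) * z) ^ n)"
    by (intro poly_growth_power poly_growth_add poly_growth_mult poly_growth_const poly_growth_id)
  thus ?thesis
    by simp
qed

lemma poly_growth_letter_form_infty: "poly_growth (letter_form_infty X Y x)"
  unfolding letter_form_infty_def[abs_def]
  by (cases "x \<in> even_forms") (auto intro!: poly_growth_const poly_growth_mult poly_growth_linear_power)

lemma poly_growth_letter_form: "poly_growth (letter_form X Y x)"
proof (cases "x \<in> even_forms")
  case True
  obtain K where K: "\<And>z. z \<in> cusp_strip \<Longrightarrow> norm (snd x z - fourier_const (snd x)) \<le> K * exp (- (2 * pi * Im z))"
    using fourier_const_decay[OF True] by blast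
  have "norm (snd x z) \<le> (\<bar>K\<bar> + norm (fourier_const (snd x))) * Im z ^ 0" if z: "z \<in> cusp_strip" for z
  proof -
    have "K * exp (- (2 * pi * Im z)) \<le> \<bar>K\<bar> * 1"
      using z by (intro mult_mono) (auto simp: cusp_strip_def)
    thus ?thesis
      using K[OF z] norm_triangle_sub[of "snd x z" "fourier_const (snd x)"] by simp
  qed
  hence "poly_growth (snd x)"
    unfolding poly_growth_def by (intro exI[of _ "\<bar>K\<bar> + norm (fourier_const (snd x))"] exI[of _ 0]) auto
  thus ?thesis
    using True unfolding letter_form_def[abs_def] by (simp add: poly_growth_mult poly_growth_linear_power)
qed (simp add: letter_form_def[abs_def] poly_growth_const)

text \<open>Universal counterpart of \<open>II_to_infty\<close>, indexed by words of modular
  forms.\<close>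

definition reg_integral :: "complex \<Rightarrow> complex \<Rightarrow> complex \<Rightarrow> complex \<Rightarrow>
    (nat \<times> (complex \<Rightarrow> complex)) list \<Rightarrow> complex" where
  "reg_integral X Y \<tau> s C = Lim at_top (\<lambda>y::real.
     (word_integral (letter_form X Y) \<tau> (\<i> * of_real y) \<odot>
      word_integral (letter_form_infty X Y) (\<i> * of_real y) s) C)"

text \<open>Each term of the derivative in the cut-off point contains the difference of a form and
  its constant coefficient, which decays exponentially, between factors of polynomial growth. The
  line iy + 1 is included for the sake of translation by 1.\<close>

lemma reg_integral_tendsto:
  assumes \<tau>: "\<tau> \<in> upper_half_plane"
  shows "((\<lambda>y::real. (word_integral (letter_form X Y) \<tau> (\<i> * of_real y) \<odot>
      word_integral (letter_form_infty X Y) (\<i> * of_real y) s) C) \<longlongrightarrow> reg_integral X Y \<tau> s C) at_top"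
    and "((\<lambda>y::real. (word_integral (letter_form X Y) \<tau> (\<i> * of_real y + 1) \<odot>
      word_integral (letter_form_infty X Y) (\<i> * of_real y + 1) s) C) \<longlongrightarrow> reg_integral X Y \<tau> s C) at_top"
proof -
  let ?I = "word_integral (letter_form X Y)" and ?J = "word_integral (letter_form_infty X Y)"
  define G' where "G' z = (\<Sum>i<length C. ?I \<tau> z (take i C) *
    (letter_form X Y (C ! i) z - letter_form_infty X Y (C ! i) z) * ?J z s (drop (Suc i) C))" for z
  have deriv: "((\<lambda>z. (?I \<tau> z \<odot> ?J z s) C) has_field_derivative G' z) (at z)" if "z \<in> upper_half_plane" for z
    unfolding G'_def
    by (rule nc_mult_has_derivative)
      (use hp.has_derivative_right[OF \<tau> that] cp.has_derivative_left[of z s] in \<open>simp_all del: word_integral.simps(2)\<close>)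
  have "rapid_decay (\<lambda>z. ?I \<tau> z (take i C) * (letter_form X Y x z - letter_form_infty X Y x z)
      * ?J z s (drop (Suc i) C))" for i x
  proof (cases "x \<in> even_forms")
    case True
    obtain K where K: "\<And>z. z \<in> cusp_strip \<Longrightarrow> norm (snd x z - fourier_const (snd x)) \<le> K * exp (- (2 * pi * Im z))"
      using fourier_const_decay[OF True] by blast
    have "rapid_decay (\<lambda>z. (snd x z - fourier_const (snd x)) *
        ((X - Y * z) ^ (fst x - 2) * (?I \<tau> z (take i C) * ?J z s (drop (Suc i) C))))"
      by (rule rapid_decay_mult[OF K])
        (auto intro!: poly_growth_mult poly_growth_linear_power
          hp.poly_growth_word_integral cp.poly_growth_word_integral cusp_strip_subset \<tau>
          poly_growth_letter_form poly_growth_letter_form_infty)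
    moreover have "(snd x z - fourier_const (snd x)) *
        ((X - Y * z) ^ (fst x - 2) * (?I \<tau> z (take i C) * ?J z s (drop (Suc i) C))) =
      ?I \<tau> z (take i C) * (letter_form X Y x z - letter_form_infty X Y x z) * ?J z s (drop (Suc i) C)" for z
      using True by (simp add: letter_form_def letter_form_infty_def algebra_simps)
    ultimately show ?thesis
      by simp
  qed (simp add: letter_form_def letter_form_infty_def rapid_decay_zero)
  hence "rapid_decay G'"
    unfolding G'_def by (intro rapid_decay_sum)
  from limit_at_cusp[OF deriv this] obtain l where
    l: "((\<lambda>y::real. (?I \<tau> (\<i> * of_real y) \<odot> ?J (\<i> * of_real y) s) C) \<longlongrightarrow> l) at_top"
      "((\<lambda>y::real. (?I \<tau> (\<i> * of_real y + 1) \<odot> ?J (\<i> * of_real y + 1) s) C) \<longlongrightarrow> l) at_top"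
    by blast
  moreover have "reg_integral X Y \<tau> s C = l"
    unfolding reg_integral_def by (rule tendsto_Lim[OF _ l(1)]) simp
  ultimately show "((\<lambda>y::real. (?I \<tau> (\<i> * of_real y) \<odot> ?J (\<i> * of_real y) s) C) \<longlongrightarrow> reg_integral X Y \<tau> s C) at_top"
    "((\<lambda>y::real. (?I \<tau> (\<i> * of_real y + 1) \<odot> ?J (\<i> * of_real y + 1) s) C) \<longlongrightarrow> reg_integral X Y \<tau> s C) at_top"
    by simp_all
qed

lemma eventually_upper_half_plane: "\<forall>\<^sub>F y in at_top. \<i> * complex_of_real y \<in> upper_half_plane"
  using eventually_gt_at_top[of 0] by eventually_elim (simp add: upper_half_plane_def)

lemma reg_integral_compose:
  assumes "\<tau> \<in> upper_half_plane" "\<tau>' \<in> upper_half_plane"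
  shows "reg_integral X Y \<tau> s = word_integral (letter_form X Y) \<tau> \<tau>' \<odot> reg_integral X Y \<tau>' s"
proof
  fix C
  let ?I = "word_integral (letter_form X Y)" and ?J = "word_integral (letter_form_infty X Y)"
  have "((\<lambda>y. (?I \<tau> \<tau>' \<odot> (?I \<tau>' (\<i> * of_real y) \<odot> ?J (\<i> * of_real y) s)) C) \<longlongrightarrow>
      (?I \<tau> \<tau>' \<odot> reg_integral X Y \<tau>' s) C) at_top"
    unfolding nc_mult_def[of "?I \<tau> \<tau>'"] by (intro tendsto_intros reg_integral_tendsto assms)
  moreover have "\<forall>\<^sub>F y in at_top. (?I \<tau> \<tau>' \<odot> (?I \<tau>' (\<i> * of_real y) \<odot> ?J (\<i> * of_real y) s)) C
      = (?I \<tau> (\<i> * of_real y) \<odot> ?J (\<i> * of_real y) s) C"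
    using eventually_upper_half_plane
    by eventually_elim (simp add: hp.compose[OF assms] flip: nc_mult_assoc)
  ultimately have "((\<lambda>y. (?I \<tau> (\<i> * of_real y) \<odot> ?J (\<i> * of_real y) s) C) \<longlongrightarrow>
      (?I \<tau> \<tau>' \<odot> reg_integral X Y \<tau>' s) C) at_top"
    by (rule Lim_transform_eventually)
  from tendsto_unique[OF _ reg_integral_tendsto(1)[OF assms(1)] this]
  show "reg_integral X Y \<tau> s C = (?I \<tau> \<tau>' \<odot> reg_integral X Y \<tau>' s) C"
    by simp
qed

text \<open>A shuffle relation involves finitely many coefficients, so it survives the
  coefficientwise limit.\<close>

lemma group_like_reg_integral:
  assumes "\<tau> \<in> upper_half_plane"
  shows "group_like (reg_integral X Y \<tau> s)"
proof -
  define F where "F y = word_integral (letter_form X Y) \<tau> (\<i> * of_real y) \<odot>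
      word_integral (letter_form_infty X Y) (\<i> * of_real y) s" for y :: real
  have F: "((\<lambda>y. F y C) \<longlongrightarrow> reg_integral X Y \<tau> s C) at_top" for C
    unfolding F_def by (rule reg_integral_tendsto[OF assms])
  have gl: "\<forall>\<^sub>F y in at_top. group_like (F y)"
    using eventually_upper_half_plane unfolding F_def
    by eventually_elim (intro group_like_mult hp.group_like_word_integral cp.group_like_word_integral assms, auto)
  have "reg_integral X Y \<tau> s C * reg_integral X Y \<tau> s D = shuffle_sum (reg_integral X Y \<tau> s) C D" for C D
  proof (rule tendsto_unique[of at_top])
    have "((\<lambda>y. F y C * F y D) \<longlongrightarrow> reg_integral X Y \<tau> s C * reg_integral X Y \<tau> s D) at_top"
      by (intro tendsto_intros F)
    moreover have "\<forall>\<^sub>F y in at_top. F y C * F y D = shuffle_sum (F y) C D"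
      using gl by eventually_elim (simp add: group_like_def)
    ultimately show "((\<lambda>y. shuffle_sum (F y) C D) \<longlongrightarrow> reg_integral X Y \<tau> s C * reg_integral X Y \<tau> s D) at_top"
      by (rule Lim_transform_eventually)
    show "((\<lambda>y. shuffle_sum (F y) C D) \<longlongrightarrow> shuffle_sum (reg_integral X Y \<tau> s) C D) at_top"
      by (rule shuffle_sum_tendsto[OF F])
  qed simp
  moreover have "reg_integral X Y \<tau> s [] = 1"
    by (rule tendsto_unique[OF _ F[of "[]"]]) (simp_all add: F_def)
  ultimately show ?thesis
    by (simp add: group_like_def)
qed

lemma reg_integral_Nil: "\<tau> \<in> upper_half_plane \<Longrightarrow> reg_integral X Y \<tau> s [] = 1"
  using group_like_reg_integral by (simp add: group_like_def)

lemma reg_integral_uminus: "reg_integral (- X) (- Y) = reg_integral X Y"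
  by (simp add: fun_eq_iff reg_integral_def letter_form_uminus letter_form_infty_uminus)

section \<open>Modular transformations of forms and integrals\<close>

lemma moebius_denom_nonzero:
  assumes "q * d - p * b = (1::int)" "z \<in> upper_half_plane"
  shows "of_int q - of_int p * z \<noteq> 0"
proof
  assume *: "of_int q - of_int p * z = 0"
  hence "Im (of_int q - of_int p * z) = 0"
    by simp
  hence "p = 0"
    using assms(2) by (simp add: upper_half_plane_def)
  moreover from this * have "q = 0"
    by simp
  ultimately show False
    using assms(1) by simp
qed

lemma moebius_upper_half_plane:
  assumes "q * d - p * b = (1::int)" "z \<in> upper_half_plane"
  shows "(of_int d * z - of_int b) / (of_int q - of_int p * z) \<in> upper_half_plane"
proof -
  let ?v = "of_int q - of_int p * z" and ?u = "of_int d * z - of_int b"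
  have "real_of_int q * real_of_int d - real_of_int p * real_of_int b = real_of_int (q * d - p * b)"
    by simp
  hence det: "real_of_int q * real_of_int d - real_of_int p * real_of_int b = 1"
    unfolding assms(1) by simp
  have "Im ?u * Re ?v - Re ?u * Im ?v =
      Im z * (real_of_int q * real_of_int d - real_of_int p * real_of_int b)"
    by (simp add: algebra_simps)
  hence "Im (?u / ?v) = Im z / ((Re ?v)\<^sup>2 + (Im ?v)\<^sup>2)"
    unfolding Im_divide det by simp
  moreover have "0 < (Re ?v)\<^sup>2 + (Im ?v)\<^sup>2"
    using moebius_denom_nonzero[OF assms] by (metis complex_neq_0)
  ultimately show ?thesis
    using assms(2) by (simp add: upper_half_plane_def)
qed

text \<open>The matrix (d, -b; -p, q) used here is the inverse of (q, b; p, d).\<close>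

lemma modular_form_transform:
  assumes "x \<in> even_forms" "q * d - p * b = (1::int)" "z \<in> upper_half_plane"
  shows "snd x ((of_int d * z - of_int b) / (of_int q - of_int p * z)) =
    (of_int q - of_int p * z) ^ fst x * snd x z"
proof -
  define M :: "int^2^2" where "M = vector [vector [d, - b], vector [- p, q]]"
  have M: "M $ 1 $ 1 = d" "M $ 1 $ 2 = - b" "M $ 2 $ 1 = - p" "M $ 2 $ 2 = q"
    by (simp_all add: M_def)
  have "M \<in> SL2Z"
    using assms(2) by (simp add: SL2Z_def det_2 M algebra_simps)
  hence "snd x (affine (moebius M (Fin z))) = (of_int (M$2$1) * z + of_int (M$2$2)) ^ fst x * snd x z"
    using assms(1,3) by (auto simp: even_forms_def modular_forms_def simp del: moebius.simps)
  thus ?thesis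
    using moebius_denom_nonzero[OF assms(2,3)] by (simp add: M algebra_simps)
qed

text \<open>Translation is the case p = 0, b = -1; moreover
  \<open>X + Y - Y * (z + 1) = X - Y * z\<close>.\<close>

lemma letter_form_translate: "z \<in> upper_half_plane \<Longrightarrow> letter_form (X + Y) Y x (z + 1) = letter_form X Y x z"
  using modular_form_transform[of x 1 1 0 "- 1" z] by (simp add: letter_form_def algebra_simps)

lemma letter_form_infty_translate: "letter_form_infty (X + Y) Y x (z + 1) = letter_form_infty X Y x z"
  by (simp add: letter_form_infty_def algebra_simps)

lemma word_integral_translate:
  assumes "a \<in> upper_half_plane" "b \<in> upper_half_plane"
  shows "word_integral (letter_form (X + Y) Y) (a + 1) (b + 1) = word_integral (letter_form X Y) a b"
  by (rule word_integral_substitution[where g = "\<lambda>z. z + 1" and g' = "\<lambda>_. 1",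
        OF hp.letter_forms_axioms hp.letter_forms_axioms])
    (use assms letter_form_translate in \<open>auto simp: upper_half_plane_def intro!: derivative_eq_intros\<close>)

lemma word_integral_infty_translate:
  "word_integral (letter_form_infty (X + Y) Y) (a + 1) (b + 1) = word_integral (letter_form_infty X Y) a b"
  by (rule word_integral_substitution[where g = "\<lambda>z. z + 1" and g' = "\<lambda>_. 1",
        OF cp.letter_forms_axioms cp.letter_forms_axioms])
    (use letter_form_infty_translate in \<open>auto intro!: derivative_eq_intros\<close>)

text \<open>Translation also moves the cut-off point, so the left side is computed as a limit along
  iy + 1 and compared with the limit along iy.\<close>

lemma reg_integral_translate:
  assumes "\<tau> \<in> upper_half_plane"
  shows "reg_integral (X + Y) Y (\<tau> + 1) (s + 1) = reg_integral X Y \<tau> s"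
proof
  fix C
  have "\<tau> + 1 \<in> upper_half_plane"
    using assms by (simp add: upper_half_plane_def)
  note lim = reg_integral_tendsto(2)[OF this, of "X + Y" Y "s + 1" C]
  have "\<forall>\<^sub>F y in at_top. (word_integral (letter_form (X + Y) Y) (\<tau> + 1) (\<i> * of_real y + 1) \<odot>
      word_integral (letter_form_infty (X + Y) Y) (\<i> * of_real y + 1) (s + 1)) C =
     (word_integral (letter_form X Y) \<tau> (\<i> * of_real y) \<odot>
      word_integral (letter_form_infty X Y) (\<i> * of_real y) s) C"
    using eventually_upper_half_plane
    by eventually_elim (simp add: word_integral_translate[OF assms] word_integral_infty_translate)
  from Lim_transform_eventually[OF lim this]
  show "reg_integral (X + Y) Y (\<tau> + 1) (s + 1) C = reg_integral X Y \<tau> s C"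
    by (rule tendsto_unique[rotated, OF _ reg_integral_tendsto(1)[OF assms]]) simp
qed

text \<open>With \<open>Y = 0\<close> a translation leaves the polynomial variables unchanged and
  can be iterated. This covers the freedom in the matrix chosen for a cusp.\<close>

lemma reg_integral_translate_int:
  assumes "\<tau> \<in> upper_half_plane"
  shows "reg_integral X 0 (\<tau> + of_int n) (s + of_int n) = reg_integral X 0 \<tau> s"
proof -
  have nat: "reg_integral X 0 (\<tau> + of_nat n) (s + of_nat n) = reg_integral X 0 \<tau> s"
    if "\<tau> \<in> upper_half_plane" for n \<tau> s
  proof (induction n)
    case (Suc n)
    have "\<tau> + of_nat n \<in> upper_half_plane"
      using that by (simp add: upper_half_plane_def)
    from reg_integral_translate[OF this, of X 0 "s + of_nat n"] Suc show ?case
      by (simp add: add_ac)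
  qed simp
  show ?thesis
  proof (cases n rule: int_cases2)
    case (nonneg m)
    thus ?thesis
      using nat[OF assms, of m s] by simp
  next
    case (nonpos m)
    have "\<tau> + of_int n \<in> upper_half_plane"
      using assms by (simp add: upper_half_plane_def)
    from nat[OF this, of m "s + of_int n"] show ?thesis
      using nonpos by simp
  qed
qed

text \<open>With \<open>\<gamma> = (q, b; p, d)\<close>, the form \<open>f(\<tau>) (q - p \<tau>)\<^sup>k\<^sup>-\<^sup>2 d\<tau>\<close> is the pullback of \<open>f(\<tau>) d\<tau>\<close>
  under \<open>\<gamma>\<^sup>-\<^sup>1\<close>.\<close>

lemma word_integral_moebius:
  assumes "q * d - p * b = (1::int)" "u \<in> upper_half_plane" "v \<in> upper_half_plane"
  defines "g \<equiv> \<lambda>z. (of_int d * z - of_int b) / (of_int q - of_int p * z)"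
  shows "word_integral (letter_form 1 0) (g u) (g v) = word_integral (letter_form (of_int q) (of_int p)) u v"
proof (rule word_integral_substitution[where g' = "\<lambda>z. 1 / (of_int q - of_int p * z)\<^sup>2",
      OF hp.letter_forms_axioms hp.letter_forms_axioms _ _ _ assms(2,3)])
  have "(of_int (q * d - p * b) :: complex) = 1"
    unfolding assms(1) by simp
  hence det: "(of_int q * of_int d - of_int p * of_int b :: complex) = 1"
    by simp
  fix z assume z: "z \<in> upper_half_plane"
  note nz = moebius_denom_nonzero[OF assms(1) z]
  show "g z \<in> upper_half_plane"
    unfolding g_def by (rule moebius_upper_half_plane[OF assms(1) z])
  have "(g has_field_derivative (of_int d * (of_int q - of_int p * z) - (of_int d * z - of_int b) * (- of_int p)) /
      ((of_int q - of_int p * z) * (of_int q - of_int p * z))) (at z)"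
    unfolding g_def using nz by (auto intro!: derivative_eq_intros)
  also have "of_int d * (of_int q - of_int p * z) - (of_int d * z - of_int b) * (- of_int p) = (1::complex)"
    using det by (simp add: algebra_simps)
  finally show "(g has_field_derivative 1 / (of_int q - of_int p * z)\<^sup>2) (at z)"
    by (simp add: power2_eq_square)
  fix x :: "nat \<times> (complex \<Rightarrow> complex)"
  show "letter_form 1 0 x (g z) * (1 / (of_int q - of_int p * z)\<^sup>2) =
      letter_form (of_int q) (of_int p) x z"
  proof (cases "x \<in> even_forms")
    case True
    \<comment> \<open>Two powers of the automorphy factor are cancelled by the derivative of
      \<open>g\<close>, leaving the exponent k - 2 of the letter form.\<close>
    hence "fst x = fst x - 2 + 2"
      by (auto simp: even_forms_def)
    hence "(of_int q - of_int p * z) ^ fst x =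
        (of_int q - of_int p * z) ^ (fst x - 2) * (of_int q - of_int p * z)\<^sup>2"
      by (metis power_add)
    thus ?thesis
      using modular_form_transform[OF True assms(1) z] True nz
      by (simp add: letter_form_def g_def)
  qed (simp add: letter_form_def)
qed

section \<open>The universal Dedekind symbol\<close>

text \<open>\<open>DD\<close> unfolded, with universal regularized integrals. The chosen matrix and
  the double inverse are kept so that substitution yields \<open>DD\<close> literally.\<close>

definition dedekind_series :: "int \<Rightarrow> int \<Rightarrow> (nat \<times> (complex \<Rightarrow> complex)) list \<Rightarrow> complex" where
  "dedekind_series p q =
     (let \<gamma> = (SOME \<gamma>. \<gamma> \<in> SL2Z \<and> moebius \<gamma> Infty = Fin (of_int q / of_int p)); \<delta> = matrix_inv \<gamma>
      in nc_inverse (reg_integral (of_int q) (of_int p) \<i> (of_int q / of_int p)) \<odot>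
         nc_inverse (nc_inverse (slash (\<lambda>X Y. reg_integral X Y (affine (moebius \<delta> (Fin \<i>)))
           (affine (moebius \<delta> Infty))) \<delta> (of_int q) (of_int p))))"

lemma i_upper_half_plane [simp]: "\<i> \<in> upper_half_plane"
  by (simp add: upper_half_plane_def)

section \<open>Matrices taking infinity to a given cusp\<close>

lemma matrix_inv_SL2Z:
  fixes \<gamma> :: "int^2^2"
  assumes "\<gamma> \<in> SL2Z"
  shows "matrix_inv \<gamma> = vector [vector [\<gamma>$2$2, - (\<gamma>$1$2)], vector [- (\<gamma>$2$1), \<gamma>$1$1]]" (is "_ = ?A")
proof -
  have "\<gamma>$1$1 * \<gamma>$2$2 - \<gamma>$1$2 * \<gamma>$2$1 = 1"
    using assms by (simp add: SL2Z_def det_2)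
  hence A: "\<gamma> ** ?A = mat 1" "?A ** \<gamma> = mat 1"
    by (auto simp: vec_eq_iff forall_2 matrix_matrix_mult_def sum_2 mat_def algebra_simps)
  have inv: "\<gamma> ** matrix_inv \<gamma> = mat 1 \<and> matrix_inv \<gamma> ** \<gamma> = mat 1"
    unfolding matrix_inv_def by (rule someI[of _ ?A]) (use A in simp)
  have "matrix_inv \<gamma> = matrix_inv \<gamma> ** (\<gamma> ** ?A)"
    using A by (simp add: matrix_mul_rid)
  also have "\<dots> = ?A"
    using inv by (simp add: matrix_mul_assoc matrix_mul_lid)
  finally show ?thesis .
qed

lemma moebius_cusp_exists:
  assumes "(p, q) \<in> dedekind_dom"
  shows "\<exists>\<gamma>. \<gamma> \<in> SL2Z \<and> moebius \<gamma> Infty = Fin (of_int q / of_int p)"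
proof -
  have cop: "coprime p q" and p: "p \<noteq> 0"
    using assms by (auto simp: dedekind_dom_def)
  obtain u v where "u * p + v * q = 1"
    using bezout_int[of p q] cop by (metis coprime_imp_gcd_eq_1)
  hence "(vector [vector [q, - u], vector [p, v]] :: int^2^2) \<in> SL2Z"
    by (simp add: SL2Z_def det_2 algebra_simps)
  moreover have "moebius (vector [vector [q, - u], vector [p, v]]) Infty = Fin (of_int q / of_int p)"
    using p by simp
  ultimately show ?thesis
    by blast
qed

text \<open>The first column of such a matrix and (q, p) are coprime pairs with the same quotient,
  hence agree up to sign.\<close>

lemma moebius_cusp_matrix:
  fixes \<gamma> :: "int^2^2"
  assumes "(p, q) \<in> dedekind_dom" "\<gamma> \<in> SL2Z" "moebius \<gamma> Infty = Fin (of_int q / of_int p)"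
  obtains e b d :: int where "e = 1 \<or> e = - 1" "q * d - p * b = 1"
    "\<gamma>$1$1 = e * q" "\<gamma>$2$1 = e * p" "\<gamma>$1$2 = e * b" "\<gamma>$2$2 = e * d"
proof -
  define a b c d where "a = \<gamma>$1$1" "b = \<gamma>$1$2" "c = \<gamma>$2$1" "d = \<gamma>$2$2"
  note abcd = this
  have det: "a * d - b * c = 1"
    using assms(2) by (simp add: SL2Z_def det_2 abcd)
  have c: "c \<noteq> 0" and eq: "(of_int a / of_int c :: complex) = of_int q / of_int p"
    using assms(3) by (auto simp: abcd split: if_splits)
  have cop: "coprime p q" and p: "p \<noteq> 0"
    using assms(1) by (auto simp: dedekind_dom_def)
  have "(of_int a * of_int p :: complex) = of_int q * of_int c"
    using eq c p by (simp add: field_simps)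
  hence ap: "a * p = q * c"
    by (metis of_int_eq_iff of_int_mult)
  have cop': "coprime c a"
  proof (rule coprimeI)
    fix k assume "k dvd c" "k dvd a"
    hence "k dvd a * d - b * c"
      by auto
    thus "is_unit k"
      using det by simp
  qed
  have "p dvd c"
    using ap cop by (metis coprime_dvd_mult_right_iff dvd_triv_right)
  moreover have "c dvd p"
    using ap cop' by (metis coprime_dvd_mult_right_iff dvd_triv_right)
  ultimately have "\<bar>c\<bar> = \<bar>p\<bar>"
    by (metis abs_dvd_iff dvd_abs_iff abs_ge_zero zdvd_antisym_nonneg)
  then obtain e where e: "e = 1 \<or> e = - 1" "c = e * p"
    by (metis abs_eq_iff mult_1 mult_minus1)
  have "a * p = (e * q) * p"
    using ap e(2) by (simp add: mult_ac)
  hence a: "a = e * q"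
    using p by simp
  have ee: "e * e = 1"
    using e by auto
  show ?thesis
  proof (rule that[of e "e * d" "e * b"])
    show "q * (e * d) - p * (e * b) = 1"
      using det a e(2) by (simp add: algebra_simps)
  qed (use e a ee in \<open>simp_all add: abcd[symmetric] mult.assoc[symmetric]\<close>)
qed

text \<open>Replaces the chosen matrix by any (q, b; p, d) of determinant 1. The two differ by a
  sign, harmless because weights are even, and by a multiple of the first column added to the
  second, which translates the base point and the tangential base point by the same integer.\<close>

lemma dedekind_series_eq:
  assumes dom: "(p, q) \<in> dedekind_dom" and bd: "q * d - p * b = 1"
  shows "dedekind_series p q = nc_inverse (reg_integral (of_int q) (of_int p) \<i> (of_int q / of_int p)) \<odot>
    reg_integral 1 0 ((of_int d * \<i> - of_int b) / (of_int q - of_int p * \<i>)) (- of_int d / of_int p)"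
proof -
  define \<gamma> where "\<gamma> = (SOME \<gamma>. \<gamma> \<in> SL2Z \<and> moebius \<gamma> Infty = Fin (of_int q / of_int p))"
  have \<gamma>: "\<gamma> \<in> SL2Z" "moebius \<gamma> Infty = Fin (of_int q / of_int p)"
    using someI_ex[OF moebius_cusp_exists[OF dom]] unfolding \<gamma>_def by auto
  obtain e b' d' where e: "e = 1 \<or> e = - 1" and bd': "q * d' - p * b' = 1"
    and ent: "\<gamma>$1$1 = e * q" "\<gamma>$2$1 = e * p" "\<gamma>$1$2 = e * b'" "\<gamma>$2$2 = e * d'"
    by (rule moebius_cusp_matrix[OF dom \<gamma>])
  have p: "p \<noteq> 0"
    using dom by (auto simp: dedekind_dom_def)
  define \<delta> where "\<delta> = matrix_inv \<gamma>"
  have \<delta>: "\<delta>$1$1 = e * d'" "\<delta>$1$2 = - (e * b')" "\<delta>$2$1 = - (e * p)" "\<delta>$2$2 = e * q"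
    unfolding \<delta>_def matrix_inv_SL2Z[OF \<gamma>(1)] by (simp_all add: ent)
  define w where "w = (of_int d' * \<i> - of_int b') / (of_int q - of_int p * \<i> :: complex)"
  have w: "w \<in> upper_half_plane"
    unfolding w_def by (rule moebius_upper_half_plane[OF bd']) simp
  have nz: "of_int q - of_int p * \<i> \<noteq> (0::complex)"
    by (rule moebius_denom_nonzero[OF bd']) simp
  have m1: "affine (moebius \<delta> (Fin \<i>)) = w"
    using e nz by (auto simp: \<delta> w_def divide_simps) (auto simp: algebra_simps)
  have m2: "affine (moebius \<delta> Infty) = - of_int d' / of_int p"
    using e p by (auto simp: \<delta>)
  \<comment> \<open>Evaluation at X = q, Y = p turns the transported variables into (e, 0), which
    makes integer translations available.\<close>
  have X: "of_int (\<delta>$1$1) * of_int q + of_int (\<delta>$1$2) * of_int p = (of_int e :: complex)"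
  proof -
    have "\<delta>$1$1 * q + \<delta>$1$2 * p = e * (q * d' - p * b')"
      by (simp add: \<delta> algebra_simps)
    hence "\<delta>$1$1 * q + \<delta>$1$2 * p = e"
      using bd' by simp
    thus ?thesis
      by (metis of_int_add of_int_mult)
  qed
  have Y: "of_int (\<delta>$2$1) * of_int q + of_int (\<delta>$2$2) * of_int p = (0 :: complex)"
    by (simp add: \<delta> algebra_simps)
  have "dedekind_series p q = nc_inverse (reg_integral (of_int q) (of_int p) \<i> (of_int q / of_int p)) \<odot>
      nc_inverse (nc_inverse (reg_integral (of_int e) 0 w (- of_int d' / of_int p)))"
    unfolding dedekind_series_def Let_def \<gamma>_def[symmetric] \<delta>_def[symmetric] slash_def X Y m1 m2 ..
  also have "nc_inverse (nc_inverse (reg_integral (of_int e) 0 w (- of_int d' / of_int p)))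
      = reg_integral (of_int e) 0 w (- of_int d' / of_int p)"
    by (rule nc_inverse_inverse) (simp add: reg_integral_Nil[OF w])
  also have "reg_integral (of_int e) 0 = reg_integral 1 0"
    using e reg_integral_uminus[of 1 0] by auto
  also have "reg_integral 1 0 w (- of_int d' / of_int p) =
      reg_integral 1 0 ((of_int d * \<i> - of_int b) / (of_int q - of_int p * \<i>)) (- of_int d / of_int p)"
  proof -
    have cop: "coprime p q"
      using dom by (simp add: dedekind_dom_def)
    \<comment> \<open>Both second columns solve the same Bezout equation, so they differ by an
      integer multiple of (q, p).\<close>
    have eq: "q * (d' - d) = p * (b' - b)"
      using bd bd' by (simp add: algebra_simps)
    hence "p dvd q * (d' - d)"
      by simp
    hence "p dvd d' - d"
      using cop coprime_dvd_mult_right_iff by blast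
    then obtain n where n: "d' - d = p * n"
      by blast
    hence "p * (b' - b) = p * (q * n)"
      using eq by (simp add: algebra_simps)
    hence b': "b' - b = q * n"
      using p by simp
    have dc: "d' = d + p * n" and bc: "b' = b + q * n"
      using n b' by linarith+
    let ?w = "(of_int d * \<i> - of_int b) / (of_int q - of_int p * \<i> :: complex)"
    have "?w \<in> upper_half_plane"
      by (rule moebius_upper_half_plane[OF bd]) simp
    from reg_integral_translate_int[OF this, of 1 "- n" "- of_int d / of_int p"]
    have "reg_integral 1 0 (?w + of_int (- n)) (- of_int d / of_int p + of_int (- n)) =
      reg_integral 1 0 ?w (- of_int d / of_int p)" .
    moreover have "?w + of_int (- n) = w"
      unfolding w_def dc bc using nz by (simp add: field_simps)
    moreover have "- of_int d / of_int p + of_int (- n) = (- of_int d' / of_int p :: complex)"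
      unfolding dc using p by (simp add: field_simps)
    ultimately show ?thesis
      by simp
  qed
  finally show ?thesis .
qed

lemma dedekind_dom_bezout:
  assumes "(p, q) \<in> dedekind_dom"
  obtains b d where "q * d - p * b = (1::int)"
proof -
  obtain \<gamma> where "\<gamma> \<in> SL2Z" "moebius \<gamma> Infty = Fin (of_int q / of_int p)"
    using moebius_cusp_exists[OF assms] by blast
  from moebius_cusp_matrix[OF assms this] show ?thesis
    using that by blast
qed

lemma group_like_dedekind_series:
  assumes "(p, q) \<in> dedekind_dom"
  shows "group_like (dedekind_series p q)"
proof -
  obtain b d where bd: "q * d - p * b = (1::int)"
    by (rule dedekind_dom_bezout[OF assms])
  show ?thesis
    unfolding dedekind_series_eq[OF assms bd]
    by (intro group_like_mult group_like_inverse group_like_reg_integral moebius_upper_half_plane bd) simp_all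
qed

lemma dedekind_series_uminus:
  assumes "(p, q) \<in> dedekind_dom"
  shows "dedekind_series (- p) (- q) = dedekind_series p q"
proof -
  obtain b d where bd: "q * d - p * b = (1::int)"
    by (rule dedekind_dom_bezout[OF assms])
  have dom': "(- p, - q) \<in> dedekind_dom" and bd': "- q * - d - - p * - b = 1"
    using assms bd by (simp_all add: dedekind_dom_def)
  have "(of_int (- d) * \<i> - of_int (- b)) / (of_int (- q) - of_int (- p) * \<i>) =
     (of_int d * \<i> - of_int b) / (of_int q - of_int p * \<i> :: complex)"
  proof -
    have "(of_int (- d) * \<i> - of_int (- b)) / (of_int (- q) - of_int (- p) * \<i>) =
     (- (of_int d * \<i> - of_int b)) / (- (of_int q - of_int p * \<i>) :: complex)"
      by simp
    thus ?thesis
      by (simp only: minus_divide_divide)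
  qed
  thus ?thesis
    unfolding dedekind_series_eq[OF assms bd] dedekind_series_eq[OF dom' bd']
    by (simp add: reg_integral_uminus)
qed

text \<open>For q + p the matrix is multiplied on the left by the translation. Both integrals then
  acquire the same left factor \<open>E\<close>, the integral from \<i> to \<i> + 1; it cancels
  because the first integral enters inverted.\<close>

lemma dedekind_series_translate:
  assumes dom: "(p, q) \<in> dedekind_dom" "(p, q + p) \<in> dedekind_dom"
  shows "dedekind_series p (q + p) = dedekind_series p q"
proof -
  let ?W = "\<lambda>X Y. word_integral (letter_form X Y)"
  let ?p = "of_int p :: complex" and ?q = "of_int q :: complex"
  obtain b d where bd: "q * d - p * b = (1::int)"
    by (rule dedekind_dom_bezout[OF dom(1)])
  have p: "p \<noteq> 0"
    using dom by (auto simp: dedekind_dom_def)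
  have bd': "(q + p) * d - p * (b + d) = 1"
    using bd by (simp add: algebra_simps)
  define g where "g z = (of_int d * z - of_int b) / (?q - ?p * z)" for z :: complex
  define s where "s = (- of_int d / of_int p :: complex)"
  define R where "R = reg_integral ?q ?p \<i> (?q / ?p)"
  define E where "E = ?W (?q + ?p) ?p \<i> (\<i> + 1)"
  have i1: "\<i> + 1 \<in> upper_half_plane"
    by (simp add: upper_half_plane_def)
  have im: "\<i> - 1 \<in> upper_half_plane"
    by (simp add: upper_half_plane_def)
  have g: "g z \<in> upper_half_plane" if "z \<in> upper_half_plane" for z
    unfolding g_def by (rule moebius_upper_half_plane[OF bd that])
  have "reg_integral (?q + ?p) ?p \<i> (?q / ?p + 1) = E \<odot> reg_integral (?q + ?p) ?p (\<i> + 1) (?q / ?p + 1)"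
    unfolding E_def by (rule reg_integral_compose[OF i_upper_half_plane i1])
  also have "\<dots> = E \<odot> R"
    unfolding R_def by (simp add: reg_integral_translate)
  finally have left: "reg_integral (?q + ?p) ?p \<i> (?q / ?p + 1) = E \<odot> R" .
  have "reg_integral 1 0 (g (\<i> - 1)) s = ?W 1 0 (g (\<i> - 1)) (g \<i>) \<odot> reg_integral 1 0 (g \<i>) s"
    by (rule reg_integral_compose[OF g[OF im] g[OF i_upper_half_plane]])
  \<comment> \<open>The Moebius change of variables returns to the path from \<open>\<i> - 1\<close>
    to \<open>\<i>\<close>, and translation by 1 identifies its integral with
    \<open>E\<close>.\<close>
  also have "?W 1 0 (g (\<i> - 1)) (g \<i>) = ?W ?q ?p (\<i> - 1) \<i>"
    unfolding g_def by (rule word_integral_moebius[OF bd im i_upper_half_plane])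
  also have "\<dots> = E"
    using word_integral_translate[OF im i_upper_half_plane, of ?q ?p] by (simp add: E_def)
  finally have right: "reg_integral 1 0 (g (\<i> - 1)) s = E \<odot> reg_integral 1 0 (g \<i>) s" .
  have pt: "(of_int d * \<i> - of_int (b + d)) / (of_int (q + p) - ?p * \<i>) = g (\<i> - 1)"
    by (simp add: g_def algebra_simps)
  have E0: "E [] \<noteq> 0" and R0: "R [] \<noteq> 0"
    by (simp_all add: E_def R_def reg_integral_Nil)
  have "dedekind_series p (q + p) =
      nc_inverse (reg_integral (?q + ?p) ?p \<i> (?q / ?p + 1)) \<odot> reg_integral 1 0 (g (\<i> - 1)) s"
    unfolding dedekind_series_eq[OF dom(2) bd'] pt s_def using p by (simp add: add_divide_distrib)
  also have "\<dots> = nc_inverse R \<odot> (nc_inverse E \<odot> E) \<odot> reg_integral 1 0 (g \<i>) s"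
    unfolding left right nc_inverse_mult[of E R, OF E0 R0] by (simp add: nc_mult_assoc)
  also have "\<dots> = nc_inverse R \<odot> reg_integral 1 0 (g \<i>) s"
    by (simp add: nc_inverse_left[of E, OF E0])
  also have "\<dots> = dedekind_series p q"
    unfolding dedekind_series_eq[OF dom(1) bd] R_def g_def s_def ..
  finally show ?thesis .
qed

text \<open>Substitution commutes with iterated integrals, coefficientwise limits, products and
  inverses, that is, with every operation in the construction of \<open>DD\<close>.\<close>

lemma DD_eq_nc_subst:
  assumes \<omega>: "\<And>X Y t B. Omega \<A> wt h X Y t B = (case \<phi> B of None \<Rightarrow> 0 | Some x \<Rightarrow> letter_form X Y x t)"
    and \<omega>': "\<And>X Y t B. Omega_infty \<A> wt h X Y t B = (case \<phi> B of None \<Rightarrow> 0 | Some x \<Rightarrow> letter_form_infty X Y x t)"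
    and \<phi>: "\<phi> [] = None" and dom: "(p, q) \<in> dedekind_dom"
  shows "DD \<A> wt h p q = nc_subst \<phi> (dedekind_series p q)"
proof -
  have to_infty: "II_to_infty \<A> wt h \<tau> s X Y = nc_subst \<phi> (reg_integral X Y \<tau> s)"
    if \<tau>: "\<tau> \<in> upper_half_plane" for \<tau> s X Y
  proof
    fix B
    let ?F = "\<lambda>y. word_integral (letter_form X Y) \<tau> (\<i> * of_real y) \<odot>
      word_integral (letter_form_infty X Y) (\<i> * of_real y) s"
    have "((\<lambda>y. nc_subst \<phi> (?F y) B) \<longlongrightarrow> nc_subst \<phi> (reg_integral X Y \<tau> s) B) at_top"
      by (rule nc_subst_tendsto[OF reg_integral_tendsto(1)[OF \<tau>]])
    moreover have "\<forall>\<^sub>F y in at_top. nc_subst \<phi> (?F y) B =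
        (II \<A> wt h \<tau> (\<i> * of_real y) X Y \<odot> II_infty \<A> wt h (\<i> * of_real y) s X Y) B"
      using eventually_upper_half_plane
    proof eventually_elim
      case (elim y)
      show ?case
        unfolding II_def II_infty_def nc_subst_mult
        using hp.iter_series_eq_nc_subst[OF \<tau> elim, where \<omega> = "Omega \<A> wt h X Y" and \<phi> = \<phi>, OF \<omega> \<phi>]
          cp.iter_series_eq_nc_subst[where \<omega> = "Omega_infty \<A> wt h X Y" and \<phi> = \<phi>, OF _ _ \<omega>' \<phi>]
        by simp
    qed
    ultimately have "((\<lambda>y. (II \<A> wt h \<tau> (\<i> * of_real y) X Y \<odot> II_infty \<A> wt h (\<i> * of_real y) s X Y) B)
        \<longlongrightarrow> nc_subst \<phi> (reg_integral X Y \<tau> s) B) at_top"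
      by (rule Lim_transform_eventually)
    thus "II_to_infty \<A> wt h \<tau> s X Y B = nc_subst \<phi> (reg_integral X Y \<tau> s) B"
      unfolding II_to_infty_def by (intro tendsto_Lim) auto
  qed
  have from_infty: "II_from_infty \<A> wt h s \<tau> X Y = nc_subst \<phi> (nc_inverse (reg_integral X Y \<tau> s))"
    if \<tau>: "\<tau> \<in> upper_half_plane" for \<tau> s X Y
    unfolding II_from_infty_def to_infty[OF \<tau>]
    by (rule nc_subst_inverse) (simp add: reg_integral_Nil[OF \<tau>])
  define \<gamma> where "\<gamma> = (SOME \<gamma>. \<gamma> \<in> SL2Z \<and> moebius \<gamma> Infty = Fin (of_int q / of_int p))"
  have \<gamma>: "\<gamma> \<in> SL2Z" "moebius \<gamma> Infty = Fin (of_int q / of_int p)"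
    using someI_ex[OF moebius_cusp_exists[OF dom]] unfolding \<gamma>_def by auto
  define \<delta> where "\<delta> = matrix_inv \<gamma>"
  have m: "affine (moebius \<delta> (Fin \<i>)) \<in> upper_half_plane"
  proof -
    have det: "\<gamma>$1$1 * \<gamma>$2$2 - \<gamma>$2$1 * \<gamma>$1$2 = 1"
      using \<gamma>(1) by (simp add: SL2Z_def det_2 mult.commute)
    show ?thesis
      using moebius_upper_half_plane[OF det i_upper_half_plane] moebius_denom_nonzero[OF det i_upper_half_plane]
      by (simp add: \<delta>_def matrix_inv_SL2Z[OF \<gamma>(1)])
  qed
  show ?thesis
    unfolding DD_def II_cusps_def II_to_def II_from.simps Let_def dedekind_series_def
      \<gamma>_def[symmetric] \<delta>_def[symmetric] slash_def nc_subst_mult cpoint.sel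
    by (subst from_infty[OF i_upper_half_plane], subst from_infty[OF m], subst nc_subst_inverse)
      (simp_all add: nc_inverse_Nil reg_integral_Nil[OF m] del: moebius.simps)
qed

text \<open>Only single letters can be blocks, so the word of all indices picks out the coefficient
  at \<open>fs\<close>, in which a form may be repeated.\<close>

lemma nc_subst_letters:
  assumes "\<And>B. \<phi> B = (if length B = 1 \<and> hd B < length fs then Some (fs ! hd B) else None)"
  shows "nc_subst \<phi> F [0..<length fs] = F fs"
proof -
  have "nc_subst \<phi> F [i..<length fs] = F (drop i fs)" if "i \<le> length fs" for i
    using that
  proof (induction "length fs - i" arbitrary: i F)
    case (Suc k)
    hence i: "i < length fs"
      by simp
    define D where "D = [Suc i..<length fs]"
    have up: "[i..<length fs] = i # D"
      using i by (simp add: upt_conv_Cons D_def)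
    have "(case \<phi> (i # take j D) of None \<Rightarrow> 0 | Some y \<Rightarrow> nc_subst \<phi> (\<lambda>C. F (y # C)) (drop j D)) =
        (if j = 0 then F (drop i fs) else 0)" if "j \<le> length D" for j
    proof (cases "j = 0")
      case True
      have "nc_subst \<phi> (\<lambda>C. F (fs ! i # C)) [Suc i..<length fs] = F (fs ! i # drop (Suc i) fs)"
        using Suc i by (intro Suc.hyps) auto
      thus ?thesis
        using True i assms by (simp add: D_def Cons_nth_drop_Suc)
    next
      case False
      hence "\<phi> (i # take j D) = None"
        using that assms by auto
      thus ?thesis
        using False by simp
    qed
    thus ?case
      unfolding up nc_subst.simps by (simp add: sum.delta)
  qed simp
  from this[of 0] show ?thesis
    by simp
qed

text \<open>Identifies the symbols allowed in the exponents with coefficients of the universal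
  series: longer words carry the zero form, so the substitution sees single letters only.\<close>

lemma DD_forms_eq:
  assumes "set fs \<subseteq> even_forms" "(p, q) \<in> dedekind_dom"
  shows "DD_forms fs p q = dedekind_series p q fs"
proof -
  define \<phi> where "\<phi> B = (if length B = 1 \<and> hd B < length fs then Some (fs ! hd B) else None)" for B
  let ?h = "\<lambda>B\<in>words {..<length fs}. if length B = 1 then snd (fs ! hd B) else (\<lambda>_. 0)"
  have mem: "fs ! j \<in> even_forms" if "j < length fs" for j
    using assms(1) nth_mem[OF that] by blast
  have B: "B \<in> words {..<length fs} \<and> length B = 1 \<longleftrightarrow> length B = 1 \<and> hd B < length fs" for B
    by (cases B) (auto simp: words_def)
  have wt: "word_weight (\<lambda>j. fst (fs ! j) - 2) B = fst (fs ! hd B) - 2" if "length B = 1" for B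
    using that by (cases B) (auto simp: word_weight_def)
  have "Omega {..<length fs} (\<lambda>j. fst (fs ! j) - 2) ?h X Y t B =
      (case \<phi> B of None \<Rightarrow> 0 | Some x \<Rightarrow> letter_form X Y x t)" for X Y t B
    using B[of B] mem[of "hd B"] wt[of B] by (auto simp: Omega_def \<phi>_def letter_form_def)
  moreover have "Omega_infty {..<length fs} (\<lambda>j. fst (fs ! j) - 2) ?h X Y t B =
      (case \<phi> B of None \<Rightarrow> 0 | Some x \<Rightarrow> letter_form_infty X Y x t)" for X Y t B
    using B[of B] mem[of "hd B"] wt[of B]
    by (auto simp: Omega_infty_def \<phi>_def letter_form_infty_def fourier_const_zero)
  ultimately have "DD {..<length fs} (\<lambda>j. fst (fs ! j) - 2) ?h p q = nc_subst \<phi> (dedekind_series p q)"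
    by (intro DD_eq_nc_subst assms(2)) (auto simp: \<phi>_def)
  thus ?thesis
    unfolding DD_forms_def using nc_subst_letters[of \<phi> fs, OF \<phi>_def] by simp
qed

section \<open>Uniqueness of the normalized Dedekind symbol\<close>

lemma dedekind_dom_swap: "(p, q) \<in> dedekind_dom \<Longrightarrow> (- q, p) \<in> dedekind_dom"
  by (auto simp: dedekind_dom_def coprime_commute)

text \<open>The two substitutions generate a Euclidean algorithm ending at \<open>(1, 1)\<close>.\<close>

lemma dedekind_invariant_constant:
  assumes swap: "\<And>p q. (p, q) \<in> dedekind_dom \<Longrightarrow> E p q = E (- q) p"
    and shift: "\<And>p q. (p, q) \<in> dedekind_dom \<Longrightarrow> (p, q + p) \<in> dedekind_dom \<Longrightarrow> E p (q + p) = E p q"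
  shows "(p, q) \<in> dedekind_dom \<Longrightarrow> E p q = E 1 1"
proof (induction "nat (\<bar>p\<bar> + \<bar>q\<bar>)" arbitrary: p q rule: less_induct)
  case less
  \<comment> \<open>Adding or subtracting \<open>u\<close> brings \<open>v\<close> nearer to zero,
    and |u| < |v| ensures that zero is not reached.\<close>
  have step: "E u v = E 1 1" if dom: "(u, v) \<in> dedekind_dom" and lt: "\<bar>u\<bar> < \<bar>v\<bar>"
    and size: "\<bar>u\<bar> + \<bar>v\<bar> = \<bar>p\<bar> + \<bar>q\<bar>" for u v
  proof -
    have u: "u \<noteq> 0" and cop: "coprime u v"
      using dom by (auto simp: dedekind_dom_def)
    show ?thesis
    proof (cases "0 < u * v")
      case True
      have sz: "\<bar>v - u\<bar> < \<bar>v\<bar>"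
        using True lt u by (auto simp: zero_less_mult_iff)
      have "coprime u (v - u)"
        using cop gcd_add2[of u "v - u"] by (simp add: coprime_iff_gcd_eq_1)
      hence dom': "(u, v - u) \<in> dedekind_dom"
        using u lt by (auto simp: dedekind_dom_def)
      have "E u (v - u) = E 1 1"
        using sz size dom' u by (intro less.hyps) auto
      thus ?thesis
        using shift[OF dom'] dom by simp
    next
      case False
      have "u * v \<noteq> 0"
        using dom by (simp add: dedekind_dom_def)
      hence sz: "\<bar>v + u\<bar> < \<bar>v\<bar>"
        using False lt u by (auto simp: not_less mult_le_0_iff)
      have "coprime u (v + u)"
        using cop gcd_add2[of u v] by (simp add: coprime_iff_gcd_eq_1 add.commute)
      hence dom': "(u, v + u) \<in> dedekind_dom"
        using u lt by (auto simp: dedekind_dom_def)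
      have "E u (v + u) = E 1 1"
        using sz size dom' u by (intro less.hyps) auto
      thus ?thesis
        using shift[OF dom dom'] by simp
    qed
  qed
  consider "\<bar>p\<bar> < \<bar>q\<bar>" | "\<bar>q\<bar> < \<bar>p\<bar>" | "\<bar>p\<bar> = \<bar>q\<bar>"
    by linarith
  thus ?case
  proof cases
    case 1
    thus ?thesis
      using step[of p q] less.prems by simp
  next
    case 2
    thus ?thesis
      using step[of "- q" p] swap[OF less.prems] dedekind_dom_swap[OF less.prems] by simp
  next
    case 3
    have "coprime p q"
      using less.prems by (simp add: dedekind_dom_def)
    hence "is_unit p"
      using 3 by (auto simp: abs_eq_iff)
    hence pq: "p = 1 \<or> p = - 1" "q = 1 \<or> q = - 1"
      using 3 by auto
    \<comment> \<open>The quarter turn permutes the four pairs with entries 1 and -1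
      cyclically.\<close>
    have "E 1 1 = E (- 1) 1" "E (- 1) 1 = E (- 1) (- 1)" "E (- 1) (- 1) = E 1 (- 1)"
      using swap[of 1 1] swap[of "- 1" 1] swap[of "- 1" "- 1"] by (simp_all add: dedekind_dom_def)
    thus ?thesis
      using pq by auto
  qed
qed

lemma normalized_dedekind_symbol_iff: "normalized_dedekind_symbol D \<longleftrightarrow>
   (\<forall>p q. (p, q) \<in> dedekind_dom \<longrightarrow> D p q [] \<noteq> 0) \<and>
   (\<forall>p q. (p, q) \<in> dedekind_dom \<longrightarrow> (p, q + p) \<in> dedekind_dom \<longrightarrow> D p (q + p) = D p q) \<and>
   (\<forall>p q. (p, q) \<in> dedekind_dom \<longrightarrow> D p (- q) = D (- p) q) \<and> D 1 1 = nc_one"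
  unfolding normalized_dedekind_symbol_def Ball_def split_paired_All prod.case ..

text \<open>If two normalized symbols have the same reciprocity function, their quotient
  \<open>E\<close> is invariant under the quarter turn and under q -> q + p, hence equal to its
  value 1 at (1, 1). This evaluates the definite description.\<close>

lemma dedekind_of_eq:
  assumes D: "normalized_dedekind_symbol D"
    and F: "\<And>p q. (p, q) \<in> dedekind_dom \<Longrightarrow> F p q = D p q \<odot> nc_inverse (D (- q) p)"
    and out: "\<And>p q. (p, q) \<notin> dedekind_dom \<Longrightarrow> D p q = nc_one"
  shows "dedekind_of F = D"
  unfolding dedekind_of_def
proof (rule the_equality)
  show "normalized_dedekind_symbol D \<and> (\<forall>(p, q)\<in>dedekind_dom. F p q = D p q \<odot> nc_inverse (D (- q) p)) \<and>
      (\<forall>p q. (p, q) \<notin> dedekind_dom \<longrightarrow> D p q = nc_one)"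
    using assms by auto
next
  fix D' assume D': "normalized_dedekind_symbol D' \<and>
      (\<forall>(p, q)\<in>dedekind_dom. F p q = D' p q \<odot> nc_inverse (D' (- q) p)) \<and>
      (\<forall>p q. (p, q) \<notin> dedekind_dom \<longrightarrow> D' p q = nc_one)"
  have nz: "D p q [] \<noteq> 0" "D' p q [] \<noteq> 0" if "(p, q) \<in> dedekind_dom" for p q
    using D D' that by (auto simp: normalized_dedekind_symbol_def)
  define E where "E p q = nc_inverse (D p q) \<odot> D' p q" for p q
  have "E p q = nc_one" if "(p, q) \<in> dedekind_dom" for p q
  proof -
    have "E p q = E 1 1"
    proof (rule dedekind_invariant_constant[OF _ _ that])
      fix p q assume dom: "(p, q) \<in> dedekind_dom"
      note dom' = dedekind_dom_swap[OF dom]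
      have eq: "D' p q \<odot> nc_inverse (D' (- q) p) = D p q \<odot> nc_inverse (D (- q) p)"
        using D' F dom by auto
      have "E p q = nc_inverse (D p q) \<odot> (D' p q \<odot> nc_inverse (D' (- q) p)) \<odot> D' (- q) p"
        by (simp add: E_def nc_mult_assoc nc_inverse_left[of "D' (- q) p", OF nz(2)[OF dom']])
      also have "\<dots> = (nc_inverse (D p q) \<odot> D p q) \<odot> (nc_inverse (D (- q) p) \<odot> D' (- q) p)"
        unfolding eq by (simp only: nc_mult_assoc)
      also have "\<dots> = E (- q) p"
        by (simp add: E_def nc_inverse_left[of "D p q", OF nz(1)[OF dom]])
      finally show "E p q = E (- q) p" .
    next
      fix p q assume "(p, q) \<in> dedekind_dom" "(p, q + p) \<in> dedekind_dom"
      thus "E p (q + p) = E p q"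
        using D D' by (simp add: E_def normalized_dedekind_symbol_iff)
    qed
    thus ?thesis
      using D D' by (simp add: E_def normalized_dedekind_symbol_def)
  qed
  hence "D p q = D' p q" if "(p, q) \<in> dedekind_dom" for p q
  proof -
    have "D' p q = D p q \<odot> nc_inverse (D p q) \<odot> D' p q"
      by (simp add: nc_inverse_right[of "D p q", OF nz(1)[OF that]])
    also have "\<dots> = D p q \<odot> E p q"
      by (simp add: E_def nc_mult_assoc)
    finally show ?thesis
      using \<open>\<And>q p. (p, q) \<in> dedekind_dom \<Longrightarrow> E p q = nc_one\<close>[OF that] by simp
  qed
  moreover have "D p q = D' p q" if "(p, q) \<notin> dedekind_dom" for p q
    using D' out[OF that] that by simp
  ultimately show "D' = D"
    by (intro ext) metis
qed

section \<open>The algebra spanned by the Dedekind symbols\<close>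

text \<open>\<open>U\<close> restricts the letters to the forms available in the factors.
  Combinations are lists because they later turn into lists of factors.\<close>

definition dedekind_span :: "(nat \<times> (complex \<Rightarrow> complex)) set \<Rightarrow> (int \<Rightarrow> int \<Rightarrow> complex) set" where
  "dedekind_span U = {f. \<exists>L. snd ` set L \<subseteq> lists U \<and>
     (\<forall>p q. (p, q) \<in> dedekind_dom \<longrightarrow> f p q = (\<Sum>(c, C)\<leftarrow>L. c * dedekind_series p q C))}"

lemma dedekind_spanI:
  assumes "snd ` set L \<subseteq> lists U"
    and "\<And>p q. (p, q) \<in> dedekind_dom \<Longrightarrow> f p q = (\<Sum>(c, C)\<leftarrow>L. c * dedekind_series p q C)"
  shows "f \<in> dedekind_span U"
  unfolding dedekind_span_def using assms by (intro CollectI exI[of _ L]) simp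

lemma dedekind_spanE:
  assumes "f \<in> dedekind_span U"
  obtains L where "snd ` set L \<subseteq> lists U"
    "\<And>p q. (p, q) \<in> dedekind_dom \<Longrightarrow> f p q = (\<Sum>(c, C)\<leftarrow>L. c * dedekind_series p q C)"
proof -
  from assms obtain L where "snd ` set L \<subseteq> lists U \<and>
     (\<forall>p q. (p, q) \<in> dedekind_dom \<longrightarrow> f p q = (\<Sum>(c, C)\<leftarrow>L. c * dedekind_series p q C))"
    unfolding dedekind_span_def by (elim CollectE exE)
  thus ?thesis
    by (intro that[of L]) simp_all
qed

lemma dedekind_span_generator:
  assumes "C \<in> lists U"
  shows "(\<lambda>p q. c * dedekind_series p q C) \<in> dedekind_span U"
  by (rule dedekind_spanI[of "[(c, C)]"]) (use assms in simp_all)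

lemma dedekind_span_add:
  assumes "f \<in> dedekind_span U" "g \<in> dedekind_span U"
  shows "(\<lambda>p q. f p q + g p q) \<in> dedekind_span U"
proof -
  obtain L where L: "snd ` set L \<subseteq> lists U"
    "\<And>p q. (p, q) \<in> dedekind_dom \<Longrightarrow> f p q = (\<Sum>(c, C)\<leftarrow>L. c * dedekind_series p q C)"
    by (rule dedekind_spanE[OF assms(1)]) (rule that)
  obtain M where M: "snd ` set M \<subseteq> lists U"
    "\<And>p q. (p, q) \<in> dedekind_dom \<Longrightarrow> g p q = (\<Sum>(c, C)\<leftarrow>M. c * dedekind_series p q C)"
    by (rule dedekind_spanE[OF assms(2)]) (rule that)
  show ?thesis
    by (rule dedekind_spanI[of "L @ M"]) (use L M in \<open>simp_all add: image_Un\<close>)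
qed

lemma dedekind_span_const: "(\<lambda>p q. c) \<in> dedekind_span U"
proof -
  have "dedekind_series p q [] = 1" if "(p, q) \<in> dedekind_dom" for p q
    using group_like_dedekind_series[OF that] by (simp add: group_like_def)
  thus ?thesis
    by (intro dedekind_spanI[of "[(c, [])]"]) simp_all
qed

lemma dedekind_span_sum:
  "(\<And>i. i \<in> I \<Longrightarrow> f i \<in> dedekind_span U) \<Longrightarrow> (\<lambda>p q. \<Sum>i\<in>I. f i p q) \<in> dedekind_span U"
  by (induction I rule: infinite_finite_induct) (simp_all add: dedekind_span_const dedekind_span_add)

lemma dedekind_span_cong:
  assumes "f \<in> dedekind_span U" "\<And>p q. (p, q) \<in> dedekind_dom \<Longrightarrow> g p q = f p q"
  shows "g \<in> dedekind_span U"
proof -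
  obtain L where L: "snd ` set L \<subseteq> lists U"
    "\<And>p q. (p, q) \<in> dedekind_dom \<Longrightarrow> f p q = (\<Sum>(c, C)\<leftarrow>L. c * dedekind_series p q C)"
    by (rule dedekind_spanE[OF assms(1)]) (rule that)
  show ?thesis
    by (rule dedekind_spanI[of L]) (use L assms(2) in simp_all)
qed

text \<open>The prefix \<open>P\<close> records letters already taken from the two words, which the
  recursion of \<open>shuffle_sum\<close> moves into its function argument.\<close>

lemma dedekind_span_shuffle_sum:
  assumes "P \<in> lists U" "C \<in> lists U" "C' \<in> lists U"
  shows "(\<lambda>p q. shuffle_sum (\<lambda>E. dedekind_series p q (P @ E)) C C') \<in> dedekind_span U"
  using assms
proof (induction "length C + length C'" arbitrary: P C C' rule: less_induct)
  case less
  have gen: "(\<lambda>p q. dedekind_series p q E) \<in> dedekind_span U" if "E \<in> lists U" for E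
    using dedekind_span_generator[OF that, of 1] by simp
  show ?case
  proof (cases "C = [] \<or> C' = []")
    case True
    have "P @ C \<in> lists U" "P @ C' \<in> lists U"
      using less.prems by auto
    from gen[OF this(1)] gen[OF this(2)] True show ?thesis
      by auto
  next
    case False
    then obtain x D y D' where C: "C = x # D" and C': "C' = y # D'"
      by (meson neq_Nil_conv)
    have "(\<lambda>p q. shuffle_sum (\<lambda>E. dedekind_series p q ((P @ [x]) @ E)) D C') \<in> dedekind_span U"
      using less.prems C by (intro less.hyps) auto
    moreover have "(\<lambda>p q. shuffle_sum (\<lambda>E. dedekind_series p q ((P @ [y]) @ E)) C D') \<in> dedekind_span U"
      using less.prems C' by (intro less.hyps) auto
    ultimately show ?thesis
      using dedekind_span_add by (simp add: C C')
  qed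
qed

lemma dedekind_span_scale:
  assumes "f \<in> dedekind_span U"
  shows "(\<lambda>p q. c * f p q) \<in> dedekind_span U"
proof -
  obtain L where L: "snd ` set L \<subseteq> lists U"
    "\<And>p q. (p, q) \<in> dedekind_dom \<Longrightarrow> f p q = (\<Sum>(c, C)\<leftarrow>L. c * dedekind_series p q C)"
    by (rule dedekind_spanE[OF assms]) (rule that)
  have "c * (\<Sum>(c, C)\<leftarrow>L. c * dedekind_series p q C) =
      (\<Sum>(c, C)\<leftarrow>map (\<lambda>(c', C). (c * c', C)) L. c * dedekind_series p q C)" for p q
    by (induction L) (auto simp: algebra_simps)
  moreover have "snd ` set (map (\<lambda>(c', C). (c * c', C)) L) \<subseteq> lists U"
    using L(1) by (simp add: image_image split_beta)
  ultimately show ?thesis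
    using L(2) by (intro dedekind_spanI[of "map (\<lambda>(c', C). (c * c', C)) L"]) (simp_all only:)
qed

text \<open>The shuffle relations settle products of two coefficients; bilinearity extends this, one
  list at a time.\<close>

lemma dedekind_span_mult:
  assumes "f \<in> dedekind_span U" "g \<in> dedekind_span U"
  shows "(\<lambda>p q. f p q * g p q) \<in> dedekind_span U"
proof -
  have *: "(\<lambda>p q. dedekind_series p q C * g p q) \<in> dedekind_span U" if C: "C \<in> lists U" and "g \<in> dedekind_span U" for C g
  proof -
    obtain L where L: "snd ` set L \<subseteq> lists U"
      "\<And>p q. (p, q) \<in> dedekind_dom \<Longrightarrow> g p q = (\<Sum>(c, C)\<leftarrow>L. c * dedekind_series p q C)"
      by (rule dedekind_spanE[OF \<open>g \<in> _\<close>]) (rule that)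
    have "(\<lambda>p q. dedekind_series p q C * (\<Sum>(c, C)\<leftarrow>L. c * dedekind_series p q C)) \<in> dedekind_span U"
      using L(1)
    proof (induction L)
      case (Cons d L)
      obtain c D where d: "d = (c, D)" and D: "D \<in> lists U"
        using Cons.prems by (cases d) auto
      have "(\<lambda>p q. shuffle_sum (dedekind_series p q) C D) \<in> dedekind_span U"
        using dedekind_span_shuffle_sum[of "[]" U C D] C D by simp
      hence "(\<lambda>p q. dedekind_series p q C * dedekind_series p q D) \<in> dedekind_span U"
        by (rule dedekind_span_cong) (use group_like_dedekind_series in \<open>simp add: group_like_def\<close>)
      from dedekind_span_add[OF dedekind_span_scale[OF this, of c] Cons.IH] Cons.prems show ?case
        by (simp add: d algebra_simps)
    qed (simp add: dedekind_span_const)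
    thus ?thesis
      by (rule dedekind_span_cong) (use L(2) in simp)
  qed
  obtain L where L: "snd ` set L \<subseteq> lists U"
    "\<And>p q. (p, q) \<in> dedekind_dom \<Longrightarrow> f p q = (\<Sum>(c, C)\<leftarrow>L. c * dedekind_series p q C)"
    by (rule dedekind_spanE[OF assms(1)]) (rule that)
  have "(\<lambda>p q. (\<Sum>(c, C)\<leftarrow>L. c * dedekind_series p q C) * g p q) \<in> dedekind_span U"
    using L(1)
  proof (induction L)
    case (Cons d L)
    obtain c D where d: "d = (c, D)" and D: "D \<in> lists U"
      using Cons.prems by (cases d) auto
    from dedekind_span_add[OF dedekind_span_scale[OF *[OF D assms(2)], of c] Cons.IH] Cons.prems show ?case
      by (simp add: d algebra_simps)
  qed (simp add: dedekind_span_const)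
  thus ?thesis
    by (rule dedekind_span_cong) (use L(2) in simp)
qed

lemma dedekind_span_power: "f \<in> dedekind_span U \<Longrightarrow> (\<lambda>p q. f p q ^ n) \<in> dedekind_span U"
  by (induction n) (auto intro: dedekind_span_const dedekind_span_mult)

lemma dedekind_span_nc_mult:
  assumes "\<And>B. (\<lambda>p q. F p q B) \<in> dedekind_span U" "\<And>B. (\<lambda>p q. G p q B) \<in> dedekind_span U"
  shows "(\<lambda>p q. (F p q \<odot> G p q) B) \<in> dedekind_span U"
  unfolding nc_mult_def using assms by (intro dedekind_span_sum dedekind_span_mult)

lemma dedekind_span_nc_subst:
  assumes "\<And>B x. \<phi> B = Some x \<Longrightarrow> x \<in> U"
  shows "(\<lambda>p q. nc_subst \<phi> (dedekind_series p q) B) \<in> dedekind_span U"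
proof -
  have "(\<lambda>p q. nc_subst \<phi> (\<lambda>C. dedekind_series p q (P @ C)) B) \<in> dedekind_span U" if "P \<in> lists U" for P
    using that
  proof (induction B arbitrary: P rule: length_induct)
    case (1 B)
    show ?case
    proof (cases B)
      case Nil
      thus ?thesis
        using dedekind_span_generator[OF 1(2), of 1] by simp
    next
      case (Cons x D)
      have "(\<lambda>p q. case \<phi> (x # take i D) of None \<Rightarrow> 0
          | Some y \<Rightarrow> nc_subst \<phi> (\<lambda>C. dedekind_series p q (P @ y # C)) (drop i D)) \<in> dedekind_span U" for i
      proof (cases "\<phi> (x # take i D)")
        case (Some y)
        hence "P @ [y] \<in> lists U"
          using assms 1(2) by auto
        moreover have "length (drop i D) < length B"
          using Cons by simp
        ultimately have "(\<lambda>p q. nc_subst \<phi> (\<lambda>C. dedekind_series p q ((P @ [y]) @ C)) (drop i D)) \<in> dedekind_span U"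
          by (rule 1(1)[rule_format, rotated])
        thus ?thesis
          using Some by simp
      qed (simp add: dedekind_span_const)
      thus ?thesis
        unfolding Cons nc_subst.simps by (intro dedekind_span_sum)
    qed
  qed
  from this[of "[]"] show ?thesis
    by simp
qed

section \<open>Products of elementary factors\<close>

text \<open>Scalar, word and list of forms: the data of an element of
  \<open>recip_set\<close>.\<close>

type_synonym 'a factor = "complex \<times> 'a list \<times> (nat \<times> (complex \<Rightarrow> complex)) list"

abbreviation factor_word :: "'a factor \<Rightarrow> 'a list" where
  "factor_word t \<equiv> fst (snd t)"

definition factor_coeff :: "'a factor \<Rightarrow> int \<Rightarrow> int \<Rightarrow> complex" where
  "factor_coeff t p q = fst t * (dedekind_series p q (snd (snd t)) - dedekind_series 1 1 (snd (snd t)))"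

definition factor_symbol :: "'a factor \<Rightarrow> int \<Rightarrow> int \<Rightarrow> 'a list \<Rightarrow> complex" where
  "factor_symbol t p q = nc_exp (nc_monom (factor_coeff t p q) (factor_word t))"

definition factor_recip :: "'a factor \<Rightarrow> int \<Rightarrow> int \<Rightarrow> 'a list \<Rightarrow> complex" where
  "factor_recip t p q = nc_exp (nc_monom (fst t * (DD_forms (snd (snd t)) p q - DD_forms (snd (snd t)) (- q) p)) (factor_word t))"

definition factors_symbol :: "'a factor list \<Rightarrow> int \<Rightarrow> int \<Rightarrow> 'a list \<Rightarrow> complex" where
  "factors_symbol S p q = foldl (\<lambda>P t. P \<odot> factor_symbol t p q) nc_one S"

lemma factors_symbol_Nil [simp]: "factors_symbol [] p q = nc_one"
  by (simp add: factors_symbol_def)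

lemma factors_symbol_snoc [simp]: "factors_symbol (S @ [t]) p q = factors_symbol S p q \<odot> factor_symbol t p q"
  by (simp add: factors_symbol_def)

lemma factors_symbol_append: "factors_symbol (S @ L) p q = factors_symbol S p q \<odot> factors_symbol L p q"
  by (induction L rule: rev_induct) (simp_all add: nc_mult_assoc flip: append_assoc)

lemma factors_symbol_cong:
  "dedekind_series p q = dedekind_series p' q' \<Longrightarrow> factors_symbol S p q = factors_symbol S p' q'"
  by (simp add: factors_symbol_def factor_symbol_def factor_coeff_def)

lemma factor_symbol_short:
  assumes "factor_word t \<noteq> []" "length B \<le> length (factor_word t)"
  shows "factor_symbol t p q B = nc_one B + (if factor_word t = B then factor_coeff t p q else 0)"
  using nc_exp_monom_short[OF assms] by (auto simp: factor_symbol_def)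

lemma factors_symbol_const:
  assumes "\<And>t. t \<in> set S \<Longrightarrow> factor_word t \<noteq> []"
  shows "factors_symbol S p q [] = 1"
  using assms
proof (induction S rule: rev_induct)
  case (snoc t S)
  thus ?case
    by (simp add: factor_symbol_short)
qed simp

lemma factors_symbol_1_1:
  assumes "\<And>t. t \<in> set S \<Longrightarrow> factor_word t \<noteq> []"
  shows "factors_symbol S 1 1 = nc_one"
  using assms
proof (induction S rule: rev_induct)
  case (snoc t S)
  hence "factor_symbol t 1 1 = nc_one"
    by (simp add: factor_symbol_def factor_coeff_def nc_exp_monom_0)
  thus ?case
    using snoc by simp
qed simp

text \<open>The factors depend on (p, q) only through \<open>dedekind_series\<close> and inherit its
  symmetries. The value outside the domain is the one prescribed in
  \<open>dedekind_of\<close>.\<close>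

lemma normalized_factors_symbol:
  assumes "\<And>t. t \<in> set S \<Longrightarrow> factor_word t \<noteq> []"
  shows "normalized_dedekind_symbol (\<lambda>p q. if (p, q) \<in> dedekind_dom then factors_symbol S p q else nc_one)"
  unfolding normalized_dedekind_symbol_iff
proof (intro conjI allI impI)
  fix p q assume dom: "(p, q) \<in> dedekind_dom"
  show "(if (p, q) \<in> dedekind_dom then factors_symbol S p q else nc_one) [] \<noteq> 0"
    using factors_symbol_const[OF assms] by simp
  have dom': "(- p, q) \<in> dedekind_dom" "(p, - q) \<in> dedekind_dom"
    using dom by (auto simp: dedekind_dom_def)
  show "(if (p, - q) \<in> dedekind_dom then factors_symbol S p (- q) else nc_one) =
      (if (- p, q) \<in> dedekind_dom then factors_symbol S (- p) q else nc_one)"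
    using dom' factors_symbol_cong[of p "- q" "- p" q S] dedekind_series_uminus[OF dom'(1)] by simp
  assume "(p, q + p) \<in> dedekind_dom"
  thus "(if (p, q + p) \<in> dedekind_dom then factors_symbol S p (q + p) else nc_one) =
      (if (p, q) \<in> dedekind_dom then factors_symbol S p q else nc_one)"
    using dom factors_symbol_cong[of p "q + p" p q S] dedekind_series_translate[OF dom] by simp
qed (use factors_symbol_1_1[OF assms] in simp)

text \<open>Exponentials of multiples of one word are additive in the exponent, so the quotient has
  the difference as exponent, from which the value at (1, 1) drops out.\<close>

lemma factor_recip_eq:
  assumes "set (snd (snd t)) \<subseteq> even_forms" "factor_word t \<noteq> []" and dom: "(p, q) \<in> dedekind_dom"
  shows "factor_recip t p q = factor_symbol t p q \<odot> nc_inverse (factor_symbol t (- q) p)"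
proof -
  let ?y = "factor_coeff t (- q) p"
  have "fst t * (DD_forms (snd (snd t)) p q - DD_forms (snd (snd t)) (- q) p) = factor_coeff t p q - ?y"
    using DD_forms_eq[OF assms(1)] dom dedekind_dom_swap[OF dom] by (simp add: factor_coeff_def algebra_simps)
  hence "factor_recip t p q \<odot> factor_symbol t (- q) p = factor_symbol t p q"
    using nc_exp_monom_add[OF assms(2), of "factor_coeff t p q - ?y" ?y]
    by (simp add: factor_recip_def factor_symbol_def)
  hence "factor_symbol t p q \<odot> nc_inverse (factor_symbol t (- q) p) =
      factor_recip t p q \<odot> (factor_symbol t (- q) p \<odot> nc_inverse (factor_symbol t (- q) p))"
    by (simp flip: nc_mult_assoc)
  also have "factor_symbol t (- q) p \<odot> nc_inverse (factor_symbol t (- q) p) = nc_one"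
    by (rule nc_inverse_right) (simp add: factor_symbol_short assms(2))
  finally show ?thesis
    by simp
qed

text \<open>Uniqueness identifies \<open>dedekind_of\<close> of a partial product with the product
  of the factor symbols; afterwards \<open>recip_mult\<close> only regroups.\<close>

lemma recip_partial_prod_eq:
  assumes "\<And>i. i < n \<Longrightarrow> set (snd (snd (u i))) \<subseteq> even_forms"
    and "\<And>i. i < n \<Longrightarrow> factor_word (u i) \<noteq> []" and "(p, q) \<in> dedekind_dom"
  shows "recip_partial_prod (\<lambda>i. factor_recip (u i)) n p q =
    factors_symbol (map u [0..<n]) p q \<odot> nc_inverse (factors_symbol (map u [0..<n]) (- q) p)"
  using assms
proof (induction n arbitrary: p q)
  case (Suc n)
  define F where "F = recip_partial_prod (\<lambda>i. factor_recip (u i)) n"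
  define P where "P = factors_symbol (map u [0..<n])"
  note dom = \<open>(p, q) \<in> dedekind_dom\<close> and dom' = dedekind_dom_swap[OF \<open>(p, q) \<in> dedekind_dom\<close>]
  have words: "\<And>t. t \<in> set (map u [0..<n]) \<Longrightarrow> factor_word t \<noteq> []"
    using Suc.prems(2) by auto
  have "dedekind_of F = (\<lambda>p q. if (p, q) \<in> dedekind_dom then P p q else nc_one)"
  proof (rule dedekind_of_eq)
    show "normalized_dedekind_symbol (\<lambda>p q. if (p, q) \<in> dedekind_dom then P p q else nc_one)"
      unfolding P_def by (rule normalized_factors_symbol[OF words])
    show "F p q = (if (p, q) \<in> dedekind_dom then P p q else nc_one) \<odot>
        nc_inverse (if (- q, p) \<in> dedekind_dom then P (- q) p else nc_one)"
      if "(p, q) \<in> dedekind_dom" for p q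
      using Suc.IH[of p q] Suc.prems that dedekind_dom_swap[OF that] by (simp add: F_def P_def)
  qed simp
  hence "recip_partial_prod (\<lambda>i. factor_recip (u i)) (Suc n) p q =
      P p q \<odot> factor_recip (u n) p q \<odot> nc_inverse (P (- q) p)"
    using dom dom' by (simp add: recip_mult_def F_def[symmetric])
  also have "factor_recip (u n) p q = factor_symbol (u n) p q \<odot> nc_inverse (factor_symbol (u n) (- q) p)"
    using Suc.prems by (intro factor_recip_eq dom) auto
  also have "P p q \<odot> \<dots> \<odot> nc_inverse (P (- q) p) =
      P p q \<odot> factor_symbol (u n) p q \<odot> (nc_inverse (factor_symbol (u n) (- q) p) \<odot> nc_inverse (P (- q) p))"
    by (simp only: nc_mult_assoc)
  also have "nc_inverse (factor_symbol (u n) (- q) p) \<odot> nc_inverse (P (- q) p) =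
      nc_inverse (P (- q) p \<odot> factor_symbol (u n) (- q) p)"
    using Suc.prems(2)[of n] factors_symbol_const[of "map u [0..<n]" "- q" p, OF words]
    by (intro nc_inverse_mult[symmetric]) (simp_all add: factor_symbol_short P_def)
  finally show ?case
    by (simp add: P_def)
qed simp

section \<open>Truncation and leading terms of products of factors\<close>

lemma factors_symbol_tail:
  fixes L :: "'a factor list"
  assumes "\<And>t. t \<in> set L \<Longrightarrow> length B < length (factor_word t)"
  shows "factors_symbol L p q B = nc_one B"
proof -
  have "factors_symbol L p q C = nc_one C" if "length C \<le> length B" for C
    using assms that
  proof (induction L arbitrary: C rule: rev_induct)
    case (snoc t L)
    have w: "length B < length (factor_word t)"
      using snoc.prems(1) by simp
    have "(factors_symbol L p q \<odot> factor_symbol t p q) C = (nc_one \<odot> nc_one) C"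
    proof (rule nc_mult_cong)
      fix C' :: "'a list" assume "length C' \<le> length C"
      hence C': "length C' \<le> length B"
        using snoc.prems(2) by simp
      show "factors_symbol L p q C' = nc_one C'"
        using snoc C' by simp
      have "factor_word t \<noteq> []" "factor_word t \<noteq> C'"
        using w C' by auto
      thus "factor_symbol t p q C' = nc_one C'"
        using w C' by (simp add: factor_symbol_short)
    qed
    thus ?case
      by simp
  qed simp
  thus ?thesis
    by simp
qed

text \<open>Proper cuts of \<open>B\<close> contribute nothing, so leading coefficients add.\<close>

lemma nc_mult_leading:
  assumes "F [] = 1" "G [] = 1" "B \<noteq> []"
    and "\<And>i. 0 < i \<Longrightarrow> i < length B \<Longrightarrow> F (take i B) = 0 \<or> G (drop i B) = 0"
  shows "(F \<odot> G) B = F B + G B"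
proof -
  have "(F \<odot> G) B = (\<Sum>i\<in>{0, length B}. F (take i B) * G (drop i B))"
    unfolding nc_mult_def
  proof (rule sum.mono_neutral_right)
    show "\<forall>i\<in>{..length B} - {0, length B}. F (take i B) * G (drop i B) = 0"
    proof
      fix i assume "i \<in> {..length B} - {0, length B}"
      hence "0 < i" "i < length B"
        by auto
      from assms(4)[OF this] show "F (take i B) * G (drop i B) = 0"
        by auto
    qed
  qed auto
  thus ?thesis
    using assms(1-3) by simp
qed

lemma factors_symbol_leading:
  assumes "\<And>t. t \<in> set L \<Longrightarrow> length (factor_word t) = m" "0 < length B" "length B \<le> m"
  shows "factors_symbol L p q B = (\<Sum>t\<leftarrow>L. if factor_word t = B then factor_coeff t p q else 0)"
  using assms(1)
proof (induction L rule: rev_induct)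
  case Nil
  show ?case
    using assms(2) by (simp add: nc_one_def)
next
  case (snoc t L)
  have w: "length (factor_word t) = m" "factor_word t \<noteq> []"
    using snoc.prems[of t] assms(2,3) by auto
  have "(factors_symbol L p q \<odot> factor_symbol t p q) B = factors_symbol L p q B + factor_symbol t p q B"
  proof (rule nc_mult_leading)
    show "factors_symbol L p q [] = 1"
    proof (rule factors_symbol_const)
      show "factor_word t' \<noteq> []" if "t' \<in> set L" for t'
        using snoc.prems[of t'] that assms(2,3) by auto
    qed
    show "factor_symbol t p q [] = 1" "B \<noteq> []"
      using w assms(2) by (auto simp: factor_symbol_short)
    fix i assume i: "0 < i" "i < length B"
    have "factor_symbol t p q (drop i B) = 0"
      using i assms(3) w by (subst factor_symbol_short) (auto simp: nc_one_def)
    thus "factors_symbol L p q (take i B) = 0 \<or> factor_symbol t p q (drop i B) = 0" ..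
  qed
  moreover have "factor_symbol t p q B = (if factor_word t = B then factor_coeff t p q else 0)"
    using w assms(2,3) by (subst factor_symbol_short) (auto simp: nc_one_def)
  ultimately show ?case
    using snoc by simp
qed

text \<open>At each word an exponential is a polynomial in the coefficient of its factor, so closure
  of the span under multiplication keeps partial products inside it.\<close>

lemma dedekind_span_factors_symbol:
  assumes "\<And>t. t \<in> set S \<Longrightarrow> factor_word t \<noteq> [] \<and> snd (snd t) \<in> lists U"
  shows "(\<lambda>p q. factors_symbol S p q B) \<in> dedekind_span U"
  using assms
proof (induction S arbitrary: B rule: rev_induct)
  case Nil
  show ?case
    by (simp add: dedekind_span_const)
next
  case (snoc t S)
  have t: "factor_word t \<noteq> []" "snd (snd t) \<in> lists U"
    using snoc.prems by auto
  have "(\<lambda>p q. fst t * dedekind_series p q (snd (snd t)) + - fst t * dedekind_series 1 1 (snd (snd t))) \<in> dedekind_span U"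
    by (rule dedekind_span_add[OF dedekind_span_generator[OF t(2)] dedekind_span_const])
  hence coeff: "factor_coeff t \<in> dedekind_span U"
    by (rule dedekind_span_cong) (simp add: factor_coeff_def algebra_simps)
  have "(\<lambda>p q. factor_symbol t p q B) \<in> dedekind_span U" for B
  proof -
    have "(\<lambda>p q. \<Sum>n\<le>length B. factor_coeff t p q ^ n * (nc_pow (nc_monom 1 (factor_word t)) n B / fact n)) \<in> dedekind_span U"
      by (rule dedekind_span_sum) (rule dedekind_span_mult[OF dedekind_span_power[OF coeff] dedekind_span_const])
    thus ?thesis
      by (rule dedekind_span_cong) (simp add: factor_symbol_def nc_exp_monom[OF t(1) order_refl])
  qed
  thus ?case
    unfolding factors_symbol_snoc using snoc by (intro dedekind_span_nc_mult) auto
qed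

lemma factors_symbol_supported:
  assumes "\<And>t. t \<in> set S \<Longrightarrow> factor_word t \<in> words A" "B \<notin> lists A"
  shows "factors_symbol S p q B = 0"
  using assms
proof (induction S arbitrary: B rule: rev_induct)
  case Nil
  thus ?case
    by (auto simp: nc_one_def)
next
  case (snoc t S)
  have t: "factor_word t \<noteq> []" "factor_word t \<in> lists A"
    using snoc.prems by (auto simp: words_def)
  show ?case
    unfolding factors_symbol_snoc
  proof (rule nc_mult_supported[OF _ _ snoc.prems(2)])
    show "factors_symbol S p q C = 0" if "C \<notin> lists A" for C
      using snoc that by simp
    show "factor_symbol t p q C = 0" if "C \<notin> lists A" for C
      unfolding factor_symbol_def nc_exp_monom[OF t(1) order_refl] nc_pow_monom_supported[OF t(2) that] by simp
  qed
qed

definition nontrivial_factor :: "'a factor \<Rightarrow> bool" where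
  "nontrivial_factor t \<longleftrightarrow> (\<exists>p q. (p, q) \<in> dedekind_dom \<and>
     fst t * (dedekind_series p q (snd (snd t)) - dedekind_series (- q) p (snd (snd t))) \<noteq> 0)"

text \<open>An exponent fixed by the quarter turn is constant by the Euclidean algorithm, hence zero
  after normalization.\<close>

lemma factor_coeff_trivial:
  assumes "\<not> nontrivial_factor t" "(p, q) \<in> dedekind_dom"
  shows "factor_coeff t p q = 0"
proof -
  define E where "E p q = fst t * dedekind_series p q (snd (snd t))" for p q
  have "E p q = E 1 1"
  proof (rule dedekind_invariant_constant[OF _ _ assms(2)])
    show "E p q = E (- q) p" if "(p, q) \<in> dedekind_dom" for p q
    proof -
      have "fst t * (dedekind_series p q (snd (snd t)) - dedekind_series (- q) p (snd (snd t))) = 0"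
        using assms(1) that unfolding nontrivial_factor_def by metis
      thus ?thesis
        by (simp add: E_def algebra_simps)
    qed
    show "E p (q + p) = E p q" if "(p, q) \<in> dedekind_dom" "(p, q + p) \<in> dedekind_dom" for p q
      by (simp add: E_def dedekind_series_translate[OF that])
  qed
  thus ?thesis
    by (simp add: E_def factor_coeff_def right_diff_distrib)
qed

lemma nontrivial_factor_nonempty:
  assumes "nontrivial_factor t"
  shows "snd (snd t) \<noteq> []"
proof
  assume Nil: "snd (snd t) = []"
  obtain p q where dom: "(p, q) \<in> dedekind_dom"
    and nz: "fst t * (dedekind_series p q (snd (snd t)) - dedekind_series (- q) p (snd (snd t))) \<noteq> 0"
    using assms unfolding nontrivial_factor_def by (elim exE conjE)
  show False
    using nz group_like_dedekind_series[OF dom] group_like_dedekind_series[OF dedekind_dom_swap[OF dom]]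
    by (simp add: Nil group_like_def)
qed

text \<open>Up to the length of \<open>w\<close> the exponential is 1 + c w, so the first nonzero
  component of positive length is at \<open>w\<close>; nontriviality supplies a pair (p, q) where it
  is nonzero.\<close>

lemma vanishing_level_factor:
  assumes "nontrivial_factor t" "set (snd (snd t)) \<subseteq> even_forms" "factor_word t \<noteq> []"
  shows "vanishing_level (factor_recip t) = enat (length (factor_word t))"
proof -
  let ?n = "length (factor_word t)"
  have short: "factor_recip t p q B = (if B = factor_word t then
      fst t * (dedekind_series p q (snd (snd t)) - dedekind_series (- q) p (snd (snd t))) else 0)"
    if "(p, q) \<in> dedekind_dom" "B \<noteq> []" "length B \<le> ?n" for p q B
    using nc_exp_monom_short[OF assms(3) that(3)] that(1,2) DD_forms_eq[OF assms(2)] dedekind_dom_swap[OF that(1)]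
    by (simp add: factor_recip_def nc_one_def)
  have "s \<le> ?n" if "\<forall>k. 0 < k \<and> k < s \<longrightarrow> (\<forall>B. length B = k \<longrightarrow>
      (\<forall>(p, q)\<in>dedekind_dom. factor_recip t p q B = 0))" for s
  proof (rule ccontr)
    assume "\<not> s \<le> ?n"
    hence zero: "\<forall>(p, q)\<in>dedekind_dom. factor_recip t p q (factor_word t) = 0"
      using that[rule_format, of ?n "factor_word t"] assms(3) by simp
    obtain p q where dom: "(p, q) \<in> dedekind_dom"
      and nz: "fst t * (dedekind_series p q (snd (snd t)) - dedekind_series (- q) p (snd (snd t))) \<noteq> 0"
      using assms(1) unfolding nontrivial_factor_def by blast
    have "factor_recip t p q (factor_word t) = 0"
      using zero dom by auto
    thus False
      using short[OF dom assms(3) order_refl] nz by simp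
  qed
  hence "{enat s | s. 0 < s \<and> (\<forall>k. 0 < k \<and> k < s \<longrightarrow> (\<forall>B. length B = k \<longrightarrow>
      (\<forall>(p, q)\<in>dedekind_dom. factor_recip t p q B = 0)))} \<subseteq> {..enat ?n}"
    by auto
  moreover have "enat ?n \<in> {enat s | s. 0 < s \<and> (\<forall>k. 0 < k \<and> k < s \<longrightarrow> (\<forall>B. length B = k \<longrightarrow>
      (\<forall>(p, q)\<in>dedekind_dom. factor_recip t p q B = 0)))}"
    using assms(3) short by (intro CollectI exI[of _ ?n]) auto
  ultimately show ?thesis
    unfolding vanishing_level_def by (intro antisym Sup_least Sup_upper) auto
qed

section \<open>Factorization of the symbol of a modular family\<close>

locale word_family =
  fixes \<A> :: "'a set" and wt :: "'a \<Rightarrow> nat" and h :: "'a list \<Rightarrow> complex \<Rightarrow> complex"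
  assumes finite_alphabet: "finite \<A>"
    and even_wt: "\<forall>a\<in>\<A>. even (wt a) \<and> 2 \<le> wt a"
    and modular: "h \<in> modular_family \<A> wt"
begin

definition forms :: "(nat \<times> (complex \<Rightarrow> complex)) set" where
  "forms = {(word_weight wt B + 2, h B) | B. B \<in> words \<A>}"

definition form_of :: "'a list \<Rightarrow> (nat \<times> (complex \<Rightarrow> complex)) option" where
  "form_of B = (if B \<in> words \<A> then Some (word_weight wt B + 2, h B) else None)"

lemma even_form:
  assumes "B \<in> words \<A>"
  shows "(word_weight wt B + 2, h B) \<in> even_forms"
proof -
  have "even (word_weight wt B)" if "set B \<subseteq> \<A>" for B
    using that even_wt by (induction B) (auto simp: word_weight_def)
  hence "even (word_weight wt B + 2)"
    using assms by (auto simp: words_def)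
  thus ?thesis
    using modular assms unfolding modular_family_def even_forms_def by (auto dest: PiE_mem)
qed

lemma forms_even: "forms \<subseteq> even_forms"
  using even_form by (auto simp: forms_def)

lemma DD_eq: "(p, q) \<in> dedekind_dom \<Longrightarrow> DD \<A> wt h p q = nc_subst form_of (dedekind_series p q)"
proof (rule DD_eq_nc_subst)
  show "Omega \<A> wt h X Y t B = (case form_of B of None \<Rightarrow> 0 | Some x \<Rightarrow> letter_form X Y x t)" for X Y t B
    using even_form[of B] by (cases "B \<in> words \<A>") (simp_all add: Omega_def form_of_def letter_form_def)
  show "Omega_infty \<A> wt h X Y t B = (case form_of B of None \<Rightarrow> 0 | Some x \<Rightarrow> letter_form_infty X Y x t)" for X Y t B
    using even_form[of B] by (cases "B \<in> words \<A>") (simp_all add: Omega_infty_def form_of_def letter_form_infty_def)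
  show "form_of [] = None"
    by (simp add: form_of_def words_def)
qed

text \<open>Right multiplication by the inverse value at (1, 1) normalizes the symbol, cancels in
  the reciprocity function, and keeps the coefficients in the span because that value does not
  depend on (p, q).\<close>

definition target :: "int \<Rightarrow> int \<Rightarrow> 'a list \<Rightarrow> complex" where
  "target p q = nc_subst form_of (dedekind_series p q) \<odot> nc_inverse (nc_subst form_of (dedekind_series 1 1))"

lemma dom_1_1: "(1, 1) \<in> dedekind_dom"
  by (simp add: dedekind_dom_def)

lemma series_const: "(p, q) \<in> dedekind_dom \<Longrightarrow> nc_subst form_of (dedekind_series p q) [] = 1"
  using group_like_dedekind_series by (simp add: group_like_def)

lemma target_const: "(p, q) \<in> dedekind_dom \<Longrightarrow> target p q [] = 1"
  by (simp add: target_def series_const dom_1_1 nc_inverse_Nil del: nc_subst.simps)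

lemma target_1_1: "target 1 1 = nc_one"
  unfolding target_def by (rule nc_inverse_right) (simp add: series_const dom_1_1 del: nc_subst.simps)

lemma target_span: "(\<lambda>p q. target p q B) \<in> dedekind_span forms"
  unfolding target_def
  by (intro dedekind_span_nc_mult dedekind_span_nc_subst dedekind_span_const)
    (auto simp: form_of_def forms_def split: if_splits)

lemma series_supported: "C \<notin> lists \<A> \<Longrightarrow> nc_subst form_of F C = 0"
  by (rule nc_subst_supported) (auto simp: form_of_def words_def)

lemma target_supported: "B \<notin> lists \<A> \<Longrightarrow> target p q B = 0"
  unfolding target_def
  by (rule nc_mult_supported[of \<A>], erule series_supported)
    (rule nc_inverse_supported[of _ \<A>], simp_all add: series_const dom_1_1 series_supported del: nc_subst.simps)

lemma MM_eq:
  assumes "(p, q) \<in> dedekind_dom"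
  shows "MM \<A> wt h p q = target p q \<odot> nc_inverse (target (- q) p)"
proof -
  let ?D = "\<lambda>p q. nc_subst form_of (dedekind_series p q)"
  note dom' = dedekind_dom_swap[OF assms]
  have nz: "?D 1 1 [] \<noteq> 0" "?D (- q) p [] \<noteq> 0" "nc_inverse (?D 1 1) [] \<noteq> 0"
    using series_const[OF dom_1_1] series_const[OF dom'] by (simp_all add: nc_inverse_Nil del: nc_subst.simps)
  have "target p q \<odot> nc_inverse (target (- q) p) =
      ?D p q \<odot> (nc_inverse (?D 1 1) \<odot> ?D 1 1) \<odot> nc_inverse (?D (- q) p)"
    unfolding target_def nc_inverse_mult[of "?D (- q) p" "nc_inverse (?D 1 1)", OF nz(2,3)]
      nc_inverse_inverse[of "?D 1 1", OF nz(1)] by (simp only: nc_mult_assoc)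
  also have "\<dots> = ?D p q \<odot> nc_inverse (?D (- q) p)"
    unfolding nc_inverse_left[of "?D 1 1", OF nz(1)] by simp
  finally show ?thesis
    unfolding MM_def DD_eq[OF assms] DD_eq[OF dom'] by simp
qed

definition valid :: "'a factor \<Rightarrow> bool" where
  "valid t \<longleftrightarrow> factor_word t \<in> words \<A> \<and> snd (snd t) \<in> lists forms \<and> nontrivial_factor t"

lemma validD:
  assumes "valid t"
  shows "factor_word t \<noteq> []" "set (snd (snd t)) \<subseteq> even_forms"
  using assms forms_even by (auto simp: valid_def words_def)

lemma factor_recip_in_recip_set: "valid t \<Longrightarrow> factor_recip t \<in> recip_set \<A> wt h"
  using nontrivial_factor_nonempty[of t] unfolding recip_set_def factor_recip_def[abs_def] valid_def forms_def
  by (intro CollectI exI[of _ "fst t"] exI[of _ "factor_word t"] exI[of _ "snd (snd t)"]) auto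

text \<open>Since \<open>r\<close> vanishes at (1, 1), each symbol in a representation of
  \<open>r\<close> may be replaced by its difference to its value there, which gives the coefficient
  of a factor.\<close>

lemma span_factors:
  assumes "r \<in> dedekind_span forms" "r 1 1 = 0" "w \<in> words \<A>"
  obtains L where "\<And>t. t \<in> set L \<Longrightarrow> valid t \<and> factor_word t = w"
    "\<And>p q. (p, q) \<in> dedekind_dom \<Longrightarrow> r p q = (\<Sum>t\<leftarrow>L. factor_coeff t p q)"
proof -
  obtain M where M: "snd ` set M \<subseteq> lists forms"
    "\<And>p q. (p, q) \<in> dedekind_dom \<Longrightarrow> r p q = (\<Sum>(c, C)\<leftarrow>M. c * dedekind_series p q C)"
    by (rule dedekind_spanE[OF assms(1)]) (rule that)
  define K where "K = map (\<lambda>(c, C). (c, w, C)) M"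
  \<comment> \<open>Discarded factors have coefficient zero on the domain, so the sum is
    unchanged.\<close>
  define L where "L = filter nontrivial_factor K"
  have "r p q = (\<Sum>t\<leftarrow>L. factor_coeff t p q)" if dom: "(p, q) \<in> dedekind_dom" for p q
  proof -
    have "r p q = r p q - r 1 1"
      using assms(2) by simp
    also have "\<dots> = (\<Sum>(c, C)\<leftarrow>M. c * dedekind_series p q C) - (\<Sum>(c, C)\<leftarrow>M. c * dedekind_series 1 1 C)"
      using M(2)[OF dom] M(2)[OF dom_1_1] by simp
    also have "\<dots> = (\<Sum>t\<leftarrow>K. factor_coeff t p q)"
      unfolding K_def by (induction M) (auto simp: factor_coeff_def algebra_simps)
    also have "\<dots> = (\<Sum>t\<leftarrow>L. factor_coeff t p q)"
      unfolding L_def by (rule sum_list_map_filter[symmetric]) (rule factor_coeff_trivial[OF _ dom])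
    finally show ?thesis .
  qed
  moreover have "valid t \<and> factor_word t = w" if "t \<in> set L" for t
    using that M(1) assms(3) by (auto simp: L_def K_def valid_def)
  ultimately show ?thesis
    by (intro that[of L])
qed

text \<open>Collects the corrections for finitely many words in one list, from which the test on
  \<open>factor_word\<close> recovers the error at each word.\<close>

lemma span_factors_words:
  assumes "finite Ws" "Ws \<subseteq> words \<A>"
    and "\<And>w. w \<in> Ws \<Longrightarrow> r w \<in> dedekind_span forms" "\<And>w. w \<in> Ws \<Longrightarrow> r w 1 1 = 0"
  shows "\<exists>L. (\<forall>t\<in>set L. valid t \<and> factor_word t \<in> Ws) \<and>
    (\<forall>B p q. (p, q) \<in> dedekind_dom \<longrightarrow>
      (\<Sum>t\<leftarrow>L. if factor_word t = B then factor_coeff t p q else 0) = (if B \<in> Ws then r B p q else 0))"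
  using assms
proof (induction Ws rule: finite_induct)
  case empty
  show ?case
    by (rule exI[of _ "[]"]) simp
next
  case (insert w Ws)
  have "\<exists>L. (\<forall>t\<in>set L. valid t \<and> factor_word t \<in> Ws) \<and>
    (\<forall>B p q. (p, q) \<in> dedekind_dom \<longrightarrow>
      (\<Sum>t\<leftarrow>L. if factor_word t = B then factor_coeff t p q else 0) = (if B \<in> Ws then r B p q else 0))"
    by (rule insert.IH) (use insert.prems in simp_all)
  then obtain L where L0: "(\<forall>t\<in>set L. valid t \<and> factor_word t \<in> Ws) \<and>
    (\<forall>B p q. (p, q) \<in> dedekind_dom \<longrightarrow>
      (\<Sum>t\<leftarrow>L. if factor_word t = B then factor_coeff t p q else 0) = (if B \<in> Ws then r B p q else 0))"
    by (elim exE)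
  have w: "r w \<in> dedekind_span forms" "r w 1 1 = 0" "w \<in> words \<A>"
    using insert.prems by auto
  obtain M where M: "\<And>t. t \<in> set M \<Longrightarrow> valid t \<and> factor_word t = w"
    "\<And>p q. (p, q) \<in> dedekind_dom \<Longrightarrow> r w p q = (\<Sum>t\<leftarrow>M. factor_coeff t p q)"
    by (rule span_factors[OF w]) (rule that)
  have "(\<Sum>t\<leftarrow>M. if factor_word t = B then factor_coeff t p q else 0) =
      (if B = w then \<Sum>t\<leftarrow>M. factor_coeff t p q else 0)" for B p q
    using M(1) by (induction M) simp_all
  hence "(\<Sum>t\<leftarrow>L @ M. if factor_word t = B then factor_coeff t p q else 0) =
      (if B \<in> insert w Ws then r B p q else 0)" if "(p, q) \<in> dedekind_dom" for B p q
    using L0 M(2)[OF that] that insert.hyps(2) by simp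
  moreover have "\<forall>t\<in>set (L @ M). valid t \<and> factor_word t \<in> insert w Ws"
    unfolding set_append ball_Un using L0 M(1) by simp
  ultimately show ?case
    by (intro exI[of _ "L @ M"] conjI allI impI)
qed

text \<open>Sortedness is part of the invariant because the word lengths are the vanishing
  levels.\<close>

definition approximates :: "nat \<Rightarrow> 'a factor list \<Rightarrow> bool" where
  "approximates k S \<longleftrightarrow> (\<forall>t\<in>set S. valid t \<and> length (factor_word t) \<le> k) \<and>
     sorted (map (\<lambda>t. length (factor_word t)) S) \<and>
     (\<forall>B p q. length B \<le> k \<longrightarrow> (p, q) \<in> dedekind_dom \<longrightarrow> factors_symbol S p q B = target p q B)"

text \<open>The coefficients of length \<open>k + 1\<close> of the target and of the product found so far differ by
  elements of the span of the Dedekind symbols, and a further factor of degree \<open>k + 1\<close> simply adds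
  its own leading coefficient.\<close>

lemma approximates_step:
  assumes S: "approximates k S"
  shows "\<exists>S'. approximates (Suc k) S' \<and>
    (\<exists>L. S' = S @ L \<and> (\<forall>t\<in>set L. length (factor_word t) = Suc k))"
proof -
  define Ws where "Ws = {w. set w \<subseteq> \<A> \<and> length w = Suc k}"
  define r where "r w p q = target p q w - factors_symbol S p q w" for w p q
  have SV: "\<And>t. t \<in> set S \<Longrightarrow> valid t"
    using S by (simp add: approximates_def)
  have S0: "\<And>t. t \<in> set S \<Longrightarrow> factor_word t \<noteq> []"
    using SV validD(1) by blast
  have Ws: "finite Ws" "Ws \<subseteq> words \<A>"
    unfolding Ws_def using finite_lists_length_eq[OF finite_alphabet] by (auto simp: words_def)
  have r: "r w \<in> dedekind_span forms" for w
  proof -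
    have "(\<lambda>p q. target p q w + - 1 * factors_symbol S p q w) \<in> dedekind_span forms"
      using SV S0 by (intro dedekind_span_add dedekind_span_scale target_span dedekind_span_factors_symbol)
        (auto simp: valid_def)
    thus ?thesis
      by (rule dedekind_span_cong) (simp add: r_def)
  qed
  have r1: "r w 1 1 = 0" for w
    by (simp add: r_def target_1_1 factors_symbol_1_1[OF S0])
  from span_factors_words[of Ws r, OF Ws r r1] obtain L where
    "(\<forall>t\<in>set L. valid t \<and> factor_word t \<in> Ws) \<and> (\<forall>B p q. (p, q) \<in> dedekind_dom \<longrightarrow>
      (\<Sum>t\<leftarrow>L. if factor_word t = B then factor_coeff t p q else 0) = (if B \<in> Ws then r B p q else 0))"
    by (elim exE)
  hence L: "\<And>t. t \<in> set L \<Longrightarrow> valid t \<and> factor_word t \<in> Ws"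
    "\<And>B p q. (p, q) \<in> dedekind_dom \<Longrightarrow>
      (\<Sum>t\<leftarrow>L. if factor_word t = B then factor_coeff t p q else 0) = (if B \<in> Ws then r B p q else 0)"
    by simp_all
  have len: "length (factor_word t) = Suc k" if "t \<in> set L" for t
    using L(1)[OF that] by (simp add: Ws_def)
  have "factors_symbol (S @ L) p q B = target p q B"
    if B: "length B \<le> Suc k" and dom: "(p, q) \<in> dedekind_dom" for B p q
  proof (cases "length B = Suc k")
    case False
    hence B': "length B \<le> k"
      using B by simp
    \<comment> \<open>New factors have words of length k + 1 and are invisible at shorter
      words.\<close>
    have "factors_symbol (S @ L) p q B = (factors_symbol S p q \<odot> nc_one) B"
      unfolding factors_symbol_append
      by (rule nc_mult_cong) (use len B' in \<open>auto intro!: factors_symbol_tail\<close>)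
    thus ?thesis
      using S B' dom by (simp add: approximates_def)
  next
    case True
    have "(factors_symbol S p q \<odot> factors_symbol L p q) B = factors_symbol S p q B + factors_symbol L p q B"
    proof (rule nc_mult_leading)
      show "factors_symbol S p q [] = 1"
        by (rule factors_symbol_const[OF S0])
      show "factors_symbol L p q [] = 1"
        by (rule factors_symbol_const) (use L(1) validD(1) in blast)
      show "B \<noteq> []"
        using True by auto
      fix i assume i: "0 < i" "i < length B"
      have "factors_symbol L p q (drop i B) = nc_one (drop i B)"
        using i True len by (intro factors_symbol_tail) auto
      thus "factors_symbol S p q (take i B) = 0 \<or> factors_symbol L p q (drop i B) = 0"
        using i by (simp add: nc_one_def)
    qed
    also have "factors_symbol L p q B = (if B \<in> Ws then r B p q else 0)"
      using L(2)[OF dom] factors_symbol_leading[of L "Suc k" B, OF len] True by simp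
    also have "\<dots> = r B p q"
    proof (cases "B \<in> Ws")
      case False
      \<comment> \<open>Outside the alphabet the target and the partial product both vanish, so
        there is no error to correct.\<close>
      hence "B \<notin> lists \<A>"
        using True by (auto simp: Ws_def)
      thus ?thesis
        using False target_supported factors_symbol_supported[of S \<A> B p q] SV by (simp add: r_def valid_def)
    qed simp
    finally show ?thesis
      by (simp add: factors_symbol_append r_def)
  qed
  moreover have "sorted (map (\<lambda>t. length (factor_word t)) (S @ L))"
  proof -
    have "map (\<lambda>t. length (factor_word t)) L = replicate (length L) (Suc k)"
      using len by (intro replicate_eqI) auto
    thus ?thesis
      using S by (auto simp: approximates_def sorted_append)
  qed
  ultimately have "approximates (Suc k) (S @ L)"
    using S L(1) len by (auto simp: approximates_def)
  thus ?thesis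
    using len by blast
qed

lemma reciprocity_factorization:
  "\<exists>(N :: enat) T. (\<forall>i. enat i < N \<longrightarrow> T i \<in> recip_set \<A> wt h) \<and>
     (\<forall>i. enat (Suc i) < N \<longrightarrow> vanishing_level (T i) \<le> vanishing_level (T (Suc i))) \<and>
     is_recip_prod N T (MM \<A> wt h)"
proof -
  have "approximates 0 []"
    by (simp add: approximates_def target_const)
  hence "\<exists>S. approximates 0 S" ..
  \<comment> \<open>Dependent choice along the extension relation makes the lists nested, so they
    determine one sequence of factors.\<close>
  hence "\<exists>f. \<forall>k. approximates k (f k) \<and>
      (\<exists>L. f (Suc k) = f k @ L \<and> (\<forall>t\<in>set L. length (factor_word t) = Suc k))"
    by (rule dependent_nat_choice) (rule approximates_step)
  then obtain f where f0: "\<forall>k. approximates k (f k) \<and>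
      (\<exists>L. f (Suc k) = f k @ L \<and> (\<forall>t\<in>set L. length (factor_word t) = Suc k))"
    by (elim exE)
  hence f: "\<And>k. approximates k (f k)"
    and f_Suc: "\<And>k. \<exists>L. f (Suc k) = f k @ L \<and> (\<forall>t\<in>set L. length (factor_word t) = Suc k)"
    by simp_all
  have valid_f: "valid t" if "t \<in> set (f k)" for t k
    using f[of k] that by (simp add: approximates_def)
  have f_mono: "\<exists>L. f k' = f k @ L \<and> (\<forall>t\<in>set L. k < length (factor_word t))" if "k \<le> k'" for k k'
    using that
  proof (induction rule: dec_induct)
    case (step n)
    then obtain L L' where "f n = f k @ L" "\<forall>t\<in>set L. k < length (factor_word t)"
      "f (Suc n) = f n @ L'" "\<forall>t\<in>set L'. length (factor_word t) = Suc n"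
      using f_Suc[of n] by blast
    thus ?case
      using step by (intro exI[of _ "L @ L'"]) auto
  qed simp
  \<comment> \<open>The least \<open>k\<close> is only a canonical choice: every list that is long
    enough has the same entry.\<close>
  define u where "u i = f (LEAST k. i < length (f k)) ! i" for i
  have u: "u i = f k ! i" if "i < length (f k)" for i k
  proof -
    define l where "l = (LEAST k. i < length (f k))"
    have "l \<le> k" "i < length (f l)"
      unfolding l_def using that by (auto intro: Least_le LeastI)
    then obtain L where "f k = f l @ L"
      using f_mono by blast
    thus ?thesis
      using \<open>i < length (f l)\<close> by (simp add: u_def l_def nth_append)
  qed
  have take_f: "map u [0..<n] = take n (f k)" if "n \<le> length (f k)" for n k
    using that u by (intro nth_equalityI) auto
  \<comment> \<open>Finite exactly when the nested lists stop growing.\<close>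
  define N where "N = (SUP k. enat (length (f k)))"
  define T where "T i = factor_recip (u i)" for i
  have less_N: "\<exists>k. i < length (f k)" if "enat i < N" for i
    using that by (auto simp: N_def less_SUP_iff)
  have valid_u: "valid (u i)" if "enat i < N" for i
    using less_N[OF that] u valid_f by (metis nth_mem)
  have "T i \<in> recip_set \<A> wt h" if "enat i < N" for i
    unfolding T_def by (rule factor_recip_in_recip_set[OF valid_u[OF that]])
  moreover have "vanishing_level (T i) \<le> vanishing_level (T (Suc i))" if i: "enat (Suc i) < N" for i
  proof -
    obtain k where k: "Suc i < length (f k)"
      using less_N[OF i] by blast
    have "enat i < N"
      using i by (metis Suc_ile_eq order_less_imp_le)
    note v = valid_u[OF i] valid_u[OF this]
    have level: "vanishing_level (factor_recip t) = enat (length (factor_word t))" if "valid t" for t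
      using that validD by (intro vanishing_level_factor) (auto simp: valid_def)
    have "sorted (map (\<lambda>t. length (factor_word t)) (f k))"
      using f[of k] by (simp add: approximates_def)
    hence "length (factor_word (f k ! i)) \<le> length (factor_word (f k ! Suc i))"
      using k sorted_nth_mono[of "map (\<lambda>t. length (factor_word t)) (f k)" i "Suc i"] by simp
    thus ?thesis
      unfolding T_def level[OF v(1)] level[OF v(2)] using u[of i k] u[of "Suc i" k] k by simp
  qed
  moreover have "is_recip_prod N T (MM \<A> wt h)"
    unfolding is_recip_prod_def
  proof (intro allI exI conjI impI)
    fix B :: "'a list"
    let ?m = "length B"
    \<comment> \<open>The threshold for \<open>B\<close> is the number of factors with words of
      length at most that of \<open>B\<close>; later factors have longer words.\<close>
    show "enat (length (f ?m)) \<le> N"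
      unfolding N_def by (rule SUP_upper) simp
    fix n assume n: "length (f ?m) \<le> n" "enat n \<le> N"
    have "\<exists>k. n \<le> length (f k)"
    proof (cases n)
      case (Suc j)
      hence "enat j < N"
        using n(2) by (simp add: Suc_ile_eq)
      thus ?thesis
        using less_N Suc by (auto simp: Suc_le_eq)
    qed simp
    then obtain k0 where k0: "n \<le> length (f k0)"
      by blast
    define k where "k = max ?m k0"
    obtain L where "f k = f k0 @ L"
      using f_mono[of k0 k] by (auto simp: k_def)
    hence nk: "n \<le> length (f k)"
      using k0 by simp
    obtain L where L: "f k = f ?m @ L" "\<And>t. t \<in> set L \<Longrightarrow> ?m < length (factor_word t)"
      using f_mono[of ?m k] by (auto simp: k_def)
    have S: "map u [0..<n] = f ?m @ take (n - length (f ?m)) L"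
      using take_f[OF nk] n(1) L(1) by simp
    have agree: "factors_symbol (map u [0..<n]) p q C = target p q C"
      if C: "length C \<le> ?m" and dom: "(p, q) \<in> dedekind_dom" for p q C
    proof -
      have "factors_symbol (map u [0..<n]) p q C = (factors_symbol (f ?m) p q \<odot> nc_one) C"
        unfolding S factors_symbol_append
      proof (rule nc_mult_cong)
        fix C' :: "'a list" assume "length C' \<le> length C"
        thus "factors_symbol (take (n - length (f ?m)) L) p q C' = nc_one C'"
          using C L(2) by (intro factors_symbol_tail) (meson in_set_takeD le_less_trans order_trans)
      qed simp
      thus ?thesis
        using f[of ?m] C dom by (simp add: approximates_def)
    qed
    have valid_lt: "valid (u i)" if "i < n" for i
      using u[of i k] valid_f[of "f k ! i" k] that nk by simp
    have "recip_partial_prod T n p q B = MM \<A> wt h p q B" if dom: "(p, q) \<in> dedekind_dom" for p q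
    proof -
      note dom' = dedekind_dom_swap[OF dom]
      have "recip_partial_prod T n p q = factors_symbol (map u [0..<n]) p q \<odot>
          nc_inverse (factors_symbol (map u [0..<n]) (- q) p)"
        unfolding T_def[abs_def] using valid_lt validD by (intro recip_partial_prod_eq dom) auto
      hence "recip_partial_prod T n p q B = (factors_symbol (map u [0..<n]) p q \<odot>
          nc_inverse (factors_symbol (map u [0..<n]) (- q) p)) B"
        by simp
      also have "\<dots> = (target p q \<odot> nc_inverse (target (- q) p)) B"
      proof (rule nc_mult_cong)
        fix C :: "'a list" assume C: "length C \<le> length B"
        show "factors_symbol (map u [0..<n]) p q C = target p q C"
          by (rule agree[OF C dom])
        show "nc_inverse (factors_symbol (map u [0..<n]) (- q) p) C = nc_inverse (target (- q) p) C"
        proof (rule nc_inverse_cong)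
          show "factors_symbol (map u [0..<n]) (- q) p [] \<noteq> 0"
            using agree[of "[]", OF _ dom'] target_const[OF dom'] by simp
          show "factors_symbol (map u [0..<n]) (- q) p C' = target (- q) p C'" if "length C' \<le> length C" for C'
            using that C by (intro agree dom') simp
        qed
      qed
      finally show ?thesis
        using MM_eq[OF dom] by simp
    qed
    thus "\<forall>(p, q)\<in>dedekind_dom. recip_partial_prod T n p q B = MM \<A> wt h p q B"
      by auto
  qed
  ultimately show ?thesis
    by blast
qed

end

theorem theorem5p11:
  fixes \<A> :: "'a set" and wt :: "'a \<Rightarrow> nat" and h :: "'a list \<Rightarrow> complex \<Rightarrow> complex"
  assumes "finite \<A>"
    and "\<forall>a\<in>\<A>. even (wt a) \<and> 2 \<le> wt a"
    and "h \<in> modular_family \<A> wt"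
  shows "\<exists>(N :: enat) (T :: nat \<Rightarrow> int \<Rightarrow> int \<Rightarrow> 'a list \<Rightarrow> complex).
           (\<forall>i. enat i < N \<longrightarrow> T i \<in> recip_set \<A> wt h) \<and>
           (\<forall>i. enat (Suc i) < N \<longrightarrow> vanishing_level (T i) \<le> vanishing_level (T (Suc i))) \<and>
           is_recip_prod N T (MM \<A> wt h)"
proof -
  interpret word_family \<A> wt h
    using assms by unfold_locales
  show ?thesis
    by (rule reciprocity_factorization)
qed

end
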